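(* Let $Q$ be a located subset of a complete enough metric space $(X,\rho)$, and let $x\in X$ be such that for every $z\in X$, either $z\neq x$ or $z\notin Q$. Then either $\rho(Q,x)>0$ or $\rho(Q,x)=0$. Furthermore, in case the second alternative holds, LPO holds.
   Context: The setting is Bishop-style constructive mathematics: intuitionistic logic (no law of excluded middle), with countable and dependent choice allowed. "Either $A$ or $B$" is the constructive disjunction $A\lor B$. In a metric space, $z\neq x$ means $\rho(z,x)>0$. A subset $A$ of a metric space $(X,\rho)$ is located if the distance $\rho(A,x)=\inf\{\rho(a,x):a\in A\}$ exists for all $x\in X$. "Complete enough" is an informal condition, weaker than completeness: $X$ need only contain the limits of the particular Cauchy sequences used in the argument (every complete metric space qualifies). These sequences are of two kinds, built from a sequence $(q_n)_{n\geqslant1}$ in $Q$ and an increasing (i.e. non-decreasing) binary sequence $(\lambda_n)_{n\geqslant1}$ with, say, $\lambda_1=0$: (i) when $\rho(q_n,x)<2^{-n}$ for each $n$ with $\lambda_n=0$, the sequence whose $n$-th term is $x$ if $\lambda_n=0$, and is $q_m$ if $\lambda_n=1$, where $m$ is the index with $\lambda_m=0$ and $\lambda_{m+1}=1$; (ii) when $\rho(q_n,x)<2^{-n}$ for all $n$, the sequence whose $n$-th term is $q_n$ if $\lambda_n=0$, and is $q_m$ if $\lambda_n=1$, with $m$ as before. LPO (the limited principle of omniscience) is the statement: for every binary sequence $(a_n)_{n\geqslant1}$, either $a_n=0$ for all $n$ or there exists $n$ with $a_n=1$. *)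

theory Defs
  imports Main
begin

text \<open>
  In HOL every proposition satisfies excluded middle, so that a constructive disjunction and LPO,
  rendered as HOL propositions, would be trivially true.  What is formalised here is therefore
  provability in a formal system for Bishop-style constructive mathematics: a many-sorted
  intuitionistic first-order theory with the natural numbers (full induction), the rational
  numbers, sequences, and the schemes of countable and dependent choice.  The calculus contains
  neither excluded middle nor Markov's principle, nor any extensionality axiom.

  An arbitrary metric space is given by an uninterpreted sort \<open>Pt\<close> with an uninterpreted function
  symbol \<open>Dist\<close>, and an arbitrary subset of it by an uninterpreted predicate symbol \<open>InQ\<close>.
  No axiom mentions \<open>Dist\<close> or \<open>InQ\<close> (they may occur in instances of the schemes, like everything
  else); what is assumed about them appears as hypotheses in the derived formula.
  A derivation is thus uniform in the metric space and in the subset.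
\<close>


section \<open>Syntax\<close>

datatype sort = Nat | Rat | Pt | Seq sort

datatype fsym =
    Zero | Succ | NAdd | NMul
  | OfNat | QAdd | QNeg | QMul | QInv | QPow
  | Ap sort  \<comment> \<open>the term with the given index of a sequence\<close>
  | RConst | RAdd | RNeg  \<comment> \<open>operations on real numbers, which are sequences of rationals\<close>
  | Dist

fun fsym_args :: "fsym \<Rightarrow> sort list" where
  "fsym_args Zero = []"
| "fsym_args Succ = [Nat]"
| "fsym_args NAdd = [Nat, Nat]"
| "fsym_args NMul = [Nat, Nat]"
| "fsym_args OfNat = [Nat]"
| "fsym_args QAdd = [Rat, Rat]"
| "fsym_args QNeg = [Rat]"
| "fsym_args QMul = [Rat, Rat]"
| "fsym_args QInv = [Rat]"
| "fsym_args QPow = [Rat, Nat]"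
| "fsym_args (Ap s) = [Seq s, Nat]"
| "fsym_args RConst = [Rat]"
| "fsym_args RAdd = [Seq Rat, Seq Rat]"
| "fsym_args RNeg = [Seq Rat]"
| "fsym_args Dist = [Pt, Pt]"

fun fsym_result :: "fsym \<Rightarrow> sort" where
  "fsym_result Zero = Nat"
| "fsym_result Succ = Nat"
| "fsym_result NAdd = Nat"
| "fsym_result NMul = Nat"
| "fsym_result OfNat = Rat"
| "fsym_result QAdd = Rat"
| "fsym_result QNeg = Rat"
| "fsym_result QMul = Rat"
| "fsym_result QInv = Rat"
| "fsym_result QPow = Rat"
| "fsym_result (Ap s) = s"
| "fsym_result RConst = Seq Rat"
| "fsym_result RAdd = Seq Rat"
| "fsym_result RNeg = Seq Rat"
| "fsym_result Dist = Seq Rat"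

datatype psym = Equal sort | QLess | InQ

fun psym_args :: "psym \<Rightarrow> sort list" where
  "psym_args (Equal s) = [s, s]"
| "psym_args QLess = [Rat, Rat]"
| "psym_args InQ = [Pt]"

text \<open>
  Locally nameless representation: free variables are the parameters \<open>Par a s\<close> with name \<open>a\<close> and
  sort \<open>s\<close>; bound variables are de Bruijn indices.
\<close>

datatype tm = Par nat sort | Bound nat | Fn fsym "tm list"

datatype fm =
    Pr psym "tm list"
  | Falsum  ("\<^bold>\<bottom>")
  | And fm fm  (infixr "\<^bold>\<and>" 35)
  | Or fm fm  (infixr "\<^bold>\<or>" 30)
  | Imp fm fm  (infixr "\<^bold>\<longrightarrow>" 25)
  | All sort fm
  | Ex sort fm

abbreviation Neg :: "fm \<Rightarrow> fm"  ("\<^bold>\<not> _" [40] 40)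
  where "\<^bold>\<not> A \<equiv> A \<^bold>\<longrightarrow> \<^bold>\<bottom>"

text \<open>In \<open>has_sort \<Delta> t s\<close> and \<open>wf \<Delta> A\<close> the list \<open>\<Delta>\<close> gives the sorts of the dangling indices.\<close>

inductive has_sort :: "sort list \<Rightarrow> tm \<Rightarrow> sort \<Rightarrow> bool" where
  "has_sort \<Delta> (Par a s) s"
| "i < length \<Delta> \<Longrightarrow> has_sort \<Delta> (Bound i) (\<Delta> ! i)"
| "list_all2 (has_sort \<Delta>) ts (fsym_args f) \<Longrightarrow> has_sort \<Delta> (Fn f ts) (fsym_result f)"

primrec wf :: "sort list \<Rightarrow> fm \<Rightarrow> bool" where
  "wf \<Delta> (Pr p ts) \<longleftrightarrow> list_all2 (has_sort \<Delta>) ts (psym_args p)"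
| "wf \<Delta> \<^bold>\<bottom> \<longleftrightarrow> True"
| "wf \<Delta> (A \<^bold>\<and> B) \<longleftrightarrow> wf \<Delta> A \<and> wf \<Delta> B"
| "wf \<Delta> (A \<^bold>\<or> B) \<longleftrightarrow> wf \<Delta> A \<and> wf \<Delta> B"
| "wf \<Delta> (A \<^bold>\<longrightarrow> B) \<longleftrightarrow> wf \<Delta> A \<and> wf \<Delta> B"
| "wf \<Delta> (All s A) \<longleftrightarrow> wf (s # \<Delta>) A"
| "wf \<Delta> (Ex s A) \<longleftrightarrow> wf (s # \<Delta>) A"

primrec names_tm :: "tm \<Rightarrow> nat set" where
  "names_tm (Par a s) = {a}"
| "names_tm (Bound i) = {}"
| "names_tm (Fn f ts) = \<Union> (set (map names_tm ts))"

primrec names :: "fm \<Rightarrow> nat set" where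
  "names (Pr p ts) = \<Union> (set (map names_tm ts))"
| "names \<^bold>\<bottom> = {}"
| "names (A \<^bold>\<and> B) = names A \<union> names B"
| "names (A \<^bold>\<or> B) = names A \<union> names B"
| "names (A \<^bold>\<longrightarrow> B) = names A \<union> names B"
| "names (All s A) = names A"
| "names (Ex s A) = names A"

text \<open>\<open>opn k t A\<close> replaces the dangling index \<open>k\<close> by the term \<open>t\<close>, which has no dangling indices.\<close>

primrec opn_tm :: "nat \<Rightarrow> tm \<Rightarrow> tm \<Rightarrow> tm" where
  "opn_tm k t (Par a s) = Par a s"
| "opn_tm k t (Bound i) = (if i = k then t else Bound i)"
| "opn_tm k t (Fn f ts) = Fn f (map (opn_tm k t) ts)"

primrec opn :: "nat \<Rightarrow> tm \<Rightarrow> fm \<Rightarrow> fm" where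
  "opn k t (Pr p ts) = Pr p (map (opn_tm k t) ts)"
| "opn k t \<^bold>\<bottom> = \<^bold>\<bottom>"
| "opn k t (A \<^bold>\<and> B) = (opn k t A \<^bold>\<and> opn k t B)"
| "opn k t (A \<^bold>\<or> B) = (opn k t A \<^bold>\<or> opn k t B)"
| "opn k t (A \<^bold>\<longrightarrow> B) = (opn k t A \<^bold>\<longrightarrow> opn k t B)"
| "opn k t (All s A) = All s (opn (Suc k) t A)"
| "opn k t (Ex s A) = Ex s (opn (Suc k) t A)"

text \<open>\<open>cls k a s A\<close> replaces the parameter \<open>Par a s\<close> by the index \<open>k\<close>.\<close>

primrec cls_tm :: "nat \<Rightarrow> nat \<Rightarrow> sort \<Rightarrow> tm \<Rightarrow> tm" where
  "cls_tm k a s (Par b r) = (if b = a \<and> r = s then Bound k else Par b r)"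
| "cls_tm k a s (Bound i) = Bound i"
| "cls_tm k a s (Fn f ts) = Fn f (map (cls_tm k a s) ts)"

primrec cls :: "nat \<Rightarrow> nat \<Rightarrow> sort \<Rightarrow> fm \<Rightarrow> fm" where
  "cls k a s (Pr p ts) = Pr p (map (cls_tm k a s) ts)"
| "cls k a s \<^bold>\<bottom> = \<^bold>\<bottom>"
| "cls k a s (A \<^bold>\<and> B) = (cls k a s A \<^bold>\<and> cls k a s B)"
| "cls k a s (A \<^bold>\<or> B) = (cls k a s A \<^bold>\<or> cls k a s B)"
| "cls k a s (A \<^bold>\<longrightarrow> B) = (cls k a s A \<^bold>\<longrightarrow> cls k a s B)"
| "cls k a s (All r A) = All r (cls (Suc k) a s A)"
| "cls k a s (Ex r A) = Ex r (cls (Suc k) a s A)"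

text \<open>
  Notation for quantifiers: \<open>\<^bold>\<forall>x:s. A x\<close> stands for the formula obtained by evaluating the
  (uniform) map \<open>A\<close> at a parameter that does not occur in it and binding this parameter.
  The dummy argument \<open>Fn Zero []\<close> only serves to read off the parameters that occur in \<open>A\<close> itself.
\<close>

definition fresh_name :: "(tm \<Rightarrow> fm) \<Rightarrow> nat" where
  "fresh_name A = Suc (Max (insert 0 (names (A (Fn Zero [])))))"

definition Forall :: "sort \<Rightarrow> (tm \<Rightarrow> fm) \<Rightarrow> fm" where
  "Forall s A = All s (cls 0 (fresh_name A) s (A (Par (fresh_name A) s)))"

definition Exists :: "sort \<Rightarrow> (tm \<Rightarrow> fm) \<Rightarrow> fm" where
  "Exists s A = Ex s (cls 0 (fresh_name A) s (A (Par (fresh_name A) s)))"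

syntax
  "_Forall" :: "pttrn \<Rightarrow> sort \<Rightarrow> fm \<Rightarrow> fm"  ("(3\<^bold>\<forall>_:_./ _)" [0, 0, 10] 10)
  "_Exists" :: "pttrn \<Rightarrow> sort \<Rightarrow> fm \<Rightarrow> fm"  ("(3\<^bold>\<exists>_:_./ _)" [0, 0, 10] 10)
translations
  "\<^bold>\<forall>x:s. A" \<rightleftharpoons> "CONST Forall s (\<lambda>x. A)"
  "\<^bold>\<exists>x:s. A" \<rightleftharpoons> "CONST Exists s (\<lambda>x. A)"

lemma "(\<^bold>\<forall>x:Pt. (\<^bold>\<exists>y:Pt. Pr (Equal Pt) [y, x]) \<^bold>\<and> Pr InQ [x]) =
    All Pt (Ex Pt (Pr (Equal Pt) [Bound 0, Bound 1]) \<^bold>\<and> Pr InQ [Bound 0])"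
  by (simp add: Forall_def Exists_def fresh_name_def)

text \<open>Instances of the formula variables of the axiom schemes.\<close>

abbreviation inst1 :: "fm \<Rightarrow> tm \<Rightarrow> fm"  ("_\<langle>_\<rangle>" [1000, 0] 1000)
  where "A\<langle>t\<rangle> \<equiv> opn 0 t A"

abbreviation inst2 :: "fm \<Rightarrow> tm \<Rightarrow> tm \<Rightarrow> fm"  ("_\<langle>_,_\<rangle>" [1000, 0, 0] 1000)
  where "A\<langle>t,u\<rangle> \<equiv> opn 0 t (opn 1 u A)"

abbreviation zero :: tm  ("0\<^sub>N") where "0\<^sub>N \<equiv> Fn Zero []"
abbreviation succ :: "tm \<Rightarrow> tm"  where "succ m \<equiv> Fn Succ [m]"
abbreviation one :: tm  ("1\<^sub>N") where "1\<^sub>N \<equiv> succ 0\<^sub>N"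
abbreviation nadd :: "tm \<Rightarrow> tm \<Rightarrow> tm"  (infixl "+\<^sub>N" 65) where "m +\<^sub>N n \<equiv> Fn NAdd [m, n]"
abbreviation nmul :: "tm \<Rightarrow> tm \<Rightarrow> tm"  (infixl "*\<^sub>N" 70) where "m *\<^sub>N n \<equiv> Fn NMul [m, n]"

abbreviation of_N :: "tm \<Rightarrow> tm"  where "of_N n \<equiv> Fn OfNat [n]"
abbreviation qadd :: "tm \<Rightarrow> tm \<Rightarrow> tm"  (infixl "+\<^sub>Q" 65) where "p +\<^sub>Q q \<equiv> Fn QAdd [p, q]"
abbreviation qneg :: "tm \<Rightarrow> tm"  ("-\<^sub>Q _" [81] 80) where "-\<^sub>Q p \<equiv> Fn QNeg [p]"
abbreviation qmul :: "tm \<Rightarrow> tm \<Rightarrow> tm"  (infixl "*\<^sub>Q" 70) where "p *\<^sub>Q q \<equiv> Fn QMul [p, q]"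
abbreviation qinv :: "tm \<Rightarrow> tm"  where "qinv p \<equiv> Fn QInv [p]"
abbreviation qpow :: "tm \<Rightarrow> tm \<Rightarrow> tm"  (infixr "^\<^sub>Q" 80) where "p ^\<^sub>Q n \<equiv> Fn QPow [p, n]"
abbreviation zeroQ :: tm  ("0\<^sub>Q") where "0\<^sub>Q \<equiv> of_N 0\<^sub>N"
abbreviation oneQ :: tm  ("1\<^sub>Q") where "1\<^sub>Q \<equiv> of_N 1\<^sub>N"

abbreviation ap :: "tm \<Rightarrow> sort \<Rightarrow> tm \<Rightarrow> tm"  ("_ \<cdot>\<^bsub>_\<^esub> _" [90, 0, 91] 90)
  where "f \<cdot>\<^bsub>s\<^esub> n \<equiv> Fn (Ap s) [f, n]"

abbreviation rconst :: "tm \<Rightarrow> tm"  where "rconst q \<equiv> Fn RConst [q]"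
abbreviation radd :: "tm \<Rightarrow> tm \<Rightarrow> tm"  (infixl "+\<^sub>R" 65) where "x +\<^sub>R y \<equiv> Fn RAdd [x, y]"
abbreviation rneg :: "tm \<Rightarrow> tm"  ("-\<^sub>R _" [81] 80) where "-\<^sub>R x \<equiv> Fn RNeg [x]"
abbreviation zeroR :: tm  ("0\<^sub>R") where "0\<^sub>R \<equiv> rconst 0\<^sub>Q"

abbreviation \<rho> :: "tm \<Rightarrow> tm \<Rightarrow> tm"  where "\<rho> x y \<equiv> Fn Dist [x, y]"

abbreviation equal :: "tm \<Rightarrow> sort \<Rightarrow> tm \<Rightarrow> fm"  ("(_ =\<^bsub>_\<^esub> _)" [51, 0, 51] 50)
  where "t =\<^bsub>s\<^esub> u \<equiv> Pr (Equal s) [t, u]"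
abbreviation qless :: "tm \<Rightarrow> tm \<Rightarrow> fm"  (infix "<\<^sub>Q" 50) where "p <\<^sub>Q q \<equiv> Pr QLess [p, q]"
abbreviation in_Q :: "tm \<Rightarrow> fm"  ("_ \<in>\<^sub>Q" [51] 50) where "x \<in>\<^sub>Q \<equiv> Pr InQ [x]"


section \<open>Axioms and derivations\<close>

inductive axiom :: "fm \<Rightarrow> bool" where
  eq_refl: "axiom (\<^bold>\<forall>x:s. x =\<^bsub>s\<^esub> x)"
| eq_subst: "wf [s] A \<Longrightarrow> axiom (\<^bold>\<forall>x:s. \<^bold>\<forall>y:s. x =\<^bsub>s\<^esub> y \<^bold>\<longrightarrow> A\<langle>x\<rangle> \<^bold>\<longrightarrow> A\<langle>y\<rangle>)"

| succ_nonzero: "axiom (\<^bold>\<forall>n:Nat. \<^bold>\<not> succ n =\<^bsub>Nat\<^esub> 0\<^sub>N)"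
| succ_inject: "axiom (\<^bold>\<forall>m:Nat. \<^bold>\<forall>n:Nat. succ m =\<^bsub>Nat\<^esub> succ n \<^bold>\<longrightarrow> m =\<^bsub>Nat\<^esub> n)"
| induction: "wf [Nat] A \<Longrightarrow> axiom (A\<langle>0\<^sub>N\<rangle> \<^bold>\<and> (\<^bold>\<forall>n:Nat. A\<langle>n\<rangle> \<^bold>\<longrightarrow> A\<langle>succ n\<rangle>) \<^bold>\<longrightarrow> (\<^bold>\<forall>n:Nat. A\<langle>n\<rangle>))"
| nadd_zero: "axiom (\<^bold>\<forall>m:Nat. m +\<^sub>N 0\<^sub>N =\<^bsub>Nat\<^esub> m)"
| nadd_succ: "axiom (\<^bold>\<forall>m:Nat. \<^bold>\<forall>n:Nat. m +\<^sub>N succ n =\<^bsub>Nat\<^esub> succ (m +\<^sub>N n))"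
| nmul_zero: "axiom (\<^bold>\<forall>m:Nat. m *\<^sub>N 0\<^sub>N =\<^bsub>Nat\<^esub> 0\<^sub>N)"
| nmul_succ: "axiom (\<^bold>\<forall>m:Nat. \<^bold>\<forall>n:Nat. m *\<^sub>N succ n =\<^bsub>Nat\<^esub> m *\<^sub>N n +\<^sub>N m)"

  \<comment> \<open>the rationals form a linearly ordered field with decidable order \<dots>\<close>
| qadd_assoc: "axiom (\<^bold>\<forall>p:Rat. \<^bold>\<forall>q:Rat. \<^bold>\<forall>r:Rat. (p +\<^sub>Q q) +\<^sub>Q r =\<^bsub>Rat\<^esub> p +\<^sub>Q (q +\<^sub>Q r))"
| qadd_comm: "axiom (\<^bold>\<forall>p:Rat. \<^bold>\<forall>q:Rat. p +\<^sub>Q q =\<^bsub>Rat\<^esub> q +\<^sub>Q p)"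
| qadd_zero: "axiom (\<^bold>\<forall>p:Rat. p +\<^sub>Q 0\<^sub>Q =\<^bsub>Rat\<^esub> p)"
| qadd_neg: "axiom (\<^bold>\<forall>p:Rat. p +\<^sub>Q -\<^sub>Q p =\<^bsub>Rat\<^esub> 0\<^sub>Q)"
| qmul_assoc: "axiom (\<^bold>\<forall>p:Rat. \<^bold>\<forall>q:Rat. \<^bold>\<forall>r:Rat. (p *\<^sub>Q q) *\<^sub>Q r =\<^bsub>Rat\<^esub> p *\<^sub>Q (q *\<^sub>Q r))"
| qmul_comm: "axiom (\<^bold>\<forall>p:Rat. \<^bold>\<forall>q:Rat. p *\<^sub>Q q =\<^bsub>Rat\<^esub> q *\<^sub>Q p)"
| qmul_one: "axiom (\<^bold>\<forall>p:Rat. p *\<^sub>Q 1\<^sub>Q =\<^bsub>Rat\<^esub> p)"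
| qmul_add: "axiom (\<^bold>\<forall>p:Rat. \<^bold>\<forall>q:Rat. \<^bold>\<forall>r:Rat. p *\<^sub>Q (q +\<^sub>Q r) =\<^bsub>Rat\<^esub> p *\<^sub>Q q +\<^sub>Q p *\<^sub>Q r)"
| qmul_inv: "axiom (\<^bold>\<forall>p:Rat. \<^bold>\<not> p =\<^bsub>Rat\<^esub> 0\<^sub>Q \<^bold>\<longrightarrow> p *\<^sub>Q qinv p =\<^bsub>Rat\<^esub> 1\<^sub>Q)"
| qless_irrefl: "axiom (\<^bold>\<forall>p:Rat. \<^bold>\<not> p <\<^sub>Q p)"
| qless_trans: "axiom (\<^bold>\<forall>p:Rat. \<^bold>\<forall>q:Rat. \<^bold>\<forall>r:Rat. p <\<^sub>Q q \<^bold>\<longrightarrow> q <\<^sub>Q r \<^bold>\<longrightarrow> p <\<^sub>Q r)"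
| qless_linear: "axiom (\<^bold>\<forall>p:Rat. \<^bold>\<forall>q:Rat. p <\<^sub>Q q \<^bold>\<or> p =\<^bsub>Rat\<^esub> q \<^bold>\<or> q <\<^sub>Q p)"
| qless_add: "axiom (\<^bold>\<forall>p:Rat. \<^bold>\<forall>q:Rat. \<^bold>\<forall>r:Rat. p <\<^sub>Q q \<^bold>\<longrightarrow> p +\<^sub>Q r <\<^sub>Q q +\<^sub>Q r)"
| qless_mul: "axiom (\<^bold>\<forall>p:Rat. \<^bold>\<forall>q:Rat. 0\<^sub>Q <\<^sub>Q p \<^bold>\<longrightarrow> 0\<^sub>Q <\<^sub>Q q \<^bold>\<longrightarrow> 0\<^sub>Q <\<^sub>Q p *\<^sub>Q q)"
| qless_zero_one: "axiom (0\<^sub>Q <\<^sub>Q 1\<^sub>Q)"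
  \<comment> \<open>\<dots> in which every element is of the form \<open>(m - n) / (k + 1)\<close> with natural \<open>m\<close>, \<open>n\<close>, \<open>k\<close>\<close>
| of_N_succ: "axiom (\<^bold>\<forall>n:Nat. of_N (succ n) =\<^bsub>Rat\<^esub> of_N n +\<^sub>Q 1\<^sub>Q)"
| fraction: "axiom (\<^bold>\<forall>p:Rat. \<^bold>\<exists>m:Nat. \<^bold>\<exists>n:Nat. \<^bold>\<exists>k:Nat.
    p *\<^sub>Q of_N (succ k) =\<^bsub>Rat\<^esub> of_N m +\<^sub>Q -\<^sub>Q of_N n)"
| qpow_zero: "axiom (\<^bold>\<forall>p:Rat. p ^\<^sub>Q 0\<^sub>N =\<^bsub>Rat\<^esub> 1\<^sub>Q)"
| qpow_succ: "axiom (\<^bold>\<forall>p:Rat. \<^bold>\<forall>n:Nat. p ^\<^sub>Q succ n =\<^bsub>Rat\<^esub> p ^\<^sub>Q n *\<^sub>Q p)"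

  \<comment> \<open>the defining equations of Bishop's operations on sequences of rationals\<close>
| rconst: "axiom (\<^bold>\<forall>q:Rat. \<^bold>\<forall>n:Nat. rconst q \<cdot>\<^bsub>Rat\<^esub> n =\<^bsub>Rat\<^esub> q)"
| radd: "axiom (\<^bold>\<forall>x:Seq Rat. \<^bold>\<forall>y:Seq Rat. \<^bold>\<forall>n:Nat.
    (x +\<^sub>R y) \<cdot>\<^bsub>Rat\<^esub> n =\<^bsub>Rat\<^esub> x \<cdot>\<^bsub>Rat\<^esub> (n +\<^sub>N n) +\<^sub>Q y \<cdot>\<^bsub>Rat\<^esub> (n +\<^sub>N n))"
| rneg: "axiom (\<^bold>\<forall>x:Seq Rat. \<^bold>\<forall>n:Nat. (-\<^sub>R x) \<cdot>\<^bsub>Rat\<^esub> n =\<^bsub>Rat\<^esub> -\<^sub>Q (x \<cdot>\<^bsub>Rat\<^esub> n))"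

| countable_choice: "wf [Nat, s] A \<Longrightarrow>
    axiom ((\<^bold>\<forall>n:Nat. \<^bold>\<exists>y:s. A\<langle>n,y\<rangle>) \<^bold>\<longrightarrow> (\<^bold>\<exists>f:Seq s. \<^bold>\<forall>n:Nat. A\<langle>n,f \<cdot>\<^bsub>s\<^esub> n\<rangle>))"
| dependent_choice: "wf [s] A \<Longrightarrow> wf [s, s] B \<Longrightarrow>
    axiom ((\<^bold>\<forall>x:s. A\<langle>x\<rangle> \<^bold>\<longrightarrow> (\<^bold>\<exists>y:s. A\<langle>y\<rangle> \<^bold>\<and> B\<langle>x,y\<rangle>)) \<^bold>\<longrightarrow>
      (\<^bold>\<forall>x:s. A\<langle>x\<rangle> \<^bold>\<longrightarrow> (\<^bold>\<exists>f:Seq s. f \<cdot>\<^bsub>s\<^esub> 0\<^sub>N =\<^bsub>s\<^esub> x \<^bold>\<and>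
        (\<^bold>\<forall>n:Nat. A\<langle>f \<cdot>\<^bsub>s\<^esub> n\<rangle> \<^bold>\<and> B\<langle>f \<cdot>\<^bsub>s\<^esub> n,f \<cdot>\<^bsub>s\<^esub> succ n\<rangle>))))"

text \<open>Natural deduction for intuitionistic many-sorted first-order logic.\<close>

inductive derives :: "fm set \<Rightarrow> fm \<Rightarrow> bool"  (infix "\<turnstile>" 15) where
  Axiom: "axiom A \<Longrightarrow> \<Gamma> \<turnstile> A"
| Assm: "A \<in> \<Gamma> \<Longrightarrow> wf [] A \<Longrightarrow> \<Gamma> \<turnstile> A"
| FalsumE: "\<Gamma> \<turnstile> \<^bold>\<bottom> \<Longrightarrow> wf [] A \<Longrightarrow> \<Gamma> \<turnstile> A"
| AndI: "\<Gamma> \<turnstile> A \<Longrightarrow> \<Gamma> \<turnstile> B \<Longrightarrow> \<Gamma> \<turnstile> A \<^bold>\<and> B"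
| AndE1: "\<Gamma> \<turnstile> A \<^bold>\<and> B \<Longrightarrow> \<Gamma> \<turnstile> A"
| AndE2: "\<Gamma> \<turnstile> A \<^bold>\<and> B \<Longrightarrow> \<Gamma> \<turnstile> B"
| OrI1: "\<Gamma> \<turnstile> A \<Longrightarrow> wf [] B \<Longrightarrow> \<Gamma> \<turnstile> A \<^bold>\<or> B"
| OrI2: "\<Gamma> \<turnstile> B \<Longrightarrow> wf [] A \<Longrightarrow> \<Gamma> \<turnstile> A \<^bold>\<or> B"
| OrE: "\<Gamma> \<turnstile> A \<^bold>\<or> B \<Longrightarrow> insert A \<Gamma> \<turnstile> C \<Longrightarrow> insert B \<Gamma> \<turnstile> C \<Longrightarrow> \<Gamma> \<turnstile> C"
| ImpI: "insert A \<Gamma> \<turnstile> B \<Longrightarrow> wf [] A \<Longrightarrow> \<Gamma> \<turnstile> A \<^bold>\<longrightarrow> B"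
| ImpE: "\<Gamma> \<turnstile> A \<^bold>\<longrightarrow> B \<Longrightarrow> \<Gamma> \<turnstile> A \<Longrightarrow> \<Gamma> \<turnstile> B"
| AllI: "\<Gamma> \<turnstile> opn 0 (Par a s) A \<Longrightarrow> a \<notin> \<Union> (names ` insert A \<Gamma>) \<Longrightarrow> \<Gamma> \<turnstile> All s A"
| AllE: "\<Gamma> \<turnstile> All s A \<Longrightarrow> has_sort [] t s \<Longrightarrow> \<Gamma> \<turnstile> opn 0 t A"
| ExI: "\<Gamma> \<turnstile> opn 0 t A \<Longrightarrow> has_sort [] t s \<Longrightarrow> wf [s] A \<Longrightarrow> \<Gamma> \<turnstile> Ex s A"
| ExE: "\<Gamma> \<turnstile> Ex s A \<Longrightarrow> insert (opn 0 (Par a s) A) \<Gamma> \<turnstile> C \<Longrightarrow>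
    a \<notin> \<Union> (names ` insert A (insert C \<Gamma>)) \<Longrightarrow> \<Gamma> \<turnstile> C"


section \<open>Numbers\<close>

definition nle :: "tm \<Rightarrow> tm \<Rightarrow> fm"  (infix "\<le>\<^sub>N" 50) where
  "m \<le>\<^sub>N n = (\<^bold>\<exists>k:Nat. m +\<^sub>N k =\<^bsub>Nat\<^esub> n)"

definition qle :: "tm \<Rightarrow> tm \<Rightarrow> fm"  (infix "\<le>\<^sub>Q" 50) where
  "p \<le>\<^sub>Q q = (p <\<^sub>Q q \<^bold>\<or> p =\<^bsub>Rat\<^esub> q)"

text \<open>Quantifiers over the positive integers, which are the indices of all sequences below.\<close>

definition Forall_pos :: "(tm \<Rightarrow> fm) \<Rightarrow> fm"  (binder "\<^bold>\<forall>\<^sup>+" 10) where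
  "(\<^bold>\<forall>\<^sup>+n. A n) = (\<^bold>\<forall>n:Nat. 1\<^sub>N \<le>\<^sub>N n \<^bold>\<longrightarrow> A n)"

definition Exists_pos :: "(tm \<Rightarrow> fm) \<Rightarrow> fm"  (binder "\<^bold>\<exists>\<^sup>+" 10) where
  "(\<^bold>\<exists>\<^sup>+n. A n) = (\<^bold>\<exists>n:Nat. 1\<^sub>N \<le>\<^sub>N n \<^bold>\<and> A n)"

abbreviation recip :: "tm \<Rightarrow> tm" where "recip n \<equiv> qinv (of_N n)"

text \<open>
  Real numbers following Bishop: regular sequences \<open>(x\<^sub>n)\<close> of rationals,
  \<open>\<bar>x\<^sub>m - x\<^sub>n\<bar> \<le> 1/m + 1/n\<close>; \<open>x = y\<close> iff \<open>\<bar>x\<^sub>n - y\<^sub>n\<bar> \<le> 2/n\<close> for all \<open>n\<close>;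
  \<open>x\<close> is positive iff \<open>x\<^sub>n > 1/n\<close> for some \<open>n\<close>, and nonnegative iff \<open>x\<^sub>n \<ge> -1/n\<close> for all \<open>n\<close>.
\<close>

text \<open>\<open>qdist_le p q r\<close> says \<open>\<bar>p - q\<bar> \<le> r\<close>.\<close>

definition qdist_le :: "tm \<Rightarrow> tm \<Rightarrow> tm \<Rightarrow> fm" where
  "qdist_le p q r = (p +\<^sub>Q -\<^sub>Q q \<le>\<^sub>Q r \<^bold>\<and> q +\<^sub>Q -\<^sub>Q p \<le>\<^sub>Q r)"

definition is_real :: "tm \<Rightarrow> fm" where
  "is_real x = (\<^bold>\<forall>\<^sup>+m. \<^bold>\<forall>\<^sup>+n. qdist_le (x \<cdot>\<^bsub>Rat\<^esub> m) (x \<cdot>\<^bsub>Rat\<^esub> n) (recip m +\<^sub>Q recip n))"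

definition Forall_real :: "(tm \<Rightarrow> fm) \<Rightarrow> fm"  (binder "\<^bold>\<forall>\<^sub>R" 10) where
  "(\<^bold>\<forall>\<^sub>Rx. A x) = (\<^bold>\<forall>x:Seq Rat. is_real x \<^bold>\<longrightarrow> A x)"

definition Exists_real :: "(tm \<Rightarrow> fm) \<Rightarrow> fm"  (binder "\<^bold>\<exists>\<^sub>R" 10) where
  "(\<^bold>\<exists>\<^sub>Rx. A x) = (\<^bold>\<exists>x:Seq Rat. is_real x \<^bold>\<and> A x)"

definition req :: "tm \<Rightarrow> tm \<Rightarrow> fm"  (infix "=\<^sub>R" 50) where
  "x =\<^sub>R y = (\<^bold>\<forall>\<^sup>+n. qdist_le (x \<cdot>\<^bsub>Rat\<^esub> n) (y \<cdot>\<^bsub>Rat\<^esub> n) (recip n +\<^sub>Q recip n))"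

definition rpos :: "tm \<Rightarrow> fm" where
  "rpos x = (\<^bold>\<exists>\<^sup>+n. recip n <\<^sub>Q x \<cdot>\<^bsub>Rat\<^esub> n)"

definition rnonneg :: "tm \<Rightarrow> fm" where
  "rnonneg x = (\<^bold>\<forall>\<^sup>+n. -\<^sub>Q recip n \<le>\<^sub>Q x \<cdot>\<^bsub>Rat\<^esub> n)"

definition rless :: "tm \<Rightarrow> tm \<Rightarrow> fm"  (infix "<\<^sub>R" 50) where
  "x <\<^sub>R y = rpos (y +\<^sub>R -\<^sub>R x)"

definition rle :: "tm \<Rightarrow> tm \<Rightarrow> fm"  (infix "\<le>\<^sub>R" 50) where
  "x \<le>\<^sub>R y = rnonneg (y +\<^sub>R -\<^sub>R x)"

abbreviation half_pow :: "tm \<Rightarrow> tm"  ("2\<^sup>-\<^sup>_" [1000] 1000) where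
  "2\<^sup>-\<^sup>n \<equiv> rconst (qinv (1\<^sub>Q +\<^sub>Q 1\<^sub>Q) ^\<^sub>Q n)"


section \<open>Metric spaces\<close>

text \<open>
  As in Bishop's sets, a point is given by a representative, and equality of points is the
  relation \<open>=\<^sub>X\<close>, not the identity \<open>=\<^bsub>Pt\<^esub>\<close> of representatives.  Since \<open>\<rho> x y = 0\<close> iff \<open>x\<close> and \<open>y\<close>
  are equal, this relation is determined by \<open>\<rho>\<close>.
\<close>

definition eqX :: "tm \<Rightarrow> tm \<Rightarrow> fm"  (infix "=\<^sub>X" 50) where
  "x =\<^sub>X y = (\<rho> x y =\<^sub>R 0\<^sub>R)"

definition neqX :: "tm \<Rightarrow> tm \<Rightarrow> fm"  (infix "\<noteq>\<^sub>X" 50) where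
  "x \<noteq>\<^sub>X y = (0\<^sub>R <\<^sub>R \<rho> x y)"

definition metric_space :: fm where
  "metric_space =
    ((\<^bold>\<forall>x:Pt. \<^bold>\<forall>y:Pt. is_real (\<rho> x y) \<^bold>\<and> 0\<^sub>R \<le>\<^sub>R \<rho> x y) \<^bold>\<and>
     (\<^bold>\<forall>x:Pt. \<rho> x x =\<^sub>R 0\<^sub>R) \<^bold>\<and>
     (\<^bold>\<forall>x:Pt. \<^bold>\<forall>y:Pt. \<rho> x y =\<^sub>R \<rho> y x) \<^bold>\<and>
     (\<^bold>\<forall>x:Pt. \<^bold>\<forall>y:Pt. \<^bold>\<forall>z:Pt. \<rho> x z \<le>\<^sub>R \<rho> x y +\<^sub>R \<rho> y z))"

text \<open>A subset respects the equality of points.\<close>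

definition subset_Q :: fm where
  "subset_Q = (\<^bold>\<forall>x:Pt. \<^bold>\<forall>y:Pt. x =\<^sub>X y \<^bold>\<longrightarrow> x \<in>\<^sub>Q \<^bold>\<longrightarrow> y \<in>\<^sub>Q)"

text \<open>\<open>d = \<rho>(Q, x)\<close> in Bishop's sense of the infimum: a lower bound that is approximated by members.\<close>

definition is_dist_Q :: "tm \<Rightarrow> tm \<Rightarrow> fm" where
  "is_dist_Q x d =
    ((\<^bold>\<forall>a:Pt. a \<in>\<^sub>Q \<^bold>\<longrightarrow> d \<le>\<^sub>R \<rho> a x) \<^bold>\<and>
     (\<^bold>\<forall>\<^sub>R\<epsilon>. 0\<^sub>R <\<^sub>R \<epsilon> \<^bold>\<longrightarrow> (\<^bold>\<exists>a:Pt. a \<in>\<^sub>Q \<^bold>\<and> \<rho> a x <\<^sub>R d +\<^sub>R \<epsilon>)))"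

definition located_Q :: fm where
  "located_Q = (\<^bold>\<forall>x:Pt. \<^bold>\<exists>\<^sub>Rd. is_dist_Q x d)"

definition converges :: "tm \<Rightarrow> fm" where
  "converges s = (\<^bold>\<exists>z:Pt. \<^bold>\<forall>\<^sup>+k. \<^bold>\<exists>\<^sup>+N. \<^bold>\<forall>n:Nat. N \<le>\<^sub>N n \<^bold>\<longrightarrow> \<rho> (s \<cdot>\<^bsub>Pt\<^esub> n) z \<le>\<^sub>R rconst (recip k))"

definition binary :: "tm \<Rightarrow> fm" where
  "binary l = (\<^bold>\<forall>\<^sup>+n. l \<cdot>\<^bsub>Nat\<^esub> n =\<^bsub>Nat\<^esub> 0\<^sub>N \<^bold>\<or> l \<cdot>\<^bsub>Nat\<^esub> n =\<^bsub>Nat\<^esub> 1\<^sub>N)"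

definition increasing :: "tm \<Rightarrow> fm" where
  "increasing l = (\<^bold>\<forall>\<^sup>+m. \<^bold>\<forall>\<^sup>+n. m \<le>\<^sub>N n \<^bold>\<longrightarrow> l \<cdot>\<^bsub>Nat\<^esub> m \<le>\<^sub>N l \<cdot>\<^bsub>Nat\<^esub> n)"

definition LPO :: fm where
  "LPO = (\<^bold>\<forall>a:Seq Nat. binary a \<^bold>\<longrightarrow>
    (\<^bold>\<forall>\<^sup>+n. a \<cdot>\<^bsub>Nat\<^esub> n =\<^bsub>Nat\<^esub> 0\<^sub>N) \<^bold>\<or> (\<^bold>\<exists>\<^sup>+n. a \<cdot>\<^bsub>Nat\<^esub> n =\<^bsub>Nat\<^esub> 1\<^sub>N))"

text \<open>
  \<open>is_switch l q u s\<close>: the \<open>n\<close>-th term of \<open>s\<close> is \<open>u n\<close> if \<open>l n = 0\<close>, and it is \<open>q m\<close> if \<open>l n = 1\<close>,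
  where \<open>m\<close> is the index with \<open>l m = 0\<close> and \<open>l (m + 1) = 1\<close>.
\<close>

definition is_switch :: "tm \<Rightarrow> tm \<Rightarrow> (tm \<Rightarrow> tm) \<Rightarrow> tm \<Rightarrow> fm" where
  "is_switch l q u s = (\<^bold>\<forall>\<^sup>+n.
    (l \<cdot>\<^bsub>Nat\<^esub> n =\<^bsub>Nat\<^esub> 0\<^sub>N \<^bold>\<longrightarrow> s \<cdot>\<^bsub>Pt\<^esub> n =\<^sub>X u n) \<^bold>\<and>
    (l \<cdot>\<^bsub>Nat\<^esub> n =\<^bsub>Nat\<^esub> 1\<^sub>N \<^bold>\<longrightarrow>
      (\<^bold>\<forall>\<^sup>+m. l \<cdot>\<^bsub>Nat\<^esub> m =\<^bsub>Nat\<^esub> 0\<^sub>N \<^bold>\<and> l \<cdot>\<^bsub>Nat\<^esub> succ m =\<^bsub>Nat\<^esub> 1\<^sub>N \<^bold>\<longrightarrow> s \<cdot>\<^bsub>Pt\<^esub> n =\<^sub>X q \<cdot>\<^bsub>Pt\<^esub> m)))"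

text \<open>
  The space contains the limits of the two kinds of Cauchy sequences built from \<open>x\<close>, a sequence in
  \<open>Q\<close> and an increasing binary sequence; every complete metric space has this property.
\<close>

definition complete_enough :: "tm \<Rightarrow> fm" where
  "complete_enough x = (\<^bold>\<forall>q:Seq Pt. \<^bold>\<forall>l:Seq Nat. \<^bold>\<forall>s:Seq Pt.
    (\<^bold>\<forall>\<^sup>+n. (q \<cdot>\<^bsub>Pt\<^esub> n) \<in>\<^sub>Q) \<^bold>\<and> binary l \<^bold>\<and> increasing l \<^bold>\<and> l \<cdot>\<^bsub>Nat\<^esub> 1\<^sub>N =\<^bsub>Nat\<^esub> 0\<^sub>N \<^bold>\<longrightarrow>
    ((\<^bold>\<forall>\<^sup>+n. l \<cdot>\<^bsub>Nat\<^esub> n =\<^bsub>Nat\<^esub> 0\<^sub>N \<^bold>\<longrightarrow> \<rho> (q \<cdot>\<^bsub>Pt\<^esub> n) x <\<^sub>R 2\<^sup>-\<^sup>n) \<^bold>\<and>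
      is_switch l q (\<lambda>n. x) s \<^bold>\<longrightarrow> converges s) \<^bold>\<and>
    ((\<^bold>\<forall>\<^sup>+n. \<rho> (q \<cdot>\<^bsub>Pt\<^esub> n) x <\<^sub>R 2\<^sup>-\<^sup>n) \<^bold>\<and>
      is_switch l q (\<lambda>n. q \<cdot>\<^bsub>Pt\<^esub> n) s \<^bold>\<longrightarrow> converges s))"

end

theory Submission
  imports Defs "HOL-Library.Countable"
begin

text \<open>
  Why the proposition holds.  Call a binary sequence \<open>a\<close> good if, whenever \<open>a\<^sub>1, \<dots>, a\<^sub>n\<^sub>-\<^sub>1\<close> all
  vanish, \<open>Q\<close> has a point within \<open>2\<^sup>-\<^sup>n\<close> of \<open>x\<close>.  For good sequences one can decide whether all
  terms vanish or some term is one (\<open>search_decides\<close>).  Indeed, let \<open>l\<^sub>n\<close> be the increasing flag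
  that records whether a one has been seen before \<open>n\<close>, choose \<open>q\<^sub>n \<in> Q\<close> that is within \<open>2\<^sup>-\<^sup>n\<close> of \<open>x\<close>
  as long as \<open>l\<^sub>n = 0\<close>, and let \<open>s\<^sub>n\<close> be \<open>x\<close> as long as \<open>l\<^sub>n = 0\<close> and \<open>q\<^sub>m\<close> from then on, where \<open>m\<close> is
  the last index with \<open>l\<^sub>m = 0\<close>.  This is a sequence of kind (i), so it has a limit \<open>z\<close>, and either
  \<open>z \<noteq> x\<close> or \<open>z \<notin> Q\<close>.  If \<open>z \<noteq> x\<close>, then some term of \<open>s\<close> that is close to \<open>z\<close> is not \<open>x\<close>, so its
  flag is one.  If \<open>z \<notin> Q\<close>, then no flag can be one, since \<open>z\<close> would then be some \<open>q\<^sub>m\<close>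
  (\<open>apart_decides\<close>).

  If \<open>d = \<rho>(Q, x) = 0\<close>, then every binary sequence is good, which is LPO (\<open>zero_distance_LPO\<close>). In
  general, countable choice gives \<open>a\<close> such that \<open>a\<^sub>n = 1\<close> only if \<open>d > 0\<close>, and \<open>a\<^sub>n = 0\<close> only if \<open>Q\<close>
  has a point within \<open>2\<^sup>-\<^sup>n\<^sup>-\<^sup>1\<close> of \<open>x\<close> and \<open>d\<close> is at most about \<open>1/n\<close>.  This sequence is good, and
  deciding it decides between \<open>d > 0\<close> and \<open>d = 0\<close> (\<open>distance_decides\<close>).

  How a derivation is obtained.  Instead of writing one down, the proof uses completeness of the
  calculus for Kripke semantics.  Worlds are the prime deductively closed theories with witnesses
  for existential formulas; a sentence is derivable if it belongs to every world (\<open>completeness\<close>).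
  At a single world disjunction and existence behave classically, and only implication and
  universal quantification refer to larger worlds, so that the argument above can be carried out
  world by world.  The axioms of the formal theory enter as properties of worlds: \<open>holds_induct\<close>,
  \<open>holds_choice\<close> and the arithmetic of the rational terms.  The latter, taken modulo provable
  equality, form a commutative ring in the metatheory; at each world its positive elements are
  closed under sums, so that an inequality is proved by exhibiting the difference of its sides as
  a sum of elements that are known to be positive or nonnegative.
\<close>

section \<open>Terms, substitution and names\<close>

abbreviation eq_N :: "tm \<Rightarrow> tm \<Rightarrow> fm"  (infix "=\<^sub>N" 50) where "m =\<^sub>N n \<equiv> m =\<^bsub>Nat\<^esub> n"
abbreviation eq_Q :: "tm \<Rightarrow> tm \<Rightarrow> fm"  (infix "=\<^sub>Q" 50) where "p =\<^sub>Q q \<equiv> p =\<^bsub>Rat\<^esub> q"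
abbreviation ap_N :: "tm \<Rightarrow> tm \<Rightarrow> tm"  (infix "\<cdot>\<^sub>N" 90) where "l \<cdot>\<^sub>N n \<equiv> l \<cdot>\<^bsub>Nat\<^esub> n"
abbreviation ap_Q :: "tm \<Rightarrow> tm \<Rightarrow> tm"  (infix "\<cdot>\<^sub>Q" 90) where "x \<cdot>\<^sub>Q n \<equiv> x \<cdot>\<^bsub>Rat\<^esub> n"
abbreviation ap_P :: "tm \<Rightarrow> tm \<Rightarrow> tm"  (infix "\<cdot>\<^sub>P" 90) where "q \<cdot>\<^sub>P n \<equiv> q \<cdot>\<^bsub>Pt\<^esub> n"

instance sort :: countable by countable_datatype
instance fsym :: countable by countable_datatype
instance psym :: countable by countable_datatype
instance tm :: countable by countable_datatype
instance fm :: countable by countable_datatype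

text \<open>
  Absence of indices, without any condition on sorts: the notation for quantifiers also evaluates
  its body at \<open>Fn Zero []\<close> when a variable of another sort is bound.
\<close>

primrec closed :: "tm \<Rightarrow> bool" where
  "closed (Par a s) \<longleftrightarrow> True"
| "closed (Bound i) \<longleftrightarrow> False"
| "closed (Fn f ts) \<longleftrightarrow> (\<forall>b\<in>set (map closed ts). b)"

lemma has_sort_Par [simp]: "has_sort \<Delta> (Par a r) s \<longleftrightarrow> s = r"
  by (auto elim: has_sort.cases intro: has_sort.intros)

lemma has_sort_Bound [simp]: "has_sort \<Delta> (Bound i) s \<longleftrightarrow> i < length \<Delta> \<and> s = \<Delta> ! i"
  by (auto elim: has_sort.cases intro: has_sort.intros)

lemma has_sort_Fn [simp]:
  "has_sort \<Delta> (Fn f ts) s \<longleftrightarrow> s = fsym_result f \<and> list_all2 (has_sort \<Delta>) ts (fsym_args f)"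
  by (auto elim: has_sort.cases intro: has_sort.intros)

lemma has_sort_closed: "has_sort [] t s \<Longrightarrow> closed t"
proof (induction t arbitrary: s)
  case (Fn f ts)
  then show ?case by (fastforce simp: list_all2_conv_all_nth in_set_conv_nth)
qed auto

lemma opn_tm_closed: "closed u \<Longrightarrow> opn_tm k t u = u"
  by (induction u) (auto intro!: map_idI)

lemma opn_tm_id: "has_sort \<Delta> u s \<Longrightarrow> length \<Delta> \<le> k \<Longrightarrow> opn_tm k t u = u"
proof (induction u arbitrary: s)
  case (Fn f ts)
  then show ?case
    by (fastforce intro!: map_idI simp: list_all2_conv_all_nth in_set_conv_nth)
qed auto

lemma opn_id: "wf \<Delta> A \<Longrightarrow> length \<Delta> \<le> k \<Longrightarrow> opn k t A = A"
proof (induction A arbitrary: \<Delta> k)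
  case (Pr p ts)
  then show ?case
    by (auto intro!: map_idI simp: list_all2_conv_all_nth in_set_conv_nth) (blast intro: opn_tm_id)
qed auto

text \<open>
  Simultaneous substitution of closed terms for the indices from \<open>k\<close> on.  Terms outside the list
  are never reached by well-formed arguments.
\<close>

primrec sub_tm :: "nat \<Rightarrow> tm list \<Rightarrow> tm \<Rightarrow> tm" where
  "sub_tm k ts (Par a s) = Par a s"
| "sub_tm k ts (Bound i) = (if i < k then Bound i else ts ! (i - k))"
| "sub_tm k ts (Fn f us) = Fn f (map (sub_tm k ts) us)"

primrec sub :: "nat \<Rightarrow> tm list \<Rightarrow> fm \<Rightarrow> fm" where
  "sub k ts (Pr p us) = Pr p (map (sub_tm k ts) us)"
| "sub k ts \<^bold>\<bottom> = \<^bold>\<bottom>"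
| "sub k ts (A \<^bold>\<and> B) = (sub k ts A \<^bold>\<and> sub k ts B)"
| "sub k ts (A \<^bold>\<or> B) = (sub k ts A \<^bold>\<or> sub k ts B)"
| "sub k ts (A \<^bold>\<longrightarrow> B) = (sub k ts A \<^bold>\<longrightarrow> sub k ts B)"
| "sub k ts (All s A) = All s (sub (Suc k) ts A)"
| "sub k ts (Ex s A) = Ex s (sub (Suc k) ts A)"

lemma has_sort_weaken: "has_sort \<Delta> t s \<Longrightarrow> has_sort (\<Delta> @ \<Delta>') t s"
proof (induction t arbitrary: s)
  case (Fn f ts)
  then show ?case by (auto simp: list_all2_conv_all_nth)
qed (auto simp: nth_append)

lemma has_sort_sub_tm:
  "has_sort (\<Delta> @ \<Delta>') u s \<Longrightarrow> list_all2 (has_sort []) ts \<Delta>' \<Longrightarrow> has_sort \<Delta> (sub_tm (length \<Delta>) ts u) s"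
proof (induction u arbitrary: s)
  case (Bound i)
  then show ?case
    using has_sort_weaken[of "[]" "ts ! (i - length \<Delta>)" _ \<Delta>]
    by (auto simp: nth_append list_all2_conv_all_nth split: if_splits)
qed (auto simp: list_all2_conv_all_nth)

lemma wf_sub:
  "wf (\<Delta> @ \<Delta>') A \<Longrightarrow> list_all2 (has_sort []) ts \<Delta>' \<Longrightarrow> wf \<Delta> (sub (length \<Delta>) ts A)"
proof (induction A arbitrary: \<Delta>)
  case (Pr p us)
  then show ?case by (auto simp: list_all2_conv_all_nth has_sort_sub_tm)
next
  case (All s A) then show ?case using All.IH[of "s # \<Delta>"] by simp
next
  case (Ex s A) then show ?case using Ex.IH[of "s # \<Delta>"] by simp
qed auto

lemma opn_sub_tm:
  "has_sort \<Delta> u s \<Longrightarrow> length \<Delta> \<le> Suc k + length ts \<Longrightarrow> \<forall>t\<in>set ts. closed t \<Longrightarrow>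
    opn_tm k t (sub_tm (Suc k) ts u) = sub_tm k (t # ts) u"
proof (induction u arbitrary: s)
  case (Bound i)
  have "opn_tm k t (ts ! (i - Suc k)) = ts ! (i - Suc k)" if "i > k"
  proof -
    have "ts ! (i - Suc k) \<in> set ts" using Bound that by auto
    then show ?thesis using Bound opn_tm_closed by simp
  qed
  then show ?case by (auto simp: nth_Cons')
qed (auto simp: list_all2_conv_all_nth in_set_conv_nth, blast)

text \<open>
  Substituting for all indices but one and then for the remaining one is a single simultaneous
  substitution, because the terms that were put in are closed.
\<close>

lemma opn_sub:
  "wf \<Delta> A \<Longrightarrow> length \<Delta> \<le> Suc k + length ts \<Longrightarrow> \<forall>t\<in>set ts. closed t \<Longrightarrow>
    opn k t (sub (Suc k) ts A) = sub k (t # ts) A"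
proof (induction A arbitrary: \<Delta> k)
  case (Pr p us)
  then show ?case by (auto simp: list_all2_conv_all_nth in_set_conv_nth) (metis opn_sub_tm add_Suc)
qed auto

lemma sub_tm_Nil: "has_sort \<Delta> u s \<Longrightarrow> length \<Delta> \<le> k \<Longrightarrow> sub_tm k ts u = u"
proof (induction u arbitrary: s)
  case (Fn f us)
  then show ?case
    by (fastforce intro!: map_idI simp: list_all2_conv_all_nth in_set_conv_nth)
qed auto

lemma sub_id: "wf \<Delta> A \<Longrightarrow> length \<Delta> \<le> k \<Longrightarrow> sub k ts A = A"
proof (induction A arbitrary: \<Delta> k)
  case (Pr p us)
  then show ?case
    by (auto intro!: map_idI simp: list_all2_conv_all_nth in_set_conv_nth) (blast intro: sub_tm_Nil)
qed auto

lemma opn_eq_sub: "wf \<Delta> A \<Longrightarrow> length \<Delta> \<le> Suc k \<Longrightarrow> opn k t A = sub k [t] A"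
  using opn_sub[of \<Delta> A k "[]" t] sub_id[of \<Delta> A "Suc k" "[]"] by simp

lemma wf_opn: "wf [s] A \<Longrightarrow> has_sort [] t s \<Longrightarrow> wf [] (opn 0 t A)"
  using wf_sub[of "[]" "[s]" A "[t]"] by (simp add: opn_eq_sub[of "[s]"])

lemma finite_names_tm: "finite (names_tm t)"
  by (induction t) auto

lemma finite_names [simp]: "finite (names A)"
  by (induction A) (auto simp: finite_names_tm)

lemma names_opn_tm: "names_tm (opn_tm k t u) \<subseteq> names_tm u \<union> names_tm t"
  by (induction u) auto

lemma names_opn: "names (opn k t A) \<subseteq> names A \<union> names_tm t"
  by (induction A arbitrary: k) (use names_opn_tm in \<open>fastforce+\<close>)

lemma names_opn_tm': "names_tm u \<subseteq> names_tm (opn_tm k t u)"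
  by (induction u) auto

lemma names_opn': "names A \<subseteq> names (opn k t A)"
  by (induction A arbitrary: k) (use names_opn_tm' in \<open>fastforce+\<close>)

lemma cls_opn_tm: "a \<notin> names_tm u \<Longrightarrow> cls_tm k a s (opn_tm k (Par a s) u) = u"
  by (induction u) (auto intro!: map_idI)

text \<open>
  Opening with a fresh parameter and closing again is the identity.  This is what makes the named
  notation for quantifiers independent of the name that it picks.
\<close>

lemma cls_opn: "a \<notin> names A \<Longrightarrow> cls k a s (opn k (Par a s) A) = A"
  by (induction A arbitrary: k) (auto intro!: map_idI simp: cls_opn_tm)

section \<open>Provability from a set of hypotheses\<close>

inductive conj_of :: "fm set \<Rightarrow> fm \<Rightarrow> bool" for \<Gamma> where
  top: "conj_of \<Gamma> (\<^bold>\<not> \<^bold>\<bottom>)"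
| mem: "A \<in> \<Gamma> \<Longrightarrow> wf [] A \<Longrightarrow> conj_of \<Gamma> A"
| conj: "conj_of \<Gamma> A \<Longrightarrow> conj_of \<Gamma> B \<Longrightarrow> conj_of \<Gamma> (A \<^bold>\<and> B)"

lemma conj_of_wf: "conj_of \<Gamma> G \<Longrightarrow> wf [] G"
  by (induction rule: conj_of.induct) auto

lemma conj_of_names: "conj_of \<Gamma> G \<Longrightarrow> names G \<subseteq> \<Union> (names ` \<Gamma>)"
  by (induction rule: conj_of.induct) auto

lemma conj_of_mono: "conj_of \<Gamma> G \<Longrightarrow> \<Gamma> \<subseteq> \<Gamma>' \<Longrightarrow> conj_of \<Gamma>' G"
  by (induction rule: conj_of.induct) (auto intro: conj_of.intros)

text \<open>
  The rule for introducing \<open>\<forall>\<close> asks for a name that occurs in none of the hypotheses, so weakening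
  would require renaming parameters throughout derivations, and it fails if the additional
  hypotheses use up all names.  Deriving \<open>G \<^bold>\<longrightarrow> A\<close> from no hypotheses at all, with a finite
  conjunction \<open>G\<close>, makes weakening trivial (\<open>prv_mono\<close>) and all rules remain available.
\<close>

definition prv :: "fm set \<Rightarrow> fm \<Rightarrow> bool"  (infix "\<tturnstile>" 15) where
  "(\<Gamma> \<tturnstile> A) \<longleftrightarrow> wf [] A \<and> (\<exists>G. conj_of \<Gamma> G \<and> ({} \<turnstile> G \<^bold>\<longrightarrow> A))"

lemma prv_wf: "\<Gamma> \<tturnstile> A \<Longrightarrow> wf [] A"
  by (simp add: prv_def)

lemma prv_mono: "\<Gamma> \<tturnstile> A \<Longrightarrow> \<Gamma> \<subseteq> \<Gamma>' \<Longrightarrow> \<Gamma>' \<tturnstile> A"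
  unfolding prv_def using conj_of_mono by blast

lemma prv_axiom: "axiom A \<Longrightarrow> wf [] A \<Longrightarrow> \<Gamma> \<tturnstile> A"
  unfolding prv_def by (meson conj_of.top ImpI Axiom wf.simps)

lemma prv_hyp: "A \<in> \<Gamma> \<Longrightarrow> wf [] A \<Longrightarrow> \<Gamma> \<tturnstile> A"
  unfolding prv_def by (meson conj_of.mem ImpI Assm insertI1)

lemma prv_emptyD: "{} \<tturnstile> A \<Longrightarrow> {} \<turnstile> A"
proof -
  assume "{} \<tturnstile> A"
  then obtain G where G: "conj_of {} G" "{} \<turnstile> (G \<^bold>\<longrightarrow> A)" by (auto simp: prv_def)
  have "{} \<turnstile> G" using G(1)
    by induction (auto intro: AndI ImpI[OF Assm])
  then show ?thesis using G(2) ImpE by blast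
qed

lemma cut_imp: "{} \<turnstile> (G \<^bold>\<longrightarrow> A) \<Longrightarrow> {} \<turnstile> (A \<^bold>\<longrightarrow> B) \<Longrightarrow> wf [] G \<Longrightarrow> wf [] A \<Longrightarrow> wf [] B \<Longrightarrow> {} \<turnstile> (G \<^bold>\<longrightarrow> B)"
proof -
  assume *: "{} \<turnstile> (G \<^bold>\<longrightarrow> A)" "{} \<turnstile> (A \<^bold>\<longrightarrow> B)" and w [simp]: "wf [] G" "wf [] A" "wf [] B"
  have "{} \<turnstile> ((G \<^bold>\<longrightarrow> A) \<^bold>\<longrightarrow> (A \<^bold>\<longrightarrow> B) \<^bold>\<longrightarrow> G \<^bold>\<longrightarrow> B)"
    by (rule ImpI, rule ImpI, rule ImpI, rule ImpE[of _ A], rule Assm, simp, simp,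
        rule ImpE[of _ G], rule Assm, simp, simp, rule Assm) auto
  with * show ?thesis using ImpE by blast
qed

lemma prv_step: "\<Gamma> \<tturnstile> A \<Longrightarrow> {A} \<turnstile> B \<Longrightarrow> wf [] B \<Longrightarrow> \<Gamma> \<tturnstile> B"
  unfolding prv_def using cut_imp conj_of_wf by (metis ImpI)

lemma prv_AndI: "\<Gamma> \<tturnstile> A \<Longrightarrow> \<Gamma> \<tturnstile> B \<Longrightarrow> \<Gamma> \<tturnstile> A \<^bold>\<and> B"
proof -
  assume "\<Gamma> \<tturnstile> A" "\<Gamma> \<tturnstile> B"
  then obtain G H where *: "conj_of \<Gamma> G" "conj_of \<Gamma> H" "{} \<turnstile> (G \<^bold>\<longrightarrow> A)" "{} \<turnstile> (H \<^bold>\<longrightarrow> B)"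
      and w [simp]: "wf [] A" "wf [] B" by (auto simp: prv_def)
  note [simp] = *(1,2)[THEN conj_of_wf]
  have "{} \<turnstile> ((G \<^bold>\<longrightarrow> A) \<^bold>\<longrightarrow> (H \<^bold>\<longrightarrow> B) \<^bold>\<longrightarrow> (G \<^bold>\<and> H) \<^bold>\<longrightarrow> (A \<^bold>\<and> B))"
    by (rule ImpI, rule ImpI, rule ImpI, rule AndI, rule ImpE[of _ G], rule Assm, simp, simp,
        rule AndE1[of _ _ H], rule Assm, simp, simp, rule ImpE[of _ H], rule Assm, simp, simp,
        rule AndE2[of _ G], rule Assm) auto
  with * have "{} \<turnstile> ((G \<^bold>\<and> H) \<^bold>\<longrightarrow> (A \<^bold>\<and> B))" using ImpE by blast
  then show ?thesis unfolding prv_def using * w conj_of.conj by auto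
qed

lemma prv_step2: "\<Gamma> \<tturnstile> A \<Longrightarrow> \<Gamma> \<tturnstile> B \<Longrightarrow> {A \<^bold>\<and> B} \<turnstile> C \<Longrightarrow> wf [] C \<Longrightarrow> \<Gamma> \<tturnstile> C"
  using prv_step prv_AndI by blast

lemma prv_AndE1: "\<Gamma> \<tturnstile> A \<^bold>\<and> B \<Longrightarrow> \<Gamma> \<tturnstile> A"
  by (rule prv_step, assumption, rule AndE1[of _ _ B], rule Assm) (auto dest: prv_wf)

lemma prv_AndE2: "\<Gamma> \<tturnstile> A \<^bold>\<and> B \<Longrightarrow> \<Gamma> \<tturnstile> B"
  by (rule prv_step, assumption, rule AndE2[of _ A], rule Assm) (auto dest: prv_wf)

lemma prv_ImpE: "\<Gamma> \<tturnstile> A \<^bold>\<longrightarrow> B \<Longrightarrow> \<Gamma> \<tturnstile> A \<Longrightarrow> \<Gamma> \<tturnstile> B"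
proof -
  assume *: "\<Gamma> \<tturnstile> A \<^bold>\<longrightarrow> B" "\<Gamma> \<tturnstile> A"
  then have [simp]: "wf [] A" "wf [] B" by (auto dest: prv_wf)
  show ?thesis
    by (rule prv_step2[OF *], rule ImpE[of _ A], rule AndE1[of _ _ A], rule Assm, simp, simp,
        rule AndE2[of _ "A \<^bold>\<longrightarrow> B"], rule Assm) auto
qed

lemma prv_FalsumE: "\<Gamma> \<tturnstile> \<^bold>\<bottom> \<Longrightarrow> wf [] A \<Longrightarrow> \<Gamma> \<tturnstile> A"
  by (erule prv_step, rule FalsumE, rule Assm) auto

lemma prv_OrI1: "\<Gamma> \<tturnstile> A \<Longrightarrow> wf [] B \<Longrightarrow> \<Gamma> \<tturnstile> A \<^bold>\<or> B"
  by (rule prv_step, assumption, rule OrI1, rule Assm) (auto dest: prv_wf)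

lemma prv_OrI2: "\<Gamma> \<tturnstile> B \<Longrightarrow> wf [] A \<Longrightarrow> \<Gamma> \<tturnstile> A \<^bold>\<or> B"
  by (rule prv_step, assumption, rule OrI2, rule Assm) (auto dest: prv_wf)

text \<open>
  A conjunction of elements of \<open>insert A \<Gamma>\<close> follows from \<open>A\<close> and a conjunction of elements of \<open>\<Gamma>\<close>.
\<close>

lemma prv_ImpI: "insert A \<Gamma> \<tturnstile> B \<Longrightarrow> wf [] A \<Longrightarrow> \<Gamma> \<tturnstile> A \<^bold>\<longrightarrow> B"
proof -
  assume "insert A \<Gamma> \<tturnstile> B" and w [simp]: "wf [] A"
  then obtain G where G: "conj_of (insert A \<Gamma>) G" "{} \<turnstile> (G \<^bold>\<longrightarrow> B)" and [simp]: "wf [] B"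
    by (auto simp: prv_def)
  have "\<exists>H. conj_of \<Gamma> H \<and> ({} \<turnstile> (H \<^bold>\<and> A) \<^bold>\<longrightarrow> G)" using G(1)
  proof induction
    case top
    have "{} \<turnstile> ((\<^bold>\<not> \<^bold>\<bottom> \<^bold>\<and> A) \<^bold>\<longrightarrow> \<^bold>\<not> \<^bold>\<bottom>)" by (intro ImpI Assm) auto
    then show ?case using conj_of.top by blast
  next
    case (mem C)
    show ?case
    proof (cases "C = A")
      case True
      have "{} \<turnstile> ((\<^bold>\<not> \<^bold>\<bottom> \<^bold>\<and> A) \<^bold>\<longrightarrow> A)" by (rule ImpI, rule AndE2, rule Assm) auto
      then show ?thesis using True conj_of.top by blast
    next
      case False
      have "{} \<turnstile> ((C \<^bold>\<and> A) \<^bold>\<longrightarrow> C)" using mem by (intro ImpI) (rule AndE1[of _ C A], rule Assm, auto)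
      then show ?thesis using False mem conj_of.mem by blast
    qed
  next
    case (conj C D)
    then obtain H K where *: "conj_of \<Gamma> H" "conj_of \<Gamma> K"
        "{} \<turnstile> ((H \<^bold>\<and> A) \<^bold>\<longrightarrow> C)" "{} \<turnstile> ((K \<^bold>\<and> A) \<^bold>\<longrightarrow> D)" by blast
    note [simp] = *(1,2)[THEN conj_of_wf] conj(1,2)[THEN conj_of_wf]
    have "{} \<turnstile> (((H \<^bold>\<and> A) \<^bold>\<longrightarrow> C) \<^bold>\<longrightarrow> ((K \<^bold>\<and> A) \<^bold>\<longrightarrow> D) \<^bold>\<longrightarrow> ((H \<^bold>\<and> K) \<^bold>\<and> A) \<^bold>\<longrightarrow> (C \<^bold>\<and> D))"
      apply (rule ImpI, rule ImpI, rule ImpI, rule AndI)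
           apply (rule ImpE[of _ "H \<^bold>\<and> A"], rule Assm, simp, simp, rule AndI)
            apply (rule AndE1[of _ H K], rule AndE1[of _ "H \<^bold>\<and> K" A], rule Assm, simp, simp)
           apply (rule AndE2[of _ "H \<^bold>\<and> K" A], rule Assm, simp, simp)
          apply (rule ImpE[of _ "K \<^bold>\<and> A"], rule Assm, simp, simp, rule AndI)
           apply (rule AndE2[of _ H K], rule AndE1[of _ "H \<^bold>\<and> K" A], rule Assm, simp, simp)
          apply (rule AndE2[of _ "H \<^bold>\<and> K" A], rule Assm)
      by simp_all
    then have "{} \<turnstile> (((H \<^bold>\<and> K) \<^bold>\<and> A) \<^bold>\<longrightarrow> (C \<^bold>\<and> D))" using * ImpE by blast
    then show ?case using * conj_of.conj by blast
  qed
  then obtain H where H: "conj_of \<Gamma> H" "{} \<turnstile> ((H \<^bold>\<and> A) \<^bold>\<longrightarrow> G)" by blast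
  note [simp] = H(1)[THEN conj_of_wf] G(1)[THEN conj_of_wf]
  have "{} \<turnstile> ((H \<^bold>\<and> A) \<^bold>\<longrightarrow> B)" using H G by (auto intro: cut_imp)
  moreover have "{} \<turnstile> (((H \<^bold>\<and> A) \<^bold>\<longrightarrow> B) \<^bold>\<longrightarrow> H \<^bold>\<longrightarrow> A \<^bold>\<longrightarrow> B)"
    by (rule ImpI, rule ImpI, rule ImpI, rule ImpE[of _ "H \<^bold>\<and> A"], rule Assm, simp, simp,
        intro AndI Assm) auto
  ultimately have "{} \<turnstile> (H \<^bold>\<longrightarrow> A \<^bold>\<longrightarrow> B)" using ImpE by blast
  then show ?thesis unfolding prv_def using H by auto
qed

lemma prv_cut: "insert A \<Gamma> \<tturnstile> B \<Longrightarrow> \<Gamma> \<tturnstile> A \<Longrightarrow> \<Gamma> \<tturnstile> B"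
  using prv_ImpI prv_ImpE prv_wf by blast

lemma prv_OrE: "\<Gamma> \<tturnstile> A \<^bold>\<or> B \<Longrightarrow> insert A \<Gamma> \<tturnstile> C \<Longrightarrow> insert B \<Gamma> \<tturnstile> C \<Longrightarrow> \<Gamma> \<tturnstile> C"
proof -
  assume *: "\<Gamma> \<tturnstile> A \<^bold>\<or> B" "insert A \<Gamma> \<tturnstile> C" "insert B \<Gamma> \<tturnstile> C"
  then have [simp]: "wf [] A" "wf [] B" "wf [] C" by (auto dest: prv_wf)
  let ?H = "(A \<^bold>\<or> B) \<^bold>\<and> (A \<^bold>\<longrightarrow> C) \<^bold>\<and> (B \<^bold>\<longrightarrow> C)"
  have "\<Gamma> \<tturnstile> ?H" using * by (auto intro!: prv_AndI prv_ImpI)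
  moreover have "{?H} \<turnstile> C"
    apply (rule OrE[of _ A B])
      apply (rule AndE1, rule Assm, simp, simp)
     apply (rule ImpE[of _ A], rule AndE1, rule AndE2[of _ "A \<^bold>\<or> B"], rule Assm, simp, simp,
         rule Assm, simp, simp)
    apply (rule ImpE[of _ B], rule AndE2, rule AndE2[of _ "A \<^bold>\<or> B"], rule Assm, simp, simp,
        rule Assm, simp, simp)
    done
  ultimately show ?thesis by (rule prv_step) simp
qed

lemma exists_fresh: "finite S \<Longrightarrow> \<exists>a::nat. a \<notin> S"
  using ex_new_if_finite infinite_UNIV_nat by blast

lemma wf_opn_id: "wf [] A \<Longrightarrow> opn k t A = A"
  by (rule opn_id) auto

lemma wf_weaken: "wf \<Delta> A \<Longrightarrow> wf (\<Delta> @ \<Delta>') A"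
proof (induction A arbitrary: \<Delta>)
  case (Pr p ts)
  then show ?case by (auto simp: list_all2_conv_all_nth has_sort_weaken)
qed (auto, metis append_Cons, metis append_Cons)

text \<open>
  From \<open>G \<^bold>\<longrightarrow> B(a)\<close> one generalises over \<open>a\<close> and moves the quantifier past \<open>G\<close>, which does not
  contain \<open>a\<close>; the second step needs an eigenvariable \<open>b\<close> of its own.
\<close>

lemma prv_AllI: "\<Gamma> \<tturnstile> opn 0 (Par a s) B \<Longrightarrow> a \<notin> \<Union> (names ` insert B \<Gamma>) \<Longrightarrow> wf [s] B \<Longrightarrow> \<Gamma> \<tturnstile> All s B"
proof -
  assume *: "\<Gamma> \<tturnstile> opn 0 (Par a s) B" "a \<notin> \<Union> (names ` insert B \<Gamma>)" and w [simp]: "wf [s] B"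
  then obtain G where G: "conj_of \<Gamma> G" "{} \<turnstile> (G \<^bold>\<longrightarrow> opn 0 (Par a s) B)" by (auto simp: prv_def)
  note wG [simp] = G(1)[THEN conj_of_wf]
  have [simp]: "wf [s] G" using wf_weaken[OF wG, of "[s]"] by simp
  have "a \<notin> names G" using conj_of_names[OF G(1)] * by auto
  then have 1: "{} \<turnstile> All s (G \<^bold>\<longrightarrow> B)"
    using G(2) *(2) by (intro AllI[of _ a]) (auto simp: wf_opn_id)
  obtain b where b: "b \<notin> names G \<union> names B" using exists_fresh[of "names G \<union> names B"] by auto
  have "{} \<turnstile> (All s (G \<^bold>\<longrightarrow> B) \<^bold>\<longrightarrow> G \<^bold>\<longrightarrow> All s B)"
  proof (rule ImpI, rule ImpI, rule AllI)
    let ?\<Delta> = "{G, All s (G \<^bold>\<longrightarrow> B)}"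
    have "?\<Delta> \<turnstile> opn 0 (Par b s) (G \<^bold>\<longrightarrow> B)" by (rule AllE, rule Assm) auto
    moreover have "?\<Delta> \<turnstile> G" by (rule Assm) auto
    ultimately show "?\<Delta> \<turnstile> opn 0 (Par b s) B" by (auto simp: wf_opn_id intro: ImpE)
    show "b \<notin> \<Union> (names ` insert B ?\<Delta>)" using b by auto
  qed auto
  with 1 have "{} \<turnstile> (G \<^bold>\<longrightarrow> All s B)" using ImpE by blast
  then show ?thesis unfolding prv_def using G by auto
qed

lemma prv_AllE: "\<Gamma> \<tturnstile> All s B \<Longrightarrow> has_sort [] t s \<Longrightarrow> \<Gamma> \<tturnstile> opn 0 t B"
proof -
  assume *: "\<Gamma> \<tturnstile> All s B" "has_sort [] t s"
  then have [simp]: "wf [s] B" by (auto dest: prv_wf)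
  show ?thesis by (rule prv_step[OF *(1)], rule AllE, rule Assm) (auto simp: * intro: wf_opn[of s])
qed

lemma prv_ExI: "\<Gamma> \<tturnstile> opn 0 t B \<Longrightarrow> has_sort [] t s \<Longrightarrow> wf [s] B \<Longrightarrow> \<Gamma> \<tturnstile> Ex s B"
  by (erule prv_step, rule ExI, rule Assm) (auto intro: wf_opn)

lemma prv_ExE:
  assumes "\<Gamma> \<tturnstile> Ex s B" "insert (opn 0 (Par a s) B) \<Gamma> \<tturnstile> C" "a \<notin> \<Union> (names ` insert B (insert C \<Gamma>))"
  shows "\<Gamma> \<tturnstile> C"
proof -
  have w [simp]: "wf [s] B" "wf [] C" using assms(1,2) by (auto dest: prv_wf)
  have [simp]: "wf [s] C" using wf_weaken[OF w(2), of "[s]"] by simp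
  have "\<Gamma> \<tturnstile> opn 0 (Par a s) (B \<^bold>\<longrightarrow> C)"
    using assms(2) by (auto simp: wf_opn_id intro!: prv_ImpI wf_opn[of s])
  then have 1: "\<Gamma> \<tturnstile> All s (B \<^bold>\<longrightarrow> C)" using assms(3) by (intro prv_AllI[of _ a]) auto
  let ?\<Delta> = "{All s (B \<^bold>\<longrightarrow> C) \<^bold>\<and> Ex s B}"
  obtain b where b: "b \<notin> names C \<union> names B" using exists_fresh[of "names C \<union> names B"] by auto
  have "?\<Delta> \<turnstile> C"
  proof (rule ExE[of _ s B b])
    show "?\<Delta> \<turnstile> Ex s B" by (rule AndE2, rule Assm) auto
    let ?\<Theta> = "insert (opn 0 (Par b s) B) ?\<Delta>"
    have "?\<Theta> \<turnstile> opn 0 (Par b s) (B \<^bold>\<longrightarrow> C)" by (rule AllE, rule AndE1, rule Assm) auto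
    moreover have "?\<Theta> \<turnstile> opn 0 (Par b s) B" by (rule Assm) (auto intro!: wf_opn[of s])
    ultimately show "?\<Theta> \<turnstile> C" by (auto simp: wf_opn_id intro: ImpE)
    show "b \<notin> \<Union> (names ` insert B (insert C ?\<Delta>))" using b by auto
  qed
  then show ?thesis using prv_step2[OF 1 assms(1)] by simp
qed

lemma prv_finite: "\<Gamma> \<tturnstile> A \<Longrightarrow> \<exists>\<Delta>\<subseteq>\<Gamma>. finite \<Delta> \<and> (\<Delta> \<tturnstile> A)"
proof -
  have "\<exists>\<Delta>\<subseteq>\<Gamma>. finite \<Delta> \<and> conj_of \<Delta> G" if "conj_of \<Gamma> G" for G using that
  proof induction
    case top
    then show ?case by (meson conj_of.top empty_subsetI finite.emptyI)
  next
    case (mem A)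
    then show ?case by (intro exI[of _ "{A}"]) (auto intro: conj_of.mem)
  next
    case (conj A B)
    then obtain \<Delta> \<Delta>' where "\<Delta> \<subseteq> \<Gamma>" "finite \<Delta>" "conj_of \<Delta> A" "\<Delta>' \<subseteq> \<Gamma>" "finite \<Delta>'" "conj_of \<Delta>' B"
        by blast
    then show ?case by (intro exI[of _ "\<Delta> \<union> \<Delta>'"]) (auto intro: conj_of.conj conj_of_mono)
  qed
  then show "\<Gamma> \<tturnstile> A \<Longrightarrow> ?thesis" unfolding prv_def by blast
qed

section \<open>Worlds and completeness\<close>

text \<open>
  A world consists of a set of names and a theory whose formulas use these names only.  The names
  are recorded separately since primeness and witnesses can only be required for formulas in these
  names: a parameter that the theory does not mention is arbitrary, and the theory does not decide
  disjunctions about it.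
\<close>

type_synonym pre_world = "nat set \<times> fm set"

text \<open>
  The domain of a world: closed terms, to be read modulo the equalities that hold at the world.
\<close>

definition elems :: "pre_world \<Rightarrow> sort \<Rightarrow> tm set" where
  "elems w s = {t. has_sort [] t s \<and> names_tm t \<subseteq> fst w}"

definition holds :: "pre_world \<Rightarrow> fm \<Rightarrow> bool"  (infix "\<Vdash>" 15) where
  "(w \<Vdash> A) \<longleftrightarrow> A \<in> snd w"

definition sentence :: "pre_world \<Rightarrow> fm \<Rightarrow> bool" where
  "sentence w A \<longleftrightarrow> wf [] A \<and> names A \<subseteq> fst w"

definition world :: "pre_world \<Rightarrow> bool" where
  "world w \<longleftrightarrow> infinite (- fst w) \<and>
    (\<forall>A. (w \<Vdash> A) \<longleftrightarrow> (snd w \<tturnstile> A) \<and> sentence w A) \<and>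
    \<not> (w \<Vdash> \<^bold>\<bottom>) \<and>
    (\<forall>A B. (w \<Vdash> A \<^bold>\<or> B) \<longrightarrow> (w \<Vdash> A) \<or> (w \<Vdash> B)) \<and>
    (\<forall>s A. (w \<Vdash> Ex s A) \<longrightarrow> (\<exists>t\<in>elems w s. w \<Vdash> opn 0 t A))"

definition ext :: "pre_world \<Rightarrow> pre_world \<Rightarrow> bool"  (infix "\<sqsubseteq>" 50) where
  "w \<sqsubseteq> w' \<longleftrightarrow> world w' \<and> fst w \<subseteq> fst w' \<and> snd w \<subseteq> snd w'"

lemma finite_subset_chain:
  fixes f :: "nat \<Rightarrow> 'a set"
  assumes "mono f" "finite X" "X \<subseteq> \<Union> (range f)"
  shows "\<exists>n. X \<subseteq> f n"
  using assms(2,3)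
proof induction
  case (insert x X)
  then obtain m n where "X \<subseteq> f n" "x \<in> f m" by auto
  then have "insert x X \<subseteq> f (max m n)"
    using monoD[OF \<open>mono f\<close>, of m "max m n"] monoD[OF \<open>mono f\<close>, of n "max m n"] by auto
  then show ?case by blast
qed auto

text \<open>
  The Lindenbaum--Henkin construction.  Run through all formulas and add each one that does not
  make \<open>C\<close> provable, together with a witness if it is existential.  The union \<open>T\<close> still does not
  prove \<open>C\<close>, and it contains every formula that can be added without making \<open>C\<close> provable; this
  maximality gives deductive closure and primeness.  Only half of the unused names serve as
  witnesses, so that infinitely many names remain unused and the construction can be repeated
  above the new world.
\<close>

lemma world_extension:
  assumes inf: "infinite (- N)" and \<Gamma>: "\<forall>A\<in>\<Gamma>. wf [] A \<and> names A \<subseteq> N"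
    and C: "\<not> (\<Gamma> \<tturnstile> C)" "wf [] C" "names C \<subseteq> N"
  shows "\<exists>w. world w \<and> N \<subseteq> fst w \<and> \<Gamma> \<subseteq> snd w \<and> \<not> (w \<Vdash> C)"
proof -
  obtain e :: "nat \<Rightarrow> nat" where e: "inj e" "range e \<subseteq> - N"
    using infinite_countable_subset[OF inf] by blast
  \<comment> \<open>Every other unused name may become a witness.\<close>
  define N1 where "N1 = range (\<lambda>n. e (2 * n))"
  define N' where "N' = N \<union> N1"
  have "infinite N1"
    unfolding N1_def using e(1) by (subst finite_image_iff) (auto intro!: injI dest!: injD[OF e(1)])
  moreover have "N1 \<inter> N = {}" using e(2) by (force simp: N1_def)
  ultimately have N1: "infinite N1" "N1 \<inter> N = {}" by auto
  have "range (\<lambda>n. e (2 * n + 1)) \<subseteq> - N'"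
    using e by (auto simp: N'_def N1_def inj_eq) presburger
  moreover have "infinite (range (\<lambda>n. e (2 * n + 1)))"
    using e(1) by (subst finite_image_iff) (auto intro!: injI dest!: injD[OF e(1)])
  ultimately have N': "infinite (- N')" using infinite_super by blast
  define P where "P = (\<lambda>G. \<Gamma> \<subseteq> G \<and> \<not> (G \<tturnstile> C) \<and> (\<forall>A\<in>G. wf [] A \<and> names A \<subseteq> N') \<and> finite (\<Union> (names `
      G) - N))"
  define R where "R = (\<lambda>F G. insert F G \<tturnstile> C) "
  define W where "W = (\<lambda>F G. \<forall>s A. F = Ex s A \<longrightarrow> (\<exists>a\<in>N1. opn 0 (Par a s) A \<in> G))"
  have step: "\<exists>G'. P G' \<and> (G \<subseteq> G' \<and> (\<forall>F. F = from_nat n \<longrightarrow> wf [] F \<longrightarrow> names F \<subseteq> N' \<longrightarrow>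
      R F G' \<or> F \<in> G' \<and> W F G'))"
    if P: "P G" for n G
  proof -
    \<comment> \<open>The formula treated in step \<open>n\<close> is added unless it makes \<open>C\<close> provable.\<close>
    define F where "F = (from_nat n :: fm)"
    consider "\<not> (wf [] F \<and> names F \<subseteq> N' \<and> \<not> R F G)" |
      "wf [] F" "names F \<subseteq> N'" "\<not> R F G" "\<And>s A. F \<noteq> Ex s A" |
      s A where "wf [] F" "names F \<subseteq> N'" "\<not> R F G" "F = Ex s A" by blast
    then show ?thesis
    proof cases
      case 1
      then show ?thesis using P by (intro exI[of _ G]) (auto simp: F_def)
    next
      case 2
      then have "P (insert F G)" using P by (auto simp: P_def R_def Un_Diff)
      with 2 show ?thesis by (intro exI[of _ "insert F G"]) (auto simp: F_def W_def)
    next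
      case 3
      let ?S = "(\<Union> (names ` insert F (insert C G)) - N)"
      have "finite ?S" using P C(3) by (auto simp: P_def Un_Diff)
      then obtain a where a: "a \<in> N1" "a \<notin> ?S" using N1 by (meson finite_subset subsetI)
      have aN: "a \<notin> N" using a N1 by auto
      let ?A = "opn 0 (Par a s) A"
      let ?G = "insert ?A (insert F G)"
      have "\<not> (?G \<tturnstile> C)"
      proof
        assume "?G \<tturnstile> C"
        moreover have "insert F G \<tturnstile> Ex s A" using 3 by (intro prv_hyp) auto
        ultimately have "insert F G \<tturnstile> C"
          using a aN 3 by (elim prv_ExE[of _ s A a]) auto
        then show False using 3 by (auto simp: R_def)
      qed
      moreover have "wf [] ?A" using 3 by (intro wf_opn[of s]) auto
      moreover have "names ?A \<subseteq> N'" "finite (names ?A - N)"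
        using 3 names_opn[of 0 "Par a s" A] a by (auto simp: N'_def)
      ultimately have "P ?G" using P 3(1,2) by (auto simp: P_def Un_Diff)
      moreover have "W F ?G" using 3 a by (auto simp: W_def)
      ultimately show ?thesis using 3 by (intro exI[of _ ?G]) (auto simp: F_def)
    qed
  qed
  have "P \<Gamma>" using assms by (auto simp: P_def N'_def intro: finite_subset[of _ "{}"])
  then have "\<exists>f. \<forall>n. P (f n) \<and> f n \<subseteq> f (Suc n) \<and>
      (\<forall>F. F = from_nat n \<longrightarrow> wf [] F \<longrightarrow> names F \<subseteq> N' \<longrightarrow>
        R F (f (Suc n)) \<or> F \<in> f (Suc n) \<and> W F (f (Suc n)))"
    by (intro dependent_nat_choice[of "\<lambda>_. P"] step exI[of _ \<Gamma>])
  then obtain f where f_all: "\<forall>n. P (f n) \<and> f n \<subseteq> f (Suc n) \<and>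
      (\<forall>F. F = from_nat n \<longrightarrow> wf [] F \<longrightarrow> names F \<subseteq> N' \<longrightarrow>
        R F (f (Suc n)) \<or> F \<in> f (Suc n) \<and> W F (f (Suc n)))" ..
  have f: "P (f n)" "f n \<subseteq> f (Suc n)"
      "F = from_nat n \<Longrightarrow> wf [] F \<Longrightarrow> names F \<subseteq> N' \<Longrightarrow> R F (f (Suc n)) \<or> F \<in> f (Suc n) \<and> W F (f (Suc
          n))" for n F
    using spec[OF f_all, of n] by simp_all
  have "mono f" by (rule monoI) (rule lift_Suc_mono_le[of f, OF f(2)])
  define T where "T = \<Union> (range f)"
  have T: "\<not> (T \<tturnstile> C)"
  proof
    assume "T \<tturnstile> C"
    then obtain \<Delta> where "\<Delta> \<subseteq> T" "finite \<Delta>" "\<Delta> \<tturnstile> C" using prv_finite by blast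
    then obtain n where "\<Delta> \<subseteq> f n" using finite_subset_chain[OF \<open>mono f\<close>] unfolding T_def by blast
    then show False using \<open>\<Delta> \<tturnstile> C\<close> f(1)[of n] prv_mono by (auto simp: P_def)
  qed
  have T_ok: "wf [] A \<and> names A \<subseteq> N'" if "A \<in> T" for A
    using that f(1) by (auto simp: T_def P_def)
  have T_max: "F \<in> T \<and> W F T" if "wf [] F" "names F \<subseteq> N'" "\<not> (insert F T \<tturnstile> C)" for F
  proof -
    have sub: "f (Suc (to_nat F)) \<subseteq> T" by (auto simp: T_def)
    then have "\<not> R F (f (Suc (to_nat F)))"
      unfolding R_def using that(3) prv_mono by (metis insert_mono)
    then have "F \<in> f (Suc (to_nat F))" "W F (f (Suc (to_nat F)))"
      using f(3)[of F "to_nat F"] that by auto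
    then show ?thesis using sub unfolding W_def by blast
  qed
  have mem: "A \<in> T" if "T \<tturnstile> A" "wf [] A" "names A \<subseteq> N'" for A
    using T_max[of A] prv_cut[of A T C] that T by blast
  have "world (N', T)"
    unfolding world_def holds_def sentence_def fst_conv snd_conv
  proof (intro conjI allI impI iffI)
    show "infinite (- N')" by fact
    show "T \<tturnstile> A" "wf [] A" "names A \<subseteq> N'" if "A \<in> T" for A
      using T_ok[OF that] that by (auto intro: prv_hyp)
    show "A \<in> T" if "(T \<tturnstile> A) \<and> wf [] A \<and> names A \<subseteq> N'" for A
      using mem that by blast
    show "\<^bold>\<bottom> \<notin> T" using T C(2) prv_hyp[of "\<^bold>\<bottom>" T] prv_FalsumE[of T C] by auto
    show "A \<in> T \<or> B \<in> T" if "(A \<^bold>\<or> B) \<in> T" for A B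
      using T_ok[OF that] T_max[of A] T_max[of B] T prv_OrE[of T A B C] prv_hyp[OF that] by auto
    show "\<exists>t\<in>elems (N', T) s. opn 0 t A \<in> T" if "Ex s A \<in> T" for s A
    proof -
      have "W (Ex s A) T" using T_ok[OF that] T_max[of "Ex s A"] T that
          by (auto simp: insert_absorb)
      then obtain a where "a \<in> N1" "opn 0 (Par a s) A \<in> T" by (auto simp: W_def)
      then show ?thesis by (intro bexI[of _ "Par a s"]) (auto simp: elems_def N'_def)
    qed
  qed
  moreover have "\<Gamma> \<subseteq> T" using f(1)[of 0] by (auto simp: P_def T_def)
  moreover have "C \<notin> T" using T C(2) prv_hyp by blast
  ultimately show ?thesis by (intro exI[of _ "(N', T)"]) (auto simp: N'_def holds_def)
qed

text \<open>
  A sentence that is not derivable is missing from some world, by \<open>world_extension\<close> applied to the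
  empty theory.
\<close>

lemma completeness:
  assumes "wf [] A" and "\<And>w. world w \<Longrightarrow> names A \<subseteq> fst w \<Longrightarrow> w \<Vdash> A"
  shows "{} \<turnstile> A"
proof -
  have "infinite (- names A)" by (simp add: finite_compl infinite_UNIV_nat Compl_eq_Diff_UNIV
      Diff_infinite_finite)
  then show ?thesis using world_extension[of "names A" "{}" A] assms prv_emptyD by blast
qed

section \<open>Forcing clauses\<close>

lemma ext_refl: "world w \<Longrightarrow> w \<sqsubseteq> w"
  by (simp add: ext_def)

lemma ext_trans: "w \<sqsubseteq> w' \<Longrightarrow> w' \<sqsubseteq> w'' \<Longrightarrow> w \<sqsubseteq> w''"
  by (auto simp: ext_def)

lemma ext_world: "w \<sqsubseteq> w' \<Longrightarrow> world w'"
  by (simp add: ext_def)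

lemma holds_mono: "w \<Vdash> A \<Longrightarrow> w \<sqsubseteq> w' \<Longrightarrow> w' \<Vdash> A"
  by (auto simp: ext_def holds_def)

lemma elems_mono: "t \<in> elems w s \<Longrightarrow> w \<sqsubseteq> w' \<Longrightarrow> t \<in> elems w' s"
  by (auto simp: ext_def elems_def)

lemma holds_prv: "world w \<Longrightarrow> snd w \<tturnstile> A \<Longrightarrow> sentence w A \<Longrightarrow> w \<Vdash> A"
  by (simp add: world_def)

lemma prv_holds: "w \<Vdash> A \<Longrightarrow> world w \<Longrightarrow> snd w \<tturnstile> A"
  by (simp add: world_def)

lemma holds_sentence: "w \<Vdash> A \<Longrightarrow> world w \<Longrightarrow> sentence w A"
  by (simp add: world_def)

lemma holds_FalsumE: "w \<Vdash> \<^bold>\<bottom> \<Longrightarrow> world w \<Longrightarrow> P"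
  by (simp add: world_def)

lemma holds_And: "world w \<Longrightarrow> (w \<Vdash> A \<^bold>\<and> B) \<longleftrightarrow> (w \<Vdash> A) \<and> (w \<Vdash> B)"
  by (auto simp: world_def sentence_def intro: prv_AndI dest: prv_AndE1 prv_AndE2)

lemma holds_OrE: "w \<Vdash> A \<^bold>\<or> B \<Longrightarrow> world w \<Longrightarrow> (w \<Vdash> A) \<or> (w \<Vdash> B)"
  unfolding world_def by blast

lemma holds_OrI1: "w \<Vdash> A \<Longrightarrow> world w \<Longrightarrow> sentence w B \<Longrightarrow> w \<Vdash> A \<^bold>\<or> B"
  by (auto simp: world_def sentence_def intro: prv_OrI1)

lemma holds_OrI2: "w \<Vdash> B \<Longrightarrow> world w \<Longrightarrow> sentence w A \<Longrightarrow> w \<Vdash> A \<^bold>\<or> B"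
  by (auto simp: world_def sentence_def intro: prv_OrI2)

lemma holds_ImpE: "w \<Vdash> A \<^bold>\<longrightarrow> B \<Longrightarrow> w \<Vdash> A \<Longrightarrow> world w \<Longrightarrow> w \<Vdash> B"
  by (auto simp: world_def sentence_def intro: prv_ImpE)

text \<open>
  If \<open>A \<^bold>\<longrightarrow> B\<close> is not in the theory, then \<open>B\<close> is not provable after adding \<open>A\<close>, and there is a
  larger world with \<open>A\<close> but without \<open>B\<close>.
\<close>

lemma holds_ImpI:
  assumes w: "world w" and ok: "sentence w (A \<^bold>\<longrightarrow> B)"
    and *: "\<And>w'. w \<sqsubseteq> w' \<Longrightarrow> w' \<Vdash> A \<Longrightarrow> w' \<Vdash> B"
  shows "w \<Vdash> A \<^bold>\<longrightarrow> B"
proof (rule ccontr)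
  assume "\<not> (w \<Vdash> A \<^bold>\<longrightarrow> B)"
  then have "\<not> (insert A (snd w) \<tturnstile> B)"
    using w ok prv_ImpI holds_prv by (fastforce simp: sentence_def)
  moreover have "infinite (- fst w)" "\<forall>A\<in>snd w. wf [] A \<and> names A \<subseteq> fst w"
    using w by (auto simp: world_def sentence_def holds_def)
  ultimately obtain w' where "world w'" "fst w \<subseteq> fst w'" "insert A (snd w) \<subseteq> snd w'" "\<not> (w' \<Vdash> B)"
    using world_extension[of "fst w" "insert A (snd w)" B] w ok
    by (auto simp: sentence_def)
  then show False using *[of w'] by (auto simp: ext_def holds_def)
qed

text \<open>
  Likewise with a parameter \<open>a\<close> outside the world in place of the assumption \<open>A\<close>: it becomes an
  element of the larger world.
\<close>

lemma holds_All_db: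
  assumes w: "world w" and ok: "sentence w (All s B)"
    and *: "\<And>w' t. w \<sqsubseteq> w' \<Longrightarrow> t \<in> elems w' s \<Longrightarrow> w' \<Vdash> opn 0 t B"
  shows "w \<Vdash> All s B"
proof (rule ccontr)
  assume *: "\<not> (w \<Vdash> All s B)"
  obtain a where a: "a \<notin> fst w" using w unfolding world_def
      by (metis Compl_iff finite.emptyI ex_in_conv)
  have names: "\<forall>A\<in>insert B (snd w). names A \<subseteq> fst w"
    using w ok by (auto simp: world_def sentence_def holds_def)
  then have "a \<notin> \<Union> (names ` insert B (snd w))" using a by blast
  then have "\<not> (snd w \<tturnstile> opn 0 (Par a s) B)"
    using * prv_AllI[of "snd w" a s B] ok holds_prv[OF w] by (auto simp: sentence_def)
  moreover have "infinite (- insert a (fst w))" using w by (auto simp: world_def Compl_insert)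
  moreover have "\<forall>A\<in>snd w. wf [] A \<and> names A \<subseteq> insert a (fst w)"
    using w by (auto simp: world_def sentence_def holds_def)
  moreover have "wf [] (opn 0 (Par a s) B)" "names (opn 0 (Par a s) B) \<subseteq> insert a (fst w)"
    using ok names_opn[of 0 "Par a s" B] by (auto simp: sentence_def intro!: wf_opn[of s])
  ultimately obtain w' where "world w'" "insert a (fst w) \<subseteq> fst w'" "snd w \<subseteq> snd w'" "\<not> (w' \<Vdash> opn
      0 (Par a s) B)"
    using world_extension by metis
  then show False using assms(3)[of w' "Par a s"] by (auto simp: ext_def elems_def)
qed

lemma holds_AllE_db: "w \<Vdash> All s B \<Longrightarrow> t \<in> elems w s \<Longrightarrow> world w \<Longrightarrow> w \<Vdash> opn 0 t B"
  using prv_AllE[of "snd w" s B t] holds_prv[of w "opn 0 t B"] wf_opn[of s B t] names_opn[of 0 t B]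
  by (auto simp: world_def sentence_def elems_def)

lemma holds_ExI_db: "w \<Vdash> opn 0 t B \<Longrightarrow> t \<in> elems w s \<Longrightarrow> wf [s] B \<Longrightarrow> world w \<Longrightarrow> w \<Vdash> Ex s B"
  using prv_ExI[of "snd w" t B s] holds_prv[of w "Ex s B"] names_opn'[of B 0 t]
  by (auto simp: world_def sentence_def elems_def)

lemma holds_ExE_db: "w \<Vdash> Ex s B \<Longrightarrow> world w \<Longrightarrow> \<exists>t\<in>elems w s. w \<Vdash> opn 0 t B"
  unfolding world_def by blast

section \<open>Definable families of formulas\<close>

text \<open>
  Formulas are written with functions on terms, as in \<open>\<^bold>\<forall>x:s. F x\<close>, and all rules for quantifiers
  need that \<open>F\<close> is substitution into some formula.  The following closure properties establish
  this for every formula that occurs, so that the side conditions are discharged by backward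
  chaining.
\<close>

primrec shift_tm :: "nat \<Rightarrow> tm \<Rightarrow> tm" where
  "shift_tm k (Par a s) = Par a s"
| "shift_tm k (Bound i) = Bound (if i < k then i else Suc i)"
| "shift_tm k (Fn f us) = Fn f (map (shift_tm k) us)"

primrec shift :: "nat \<Rightarrow> fm \<Rightarrow> fm" where
  "shift k (Pr p us) = Pr p (map (shift_tm k) us)"
| "shift k \<^bold>\<bottom> = \<^bold>\<bottom>"
| "shift k (A \<^bold>\<and> B) = (shift k A \<^bold>\<and> shift k B)"
| "shift k (A \<^bold>\<or> B) = (shift k A \<^bold>\<or> shift k B)"
| "shift k (A \<^bold>\<longrightarrow> B) = (shift k A \<^bold>\<longrightarrow> shift k B)"
| "shift k (All s A) = All s (shift (Suc k) A)"
| "shift k (Ex s A) = Ex s (shift (Suc k) A)"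

lemma names_shift_tm [simp]: "names_tm (shift_tm k u) = names_tm u"
  by (induction u) auto

lemma names_shift [simp]: "names (shift k A) = names A"
  by (induction A arbitrary: k) auto

lemma sub_shift_tm: "sub_tm k (t # ts) (shift_tm k u) = sub_tm k ts u"
  by (induction u) (auto simp: Suc_diff_le)

lemma sub_shift: "sub k (t # ts) (shift k A) = sub k ts A"
  by (induction A arbitrary: k) (auto simp: sub_shift_tm)

lemma has_sort_shift_tm:
  "has_sort (\<Delta> @ \<Delta>') u s \<Longrightarrow> has_sort (\<Delta> @ r # \<Delta>') (shift_tm (length \<Delta>) u) s"
proof (induction u arbitrary: s)
  case (Bound i)
  then show ?case by (auto simp: nth_append Suc_diff_le)
qed (auto simp: list_all2_conv_all_nth)

lemma wf_shift: "wf (\<Delta> @ \<Delta>') A \<Longrightarrow> wf (\<Delta> @ r # \<Delta>') (shift (length \<Delta>) A)"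
proof (induction A arbitrary: \<Delta>)
  case (Pr p us)
  then show ?case by (auto simp: list_all2_conv_all_nth has_sort_shift_tm)
next
  case (All s A) then show ?case using All.IH[of "s # \<Delta>"] by simp
next
  case (Ex s A) then show ?case using Ex.IH[of "s # \<Delta>"] by simp
qed auto

definition env :: "sort list \<Rightarrow> tm list \<Rightarrow> bool" where
  "env \<Delta> ts \<longleftrightarrow> length ts = length \<Delta> \<and> (\<forall>t\<in>set ts. closed t)"

definition definable_tm :: "nat set \<Rightarrow> sort list \<Rightarrow> (tm list \<Rightarrow> tm) \<Rightarrow> sort \<Rightarrow> bool" where
  "definable_tm N \<Delta> f s \<longleftrightarrow>
    (\<exists>u. has_sort \<Delta> u s \<and> names_tm u \<subseteq> N \<and> (\<forall>ts. env \<Delta> ts \<longrightarrow> f ts = sub_tm 0 ts u))"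

text \<open>
  \<open>F\<close> is a formula with free variables of the sorts \<open>\<Delta>\<close> and parameters in \<open>N\<close>, given as a function
  of the values of its variables; the first variable is the one bound most recently.
\<close>

definition definable :: "nat set \<Rightarrow> sort list \<Rightarrow> (tm list \<Rightarrow> fm) \<Rightarrow> bool" where
  "definable N \<Delta> F \<longleftrightarrow>
    (\<exists>B. wf \<Delta> B \<and> names B \<subseteq> N \<and> (\<forall>ts. env \<Delta> ts \<longrightarrow> F ts = sub 0 ts B))"

lemma env_Cons [simp]: "env (s # \<Delta>) (t # ts) \<longleftrightarrow> closed t \<and> env \<Delta> ts"
  by (auto simp: env_def)

lemma env_ConsE: "env (s # \<Delta>) ts \<Longrightarrow> (\<And>t us. ts = t # us \<Longrightarrow> closed t \<Longrightarrow> env \<Delta> us \<Longrightarrow> P) \<Longrightarrow> P"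
  by (cases ts) (auto simp: env_def)

lemma env_Nil [simp]: "env [] ts \<longleftrightarrow> ts = []"
  by (auto simp: env_def)

lemma definable_tm_const: "has_sort [] t s \<Longrightarrow> names_tm t \<subseteq> N \<Longrightarrow> definable_tm N \<Delta> (\<lambda>_. t) s"
  unfolding definable_tm_def using has_sort_weaken[of "[]" t s \<Delta>] sub_tm_Nil[of "[]" t s 0]
      by (intro exI[of _ t]) auto

lemma definable_tm_elems: "t \<in> elems w s \<Longrightarrow> definable_tm (fst w) \<Delta> (\<lambda>_. t) s"
  by (simp add: elems_def definable_tm_const)

lemma definable_tm_hd: "s = r \<Longrightarrow> definable_tm N (r # \<Delta>) hd s"
  unfolding definable_tm_def by (intro exI[of _ "Bound 0"]) (auto elim!: env_ConsE)

lemma definable_tm_tl: "definable_tm N \<Delta> f s \<Longrightarrow> definable_tm N (r # \<Delta>) (\<lambda>ts. f (tl ts)) s"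
  unfolding definable_tm_def
proof (elim exE conjE)
  fix u assume "has_sort \<Delta> u s" "names_tm u \<subseteq> N" "\<forall>ts. env \<Delta> ts \<longrightarrow> f ts = sub_tm 0 ts u"
  then show "\<exists>u. has_sort (r # \<Delta>) u s \<and> names_tm u \<subseteq> N \<and> (\<forall>ts. env (r # \<Delta>) ts \<longrightarrow>
      f (tl ts) = sub_tm 0 ts u)"
    using has_sort_shift_tm[of "[]" \<Delta> u s r]
    by (intro exI[of _ "shift_tm 0 u"]) (auto elim!: env_ConsE simp: sub_shift_tm)
qed

lemma definable_tm_Fn0: "fsym_args g = [] \<Longrightarrow> s = fsym_result g \<Longrightarrow> definable_tm N \<Delta> (\<lambda>ts. Fn g []) s"
  unfolding definable_tm_def by (intro exI[of _ "Fn g []"]) auto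

lemma definable_tm_Fn1:
  "length (fsym_args g) = 1 \<Longrightarrow> s = fsym_result g \<Longrightarrow> definable_tm N \<Delta> f (fsym_args g ! 0) \<Longrightarrow>
      definable_tm N \<Delta> (\<lambda>ts. Fn g [f ts]) s"
  unfolding definable_tm_def
proof (elim exE conjE)
  fix u assume "length (fsym_args g) = 1" "s = fsym_result g"
    "has_sort \<Delta> u (fsym_args g ! 0)" "names_tm u \<subseteq> N" "\<forall>ts. env \<Delta> ts \<longrightarrow> f ts = sub_tm 0 ts u"
  then show "\<exists>u. has_sort \<Delta> u s \<and> names_tm u \<subseteq> N \<and> (\<forall>ts. env \<Delta> ts \<longrightarrow> Fn g [f ts] = sub_tm 0 ts u)"
    by (intro exI[of _ "Fn g [u]"]) (auto simp: list_all2_conv_all_nth)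
qed

lemma definable_tm_Fn2:
  "length (fsym_args g) = 2 \<Longrightarrow> s = fsym_result g \<Longrightarrow> definable_tm N \<Delta> f (fsym_args g ! 0) \<Longrightarrow>
    definable_tm N \<Delta> f' (fsym_args g ! 1) \<Longrightarrow> definable_tm N \<Delta> (\<lambda>ts. Fn g [f ts, f' ts]) s"
  unfolding definable_tm_def
proof (elim exE conjE)
  fix u u' assume "length (fsym_args g) = 2" "s = fsym_result g"
    "has_sort \<Delta> u (fsym_args g ! 0)" "names_tm u \<subseteq> N" "\<forall>ts. env \<Delta> ts \<longrightarrow> f ts = sub_tm 0 ts u"
    "has_sort \<Delta> u' (fsym_args g ! 1)" "names_tm u' \<subseteq> N" "\<forall>ts. env \<Delta> ts \<longrightarrow> f' ts = sub_tm 0 ts u'"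
  then show "\<exists>u. has_sort \<Delta> u s \<and> names_tm u \<subseteq> N \<and> (\<forall>ts. env \<Delta> ts \<longrightarrow> Fn g [f ts,
      f' ts] = sub_tm 0 ts u)"
    by (intro exI[of _ "Fn g [u, u']"]) (auto simp: list_all2_conv_all_nth nth_Cons'
        numeral_2_eq_2 less_Suc_eq)
qed

lemma definable_Pr1:
  "length (psym_args g) = 1 \<Longrightarrow> definable_tm N \<Delta> f (psym_args g ! 0) \<Longrightarrow>
      definable N \<Delta> (\<lambda>ts. Pr g [f ts])"
  unfolding definable_tm_def definable_def
proof (elim exE conjE)
  fix u assume "length (psym_args g) = 1"
    "has_sort \<Delta> u (psym_args g ! 0)" "names_tm u \<subseteq> N" "\<forall>ts. env \<Delta> ts \<longrightarrow> f ts = sub_tm 0 ts u"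
  then show "\<exists>B. wf \<Delta> B \<and> names B \<subseteq> N \<and> (\<forall>ts. env \<Delta> ts \<longrightarrow> Pr g [f ts] = sub 0 ts B)"
    by (intro exI[of _ "Pr g [u]"]) (auto simp: list_all2_conv_all_nth)
qed

lemma definable_Pr2:
  "length (psym_args g) = 2 \<Longrightarrow> definable_tm N \<Delta> f (psym_args g ! 0) \<Longrightarrow>
    definable_tm N \<Delta> f' (psym_args g ! 1) \<Longrightarrow> definable N \<Delta> (\<lambda>ts. Pr g [f ts, f' ts])"
  unfolding definable_tm_def definable_def
proof (elim exE conjE)
  fix u u' assume "length (psym_args g) = 2"
    "has_sort \<Delta> u (psym_args g ! 0)" "names_tm u \<subseteq> N" "\<forall>ts. env \<Delta> ts \<longrightarrow> f ts = sub_tm 0 ts u"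
    "has_sort \<Delta> u' (psym_args g ! 1)" "names_tm u' \<subseteq> N" "\<forall>ts. env \<Delta> ts \<longrightarrow> f' ts = sub_tm 0 ts u'"
  then show "\<exists>B. wf \<Delta> B \<and> names B \<subseteq> N \<and> (\<forall>ts. env \<Delta> ts \<longrightarrow> Pr g [f ts, f' ts] = sub 0 ts B)"
    by (intro exI[of _ "Pr g [u, u']"]) (auto simp: list_all2_conv_all_nth nth_Cons'
        numeral_2_eq_2 less_Suc_eq)
qed

lemma definable_Falsum: "definable N \<Delta> (\<lambda>ts. \<^bold>\<bottom>)"
  unfolding definable_def by (intro exI[of _ "\<^bold>\<bottom>"]) auto

lemma definable_And: "definable N \<Delta> F \<Longrightarrow> definable N \<Delta> G \<Longrightarrow> definable N \<Delta> (\<lambda>ts. F ts \<^bold>\<and> G ts)"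
  unfolding definable_def by (elim exE, rename_tac A B, rule_tac x = "A \<^bold>\<and> B" in exI) auto

lemma definable_Or: "definable N \<Delta> F \<Longrightarrow> definable N \<Delta> G \<Longrightarrow> definable N \<Delta> (\<lambda>ts. F ts \<^bold>\<or> G ts)"
  unfolding definable_def by (elim exE, rename_tac A B, rule_tac x = "A \<^bold>\<or> B" in exI) auto

lemma definable_Imp: "definable N \<Delta> F \<Longrightarrow> definable N \<Delta> G \<Longrightarrow> definable N \<Delta> (\<lambda>ts. F ts \<^bold>\<longrightarrow> G ts)"
  unfolding definable_def by (elim exE, rename_tac A B, rule_tac x = "A \<^bold>\<longrightarrow> B" in exI) auto

text \<open>
  The value at \<open>Fn Zero []\<close> shows all names of \<open>X\<close>, so the parameter that the notation for
  quantifiers picks does not occur in \<open>X\<close>.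
\<close>

lemma bind_fresh_name:
  assumes "\<And>t. closed t \<Longrightarrow> F t = opn 0 t X"
  shows "cls 0 (fresh_name F) s (F (Par (fresh_name F) s)) = X"
proof -
  have "fresh_name F \<notin> names (F 0\<^sub>N)"
    unfolding fresh_name_def by (metis Max_ge finite.insertI finite_names insertCI not_less_eq_eq
        order_refl)
  then have "fresh_name F \<notin> names X" using names_opn'[of X 0 "0\<^sub>N"] assms[of "0\<^sub>N"] by auto
  then show ?thesis by (simp add: assms cls_opn)
qed

lemma definable_quantifier:
  assumes "definable N (s # \<Delta>) (\<lambda>ts. F (tl ts) (hd ts))"
  obtains B where "wf (s # \<Delta>) B" "names B \<subseteq> N"
    "\<And>ts t. env \<Delta> ts \<Longrightarrow> closed t \<Longrightarrow> F ts t = opn 0 t (sub (Suc 0) ts B)"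
    "\<And>ts. env \<Delta> ts \<Longrightarrow> Forall s (F ts) = All s (sub (Suc 0) ts B)"
    "\<And>ts. env \<Delta> ts \<Longrightarrow> Exists s (F ts) = Ex s (sub (Suc 0) ts B)"
proof -
  obtain B where B: "wf (s # \<Delta>) B" "names B \<subseteq> N"
      "\<And>ts. env (s # \<Delta>) ts \<Longrightarrow> F (tl ts) (hd ts) = sub 0 ts B"
    using assms by (auto simp: definable_def)
  have eq: "F ts t = opn 0 t (sub (Suc 0) ts B)" if "env \<Delta> ts" "closed t" for ts t
    using B(3)[of "t # ts"] that opn_sub[OF B(1), of 0 ts t] by (simp add: env_def)
  then have "cls 0 (fresh_name (F ts)) s (F ts (Par (fresh_name (F ts)) s)) = sub (Suc 0) ts B"
    if "env \<Delta> ts" for ts using bind_fresh_name that by blast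
  with B eq that show ?thesis by (metis Forall_def Exists_def)
qed

lemma definable_Forall: "definable N (s # \<Delta>) (\<lambda>ts. F (tl ts) (hd ts)) \<Longrightarrow>
    definable N \<Delta> (\<lambda>ts. Forall s (F ts))"
  by (erule definable_quantifier, unfold definable_def, rule_tac x = "All s B" in exI) auto

lemma definable_Exists: "definable N (s # \<Delta>) (\<lambda>ts. F (tl ts) (hd ts)) \<Longrightarrow>
    definable N \<Delta> (\<lambda>ts. Exists s (F ts))"
  by (erule definable_quantifier, unfold definable_def, rule_tac x = "Ex s B" in exI) auto

lemma definable_closed_iff: "definable N [] (\<lambda>_. A) \<longleftrightarrow> wf [] A \<and> names A \<subseteq> N"
  unfolding definable_def using sub_id[of "[]" _ 0 "[]"] by auto

lemma sentence_iff: "sentence w A \<longleftrightarrow> definable (fst w) [] (\<lambda>_. A)"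
  by (simp add: sentence_def definable_closed_iff)

lemma definable_tl: "definable N \<Delta> F \<Longrightarrow> definable N (r # \<Delta>) (\<lambda>ts. F (tl ts))"
  unfolding definable_def
proof (elim exE conjE)
  fix B assume "wf \<Delta> B" "names B \<subseteq> N" "\<forall>ts. env \<Delta> ts \<longrightarrow> F ts = sub 0 ts B"
  then show "\<exists>B. wf (r # \<Delta>) B \<and> names B \<subseteq> N \<and> (\<forall>ts. env (r # \<Delta>) ts \<longrightarrow> F (tl ts) = sub 0 ts B)"
    using wf_shift[of "[]" \<Delta> B r]
    by (intro exI[of _ "shift 0 B"]) (auto elim!: env_ConsE simp: sub_shift)
qed

lemma definable_single:
  assumes "definable N [s] (\<lambda>ts. F (hd ts))"
  obtains B where "wf [s] B" "names B \<subseteq> N" "\<And>t. closed t \<Longrightarrow> F t = opn 0 t B"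
    "Forall s F = All s B" "Exists s F = Ex s B"
  using assms by (rule definable_quantifier[where F = "\<lambda>_. F"])
    (use sub_id[of "[s]" _ "Suc 0" "[]"] in auto)

lemma elems_closed: "t \<in> elems w s \<Longrightarrow> closed t"
  by (auto simp: elems_def has_sort_closed)

lemma holds_ForallI:
  assumes "world w" "definable (fst w) [s] (\<lambda>ts. F (hd ts))"
    and "\<And>w' t. w \<sqsubseteq> w' \<Longrightarrow> t \<in> elems w' s \<Longrightarrow> w' \<Vdash> F t"
  shows "w \<Vdash> Forall s F"
proof -
  obtain B where B: "wf [s] B" "names B \<subseteq> fst w" "\<And>t. closed t \<Longrightarrow>
      F t = opn 0 t B" "Forall s F = All s B"
    using assms(2) by (rule definable_single) blast
  show ?thesis unfolding B(4)
    by (rule holds_All_db[OF assms(1)])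
      (use assms(3) B elems_closed in \<open>auto simp: sentence_def\<close>)
qed

lemma holds_ForallE:
  assumes "w \<Vdash> Forall s F" "definable N [s] (\<lambda>ts. F (hd ts))" "t \<in> elems w s" "world w"
  shows "w \<Vdash> F t"
  using assms(2) by (rule definable_single) (use assms holds_AllE_db elems_closed in metis)

lemma holds_ExistsI:
  assumes "w \<Vdash> F t" "t \<in> elems w s" "definable N [s] (\<lambda>ts. F (hd ts))" "world w"
  shows "w \<Vdash> Exists s F"
  using assms(3) by (rule definable_single) (use assms holds_ExI_db elems_closed in metis)

lemma holds_ExistsE:
  assumes "w \<Vdash> Exists s F" "definable N [s] (\<lambda>ts. F (hd ts))" "world w"
  obtains t where "t \<in> elems w s" "w \<Vdash> F t"
  using assms(2) by (rule definable_single) (use assms holds_ExE_db elems_closed that in metis)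

lemma prv_Forall:
  assumes "\<Gamma> \<tturnstile> Forall s F" "definable N [s] (\<lambda>ts. F (hd ts))" "has_sort [] t s"
  shows "\<Gamma> \<tturnstile> F t"
  using assms(2) by (rule definable_single) (use assms prv_AllE has_sort_closed in metis)

lemma definable_const: "wf [] A \<Longrightarrow> names A \<subseteq> N \<Longrightarrow> definable N \<Delta> (\<lambda>_. A)"
  unfolding definable_def using wf_weaken[of "[]" A \<Delta>] sub_id[of "[]" A 0]
      by (intro exI[of _ A]) auto

lemma definable_opn: "wf [s] B \<Longrightarrow> names B \<subseteq> N \<Longrightarrow> definable N (s # \<Delta>) (\<lambda>ts. opn 0 (hd ts) B)"
  unfolding definable_def
proof (intro exI[of _ B] conjI allI impI)
  fix ts assume B: "wf [s] B" and "env (s # \<Delta>) ts"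
  then obtain t us where ts: "ts = t # us" "closed t" "env \<Delta> us" by (elim env_ConsE)
  then show "opn 0 (hd ts) B = sub 0 ts B"
    using opn_sub[OF B, of 0 us t] sub_id[OF B, of "Suc 0" us] by (simp add: env_def)
qed (use wf_weaken[of "[s]" B \<Delta>] in auto)

text \<open>
  The order matters for backward chaining: a term without free variables is closed off at once,
  and variables are removed from the environment last.
\<close>

lemmas definable_tm_rules = definable_tm_const definable_tm_hd definable_tm_Fn0 definable_tm_Fn1
    definable_tm_Fn2 definable_tm_tl
lemmas definable_logic = definable_Pr1 definable_Pr2 definable_Falsum definable_And definable_Or
    definable_Imp definable_Forall definable_Exists

lemma definable_nle: "definable_tm N \<Delta> f Nat \<Longrightarrow> definable_tm N \<Delta> g Nat \<Longrightarrow>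
    definable N \<Delta> (\<lambda>ts. f ts \<le>\<^sub>N g ts)"
  unfolding nle_def by (intro definable_logic definable_tm_rules) auto

lemma definable_qle: "definable_tm N \<Delta> f Rat \<Longrightarrow> definable_tm N \<Delta> g Rat \<Longrightarrow>
    definable N \<Delta> (\<lambda>ts. f ts \<le>\<^sub>Q g ts)"
  unfolding qle_def by (intro definable_logic) auto

lemma definable_Forall_pos: "definable N (Nat # \<Delta>) (\<lambda>ts. F (tl ts) (hd ts)) \<Longrightarrow>
    definable N \<Delta> (\<lambda>ts. Forall_pos (F ts))"
  unfolding Forall_pos_def by (intro definable_logic definable_nle definable_tm_rules) auto

lemma definable_Exists_pos: "definable N (Nat # \<Delta>) (\<lambda>ts. F (tl ts) (hd ts)) \<Longrightarrow>
    definable N \<Delta> (\<lambda>ts. Exists_pos (F ts))"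
  unfolding Exists_pos_def by (intro definable_logic definable_nle definable_tm_rules) auto

lemmas definable_numbers = definable_logic definable_nle definable_qle definable_Forall_pos
    definable_Exists_pos

lemma definable_qdist_le:
  "definable_tm N \<Delta> f Rat \<Longrightarrow> definable_tm N \<Delta> g Rat \<Longrightarrow> definable_tm N \<Delta> h Rat \<Longrightarrow>
      definable N \<Delta> (\<lambda>ts. qdist_le (f ts) (g ts) (h ts))"
  unfolding qdist_le_def by (intro definable_numbers definable_tm_rules) auto

lemma definable_is_real: "definable_tm N \<Delta> f (Seq Rat) \<Longrightarrow> definable N \<Delta> (\<lambda>ts. is_real (f ts))"
  unfolding is_real_def by (intro definable_numbers definable_qdist_le definable_tm_rules) auto

lemma definable_Forall_real: "definable N (Seq Rat # \<Delta>) (\<lambda>ts. F (tl ts) (hd ts)) \<Longrightarrow>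
    definable N \<Delta> (\<lambda>ts. Forall_real (F ts))"
  unfolding Forall_real_def by (intro definable_logic definable_is_real definable_tm_rules) auto

lemma definable_Exists_real: "definable N (Seq Rat # \<Delta>) (\<lambda>ts. F (tl ts) (hd ts)) \<Longrightarrow>
    definable N \<Delta> (\<lambda>ts. Exists_real (F ts))"
  unfolding Exists_real_def by (intro definable_logic definable_is_real definable_tm_rules) auto

lemma definable_req: "definable_tm N \<Delta> f (Seq Rat) \<Longrightarrow> definable_tm N \<Delta> g (Seq Rat) \<Longrightarrow>
    definable N \<Delta> (\<lambda>ts. f ts =\<^sub>R g ts)"
  unfolding req_def by (intro definable_numbers definable_qdist_le definable_tm_rules) auto

lemma definable_rless: "definable_tm N \<Delta> f (Seq Rat) \<Longrightarrow> definable_tm N \<Delta> g (Seq Rat) \<Longrightarrow>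
    definable N \<Delta> (\<lambda>ts. f ts <\<^sub>R g ts)"
  unfolding rless_def rpos_def by (intro definable_numbers definable_tm_rules) auto

lemma definable_rle: "definable_tm N \<Delta> f (Seq Rat) \<Longrightarrow> definable_tm N \<Delta> g (Seq Rat) \<Longrightarrow>
    definable N \<Delta> (\<lambda>ts. f ts \<le>\<^sub>R g ts)"
  unfolding rle_def rnonneg_def by (intro definable_numbers definable_tm_rules) auto

lemma definable_eqX: "definable_tm N \<Delta> f Pt \<Longrightarrow> definable_tm N \<Delta> g Pt \<Longrightarrow>
    definable N \<Delta> (\<lambda>ts. f ts =\<^sub>X g ts)"
  unfolding eqX_def by (intro definable_req definable_tm_rules) auto

lemma definable_neqX: "definable_tm N \<Delta> f Pt \<Longrightarrow> definable_tm N \<Delta> g Pt \<Longrightarrow>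
    definable N \<Delta> (\<lambda>ts. f ts \<noteq>\<^sub>X g ts)"
  unfolding neqX_def by (intro definable_rless definable_tm_rules) auto

lemmas definable_analysis = definable_numbers definable_qdist_le definable_is_real
    definable_Forall_real definable_Exists_real
  definable_req definable_rless definable_rle definable_eqX definable_neqX

lemma definable_is_dist_Q: "definable_tm N \<Delta> f Pt \<Longrightarrow> definable_tm N \<Delta> g (Seq Rat) \<Longrightarrow>
    definable N \<Delta> (\<lambda>ts. is_dist_Q (f ts) (g ts))"
  unfolding is_dist_Q_def by (intro definable_analysis definable_tm_rules) auto

lemma definable_converges: "definable_tm N \<Delta> f (Seq Pt) \<Longrightarrow> definable N \<Delta> (\<lambda>ts. converges (f ts))"
  unfolding converges_def by (intro definable_analysis definable_tm_rules) auto

lemma definable_binary: "definable_tm N \<Delta> f (Seq Nat) \<Longrightarrow> definable N \<Delta> (\<lambda>ts. binary (f ts))"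
  unfolding binary_def by (intro definable_analysis definable_tm_rules) auto

lemma definable_increasing: "definable_tm N \<Delta> f (Seq Nat) \<Longrightarrow> definable N \<Delta> (\<lambda>ts. increasing (f ts))"
  unfolding increasing_def by (intro definable_analysis definable_tm_rules) auto

lemma definable_is_switch:
  "definable_tm N \<Delta> l (Seq Nat) \<Longrightarrow> definable_tm N \<Delta> q (Seq Pt) \<Longrightarrow>
      definable_tm N (Nat # \<Delta>) (\<lambda>ts. u (tl ts) (hd ts)) Pt \<Longrightarrow>
    definable_tm N \<Delta> s (Seq Pt) \<Longrightarrow> definable N \<Delta> (\<lambda>ts. is_switch (l ts) (q ts) (u ts) (s ts))"
  unfolding is_switch_def by (intro definable_analysis definable_tm_rules) auto

lemma definable_complete_enough: "definable_tm N \<Delta> f Pt \<Longrightarrow>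
    definable N \<Delta> (\<lambda>ts. complete_enough (f ts))"
  unfolding complete_enough_def
  by (intro definable_analysis definable_converges definable_binary definable_increasing
      definable_is_switch definable_tm_rules) auto

lemma definable_metric_space: "definable N \<Delta> (\<lambda>ts. metric_space)"
  unfolding metric_space_def by (intro definable_analysis definable_tm_rules) auto

lemma definable_subset_Q: "definable N \<Delta> (\<lambda>ts. subset_Q)"
  unfolding subset_Q_def by (intro definable_analysis definable_tm_rules) auto

lemma definable_located_Q: "definable N \<Delta> (\<lambda>ts. located_Q)"
  unfolding located_Q_def by (intro definable_analysis definable_is_dist_Q definable_tm_rules) auto

lemma definable_LPO: "definable N \<Delta> (\<lambda>ts. LPO)"
  unfolding LPO_def by (intro definable_analysis definable_binary definable_tm_rules) auto

lemmas definable_rules = definable_analysis definable_is_dist_Q definable_converges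
    definable_binary definable_increasing
  definable_is_switch definable_complete_enough definable_metric_space definable_subset_Q
      definable_located_Q definable_LPO

section \<open>Equality, induction and choice at a world\<close>

lemma prv_axiom1:
  assumes "axiom (Forall s F)" "definable UNIV [s] (\<lambda>ts. F (hd ts))" "has_sort [] t s"
  shows "\<Gamma> \<tturnstile> F t"
proof (rule prv_Forall[OF _ assms(2,3)])
  have "definable UNIV [] (\<lambda>ts. Forall s F)" using assms(2) by (intro definable_Forall)
  then show "\<Gamma> \<tturnstile> Forall s F" using assms(1) by (intro prv_axiom) (auto simp: definable_closed_iff)
qed

lemma prv_axiom2:
  assumes "axiom (Forall s (\<lambda>x. Forall r (F x)))" "definable UNIV [r,
      s] (\<lambda>ts. F (hd (tl ts)) (hd ts))"
    "definable UNIV [r] (\<lambda>ts. F t (hd ts))" "has_sort [] t s" "has_sort [] u r"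
  shows "\<Gamma> \<tturnstile> F t u"
proof (rule prv_Forall[OF _ assms(3,5)])
  have "definable UNIV [s] (\<lambda>ts. Forall r (F (hd ts)))" using assms(2) by (intro definable_Forall)
  then show "\<Gamma> \<tturnstile> Forall r (F t)" using prv_axiom1[OF assms(1) _ assms(4)] by simp
qed

lemma prv_axiom3:
  assumes "axiom (Forall s (\<lambda>x. Forall r (\<lambda>y. Forall q (F x y))))"
    "definable UNIV [q, r, s] (\<lambda>ts. F (hd (tl (tl ts))) (hd (tl ts)) (hd ts))"
    "definable UNIV [q, r] (\<lambda>ts. F t (hd (tl ts)) (hd ts))"
    "definable UNIV [q] (\<lambda>ts. F t u (hd ts))" "has_sort [] t s" "has_sort [] u r" "has_sort [] v q"
  shows "\<Gamma> \<tturnstile> F t u v"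
proof (rule prv_Forall[OF _ assms(4,7)])
  have "definable UNIV [r, s] (\<lambda>ts. Forall q (F (hd (tl ts)) (hd ts)))" "definable UNIV [r] (\<lambda>ts.
      Forall q (F t (hd ts)))"
    using assms(2,3) by (auto intro!: definable_Forall)
  then show "\<Gamma> \<tturnstile> Forall q (F t u)" using prv_axiom2[OF assms(1) _ _ assms(5,6)] by simp
qed

lemma prv_refl: "has_sort [] t s \<Longrightarrow> \<Gamma> \<tturnstile> t =\<^bsub>s\<^esub> t"
  by (rule prv_axiom1[OF axiom.eq_refl]) (intro definable_rules definable_tm_rules, auto)

text \<open>
  The substitution axiom is stated for a formula \<open>B\<close> with one free variable; it has to be read as
  a definable family in two variables before it can be instantiated.
\<close>

lemma prv_subst:
  assumes "\<Gamma> \<tturnstile> t =\<^bsub>s\<^esub> u" "\<Gamma> \<tturnstile> F t" "definable UNIV [s] (\<lambda>ts. F (hd ts))"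
  shows "\<Gamma> \<tturnstile> F u"
proof -
  have srt: "has_sort [] t s" "has_sort [] u s" using prv_wf[OF assms(1)] by auto
  obtain B where B: "wf [s] B" "\<And>t. closed t \<Longrightarrow> F t = opn 0 t B"
    using assms(3) by (rule definable_single) blast
  have "definable UNIV [s, s] (\<lambda>ts. opn 0 (hd (tl ts)) B)"
    using definable_tl[OF definable_opn[OF B(1)]] by simp
  then have "\<Gamma> \<tturnstile> t =\<^bsub>s\<^esub> u \<^bold>\<longrightarrow> opn 0 t B \<^bold>\<longrightarrow> opn 0 u B"
    using srt B(1) wf_opn[OF B(1) srt(1)]
    by (intro prv_axiom2[OF axiom.eq_subst[OF B(1)]] definable_Imp definable_Pr2 definable_opn
        definable_const definable_tm_rules) auto
  then show ?thesis using assms(1,2) B(2) srt has_sort_closed prv_ImpE by metis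
qed

lemma prv_sym: "\<Gamma> \<tturnstile> t =\<^bsub>s\<^esub> u \<Longrightarrow> \<Gamma> \<tturnstile> u =\<^bsub>s\<^esub> t"
proof -
  assume *: "\<Gamma> \<tturnstile> t =\<^bsub>s\<^esub> u"
  then have "has_sort [] t s" by (auto dest: prv_wf)
  then show ?thesis
    by (intro prv_subst[OF *, where F = "\<lambda>x. x =\<^bsub>s\<^esub> t"] prv_refl definable_Pr2 definable_tm_rules)
        auto
qed

lemma prv_trans: "\<Gamma> \<tturnstile> t =\<^bsub>s\<^esub> u \<Longrightarrow> \<Gamma> \<tturnstile> u =\<^bsub>s\<^esub> v \<Longrightarrow> \<Gamma> \<tturnstile> t =\<^bsub>s\<^esub> v"
proof -
  assume *: "\<Gamma> \<tturnstile> t =\<^bsub>s\<^esub> u" "\<Gamma> \<tturnstile> u =\<^bsub>s\<^esub> v"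
  then have "has_sort [] t s" by (auto dest: prv_wf)
  then show ?thesis
    by (intro prv_subst[OF *(2), where F = "\<lambda>x. t =\<^bsub>s\<^esub> x"] *(1) definable_Pr2 definable_tm_rules) auto
qed

lemma prv_cong:
  assumes "\<Gamma> \<tturnstile> t =\<^bsub>s\<^esub> u" "definable_tm UNIV [s] (\<lambda>ts. f (hd ts)) r" "has_sort [] (f t) r"
  shows "\<Gamma> \<tturnstile> f t =\<^bsub>r\<^esub> f u"
  using assms(1) by (rule prv_subst[where F = "\<lambda>x. f t =\<^bsub>r\<^esub> f x"])
    (use assms in \<open>auto intro!: prv_refl definable_Pr2 definable_tm_const\<close>)

lemma holds_subst:
  assumes "w \<Vdash> t =\<^bsub>s\<^esub> u" "w \<Vdash> F t" "definable (fst w) [s] (\<lambda>ts. F (hd ts))" "world w"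
  shows "w \<Vdash> F u"
proof -
  obtain B where B: "wf [s] B" "names B \<subseteq> fst w" "\<And>t. closed t \<Longrightarrow> F t = opn 0 t B"
    using assms(3) by (rule definable_single) blast
  have u: "has_sort [] u s" "names_tm u \<subseteq> fst w"
    using holds_sentence[OF assms(1,4)] by (auto simp: sentence_def)
  have "snd w \<tturnstile> F u"
    by (rule prv_subst[where F = F, OF prv_holds[OF assms(1,4)] prv_holds[OF assms(2,4)]])
      (use assms(3) in \<open>auto simp: definable_def\<close>)
  then show ?thesis
    using u B names_opn[of 0 u B] has_sort_closed[OF u(1)] prv_wf
    by (intro holds_prv[OF assms(4)]) (auto simp: sentence_def)
qed

lemma elems_sort: "t \<in> elems w s \<Longrightarrow> has_sort [] t s"
  by (simp add: elems_def)

lemma holds_eq_elems: "w \<Vdash> t =\<^bsub>s\<^esub> u \<Longrightarrow> world w \<Longrightarrow> t \<in> elems w s \<and> u \<in> elems w s"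
  using holds_sentence by (fastforce simp: sentence_def elems_def)

lemma holds_prv_eq: "world w \<Longrightarrow> snd w \<tturnstile> t =\<^bsub>s\<^esub> u \<Longrightarrow> t \<in> elems w s \<Longrightarrow> u \<in> elems w s \<Longrightarrow> w \<Vdash> t =\<^bsub>s\<^esub> u"
  by (auto intro!: holds_prv simp: sentence_def elems_def)

lemma holds_refl: "world w \<Longrightarrow> t \<in> elems w s \<Longrightarrow> w \<Vdash> t =\<^bsub>s\<^esub> t"
  by (auto intro!: holds_prv_eq prv_refl elems_sort)

lemma holds_sym: "w \<Vdash> t =\<^bsub>s\<^esub> u \<Longrightarrow> world w \<Longrightarrow> w \<Vdash> u =\<^bsub>s\<^esub> t"
  by (rule holds_prv_eq, assumption, rule prv_sym, erule (1) prv_holds) (auto dest: holds_eq_elems)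

lemma holds_trans: "w \<Vdash> t =\<^bsub>s\<^esub> u \<Longrightarrow> w \<Vdash> u =\<^bsub>s\<^esub> v \<Longrightarrow> world w \<Longrightarrow> w \<Vdash> t =\<^bsub>s\<^esub> v"
  by (rule holds_prv_eq, assumption, rule prv_trans, erule (1) prv_holds,
      erule (1) prv_holds) (auto dest: holds_eq_elems)

lemma holds_cong:
  assumes "w \<Vdash> t =\<^bsub>s\<^esub> u" "definable_tm (fst w) [s] (\<lambda>ts. f (hd ts)) r" "f t \<in> elems w r" "world w"
  shows "w \<Vdash> f t =\<^bsub>r\<^esub> f u"
  using assms(1) by (rule holds_subst[where F = "\<lambda>x. f t =\<^bsub>r\<^esub> f x"])
    (use assms in \<open>auto intro!: holds_refl definable_Pr2 definable_tm_const simp: elems_def\<close>)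

lemma sentence_definable: "definable (fst w) [s] (\<lambda>ts. F (hd ts)) \<Longrightarrow> w \<sqsubseteq> w' \<Longrightarrow> t \<in> elems w' s \<Longrightarrow>
    sentence w' (F t)"
proof (erule definable_single)
  fix B assume B: "wf [s] B" "names B \<subseteq> fst w" "\<And>t. closed t \<Longrightarrow>
      F t = opn 0 t B" "w \<sqsubseteq> w'" "t \<in> elems w' s"
  then show "sentence w' (F t)"
    using elems_closed[OF B(5)] names_opn[of 0 t B] wf_opn[OF B(1)]
    by (auto simp: sentence_def elems_def ext_def) blast
qed

lemma holds_Forall_ImpI:
  assumes w: "world w" and ok: "definable (fst w) [s] (\<lambda>ts. F (hd ts) \<^bold>\<longrightarrow> G (hd ts))"
    and *: "\<And>w' t. w \<sqsubseteq> w' \<Longrightarrow> t \<in> elems w' s \<Longrightarrow> w' \<Vdash> F t \<Longrightarrow> w' \<Vdash> G t"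
  shows "w \<Vdash> (\<^bold>\<forall>x:s. F x \<^bold>\<longrightarrow> G x)"
proof (rule holds_ForallI[OF w ok])
  fix w' t assume t: "w \<sqsubseteq> w'" "t \<in> elems w' s"
  show "w' \<Vdash> F t \<^bold>\<longrightarrow> G t"
    using sentence_definable[OF ok t] t by (intro holds_ImpI) (auto intro: * ext_trans ext_world
        elems_mono)
qed

text \<open>
  It suffices to compare the bodies at closed terms, as the notation only evaluates them at a
  parameter and at \<open>Fn Zero []\<close>.
\<close>

lemma Forall_cong:
  assumes "\<And>t. closed t \<Longrightarrow> F t = G t"
  shows "Forall s F = Forall s G" "Exists s F = Exists s G"
  using assms by (auto simp: Forall_def Exists_def fresh_name_def)

text \<open>
  The induction axiom for the formula that defines \<open>F\<close>.  The step has to be shown at all larger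
  worlds, since its premise is an implication below a quantifier.
\<close>

lemma holds_induct:
  assumes w: "world w" and F: "definable (fst w) [Nat] (\<lambda>ts. F (hd ts))" "definable (fst w) [Nat]
      (\<lambda>ts. F (succ (hd ts)))"
    and zero: "w \<Vdash> F 0\<^sub>N"
    and step: "\<And>w' n. w \<sqsubseteq> w' \<Longrightarrow> n \<in> elems w' Nat \<Longrightarrow> w' \<Vdash> F n \<Longrightarrow> w' \<Vdash> F (succ n)"
    and n: "n \<in> elems w Nat"
  shows "w \<Vdash> F n"
proof -
  obtain B where B: "wf [Nat] B" "names B \<subseteq> fst w" "\<And>t. closed t \<Longrightarrow> F t = opn 0 t B"
    using F(1) by (rule definable_single) blast
  have "axiom (F 0\<^sub>N \<^bold>\<and> (\<^bold>\<forall>n:Nat. F n \<^bold>\<longrightarrow> F (succ n)) \<^bold>\<longrightarrow> Forall Nat F)" (is "axiom (_ \<^bold>\<and> ?S \<^bold>\<longrightarrow> _)")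
    using axiom.induction[OF B(1)] B(3)
      Forall_cong(1)[of "\<lambda>n. F n \<^bold>\<longrightarrow> F (succ n)" "\<lambda>n. opn 0 n B \<^bold>\<longrightarrow> opn 0 (succ n) B"]
      Forall_cong(1)[of F "\<lambda>n. opn 0 n B"] by simp
  moreover have hyp: "w \<Vdash> F 0\<^sub>N \<^bold>\<and> ?S"
    using zero F step by (auto simp: holds_And w intro!: holds_Forall_ImpI w definable_Imp)
  moreover have concl: "sentence w (Forall Nat F)"
    using F(1) by (auto simp: sentence_iff intro!: definable_Forall)
  ultimately have "snd w \<tturnstile> F 0\<^sub>N \<^bold>\<and> ?S \<^bold>\<longrightarrow> Forall Nat F"
    using holds_sentence[OF hyp w] by (intro prv_axiom) (auto simp: sentence_def)
  then have "w \<Vdash> Forall Nat F"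
    using hyp concl w by (auto intro: holds_prv prv_ImpE prv_holds)
  then show ?thesis by (rule holds_ForallE) (use n w F in auto)
qed

lemma holds_choice:
  assumes w: "world w" and F: "definable (fst w) [Nat, s] (\<lambda>ts. F (hd ts) (hd (tl ts)))"
      "definable (fst w) [Nat] (\<lambda>ts. \<^bold>\<exists>y:s. F (hd ts) y)" "definable (fst w) [Seq s] (\<lambda>ts. \<^bold>\<forall>n:Nat.
          F n (hd ts \<cdot>\<^bsub>s\<^esub> n))"
    and total: "\<And>w' n. w \<sqsubseteq> w' \<Longrightarrow> n \<in> elems w' Nat \<Longrightarrow> w' \<Vdash> (\<^bold>\<exists>y:s. F n y)"
  obtains f where "f \<in> elems w (Seq s)" "w \<Vdash> (\<^bold>\<forall>n:Nat. F n (f \<cdot>\<^bsub>s\<^esub> n))"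
proof -
  obtain B where B: "wf [Nat, s] B" "names B \<subseteq> fst w"
      "\<And>ts. env [Nat, s] ts \<Longrightarrow> F (hd ts) (hd (tl ts)) = sub 0 ts B"
    using F(1) by (auto simp: definable_def)
  have eq: "F n y = opn 0 n (opn (Suc 0) y B)" if "closed n" "closed y" for n y
    using B(3)[of "[n, y]"] that opn_sub[OF B(1), of 0 "[y]" n] opn_eq_sub[OF B(1), of "Suc 0" y]
        by simp
  have 1: "Forall Nat (\<lambda>n. Exists s (\<lambda>y. opn 0 n (opn (Suc 0) y B))) = Forall Nat (\<lambda>n. Exists s (F
      n))"
    by (intro Forall_cong) (simp add: eq)
  have 2: "Exists (Seq s) (\<lambda>f. Forall Nat (\<lambda>n. opn 0 n (opn (Suc 0) (f \<cdot>\<^bsub>s\<^esub> n) B)))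
      = Exists (Seq s) (\<lambda>f. Forall Nat (\<lambda>n. F n (f \<cdot>\<^bsub>s\<^esub> n)))"
    by (intro Forall_cong) (simp add: eq)
  have ax: "axiom ((\<^bold>\<forall>n:Nat. \<^bold>\<exists>y:s. F n y) \<^bold>\<longrightarrow> (\<^bold>\<exists>f:Seq s. \<^bold>\<forall>n:Nat. F n (f \<cdot>\<^bsub>s\<^esub> n)))" (is "axiom (?P \<^bold>\<longrightarrow> ?C)")
    using axiom.countable_choice[OF B(1)] 1 2 by simp
  have hyp: "w \<Vdash> ?P" using total F(2) by (intro holds_ForallI w) auto
  have concl: "sentence w ?C" using F(3) by (auto simp: sentence_iff intro!: definable_Exists)
  have "snd w \<tturnstile> ?P \<^bold>\<longrightarrow> ?C"
    using holds_sentence[OF hyp w] concl by (intro prv_axiom ax) (auto simp: sentence_def)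
  then have "w \<Vdash> ?C"
    using hyp concl w by (auto intro: holds_prv prv_ImpE prv_holds)
  then show ?thesis by (rule holds_ExistsE) (use w F that in auto)
qed

section \<open>The ring of rational terms\<close>

definition rat_eq :: "tm \<Rightarrow> tm \<Rightarrow> bool" where
  "rat_eq t u \<longleftrightarrow> ({} \<tturnstile> t =\<^sub>Q u)"

lemma rat_eq_sorts: "rat_eq t u \<Longrightarrow> has_sort [] t Rat \<and> has_sort [] u Rat"
  unfolding rat_eq_def by (auto dest: prv_wf)

lemma rat_eq_refl [simp]: "rat_eq t t \<longleftrightarrow> has_sort [] t Rat"
  using rat_eq_sorts prv_refl by (auto simp: rat_eq_def)

text \<open>
  Closed terms of sort \<open>Rat\<close> modulo equality that is provable outright.  In this ring identities
  are proved by simplification.  Order and equality at a world are then expressed by predicates on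
  the ring, which depend on the world.
\<close>

quotient_type rat_class = tm / partial: rat_eq
proof (rule part_equivpI)
  show "\<exists>t. rat_eq t t" by (rule exI[of _ "0\<^sub>Q"]) simp
  show "symp rat_eq" by (auto simp: symp_def rat_eq_def intro: prv_sym)
  show "transp rat_eq" by (auto simp: transp_def rat_eq_def intro: prv_trans)
qed

lemma rat_eq_Fn1:
  assumes "rat_eq t u" "fsym_args f = [Rat]" "fsym_result f = Rat"
  shows "rat_eq (Fn f [t]) (Fn f [u])"
  using assms rat_eq_sorts[OF assms(1)] unfolding rat_eq_def
  by (intro prv_cong[where f = "\<lambda>t. Fn f [t]"]) (auto intro!: definable_tm_rules)

lemma rat_eq_Fn2:
  assumes "rat_eq t t'" "rat_eq u u'" "fsym_args f = [Rat, Rat]" "fsym_result f = Rat"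
  shows "rat_eq (Fn f [t, u]) (Fn f [t', u'])"
  unfolding rat_eq_def
proof (rule prv_trans)
  show "{} \<tturnstile> Fn f [t, u] =\<^sub>Q Fn f [t', u]"
    using assms rat_eq_sorts[OF assms(1)] rat_eq_sorts[OF assms(2)] unfolding rat_eq_def
    by (intro prv_cong[where f = "\<lambda>t. Fn f [t, u]"]) (auto intro!: definable_tm_Fn2
        definable_tm_hd definable_tm_const)
  show "{} \<tturnstile> Fn f [t', u] =\<^sub>Q Fn f [t', u']"
    using assms rat_eq_sorts[OF assms(1)] rat_eq_sorts[OF assms(2)] unfolding rat_eq_def
    by (intro prv_cong[where f = "\<lambda>u. Fn f [t', u]"]) (auto intro!: definable_tm_Fn2
        definable_tm_hd definable_tm_const)
qed

instantiation rat_class :: "{zero, one, plus, minus, uminus, times}"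
begin

lift_definition zero_rat_class :: rat_class is "0\<^sub>Q" by simp
lift_definition one_rat_class :: rat_class is "1\<^sub>Q" by simp
lift_definition plus_rat_class :: "rat_class \<Rightarrow> rat_class \<Rightarrow> rat_class" is "\<lambda>p q. p +\<^sub>Q q"
    by (simp add: rat_eq_Fn2)
lift_definition uminus_rat_class :: "rat_class \<Rightarrow> rat_class" is "\<lambda>p. -\<^sub>Q p" by (simp add: rat_eq_Fn1)
lift_definition minus_rat_class :: "rat_class \<Rightarrow> rat_class \<Rightarrow> rat_class" is "\<lambda>p q. p +\<^sub>Q -\<^sub>Q q"
    by (simp add: rat_eq_Fn1 rat_eq_Fn2)
lift_definition times_rat_class :: "rat_class \<Rightarrow> rat_class \<Rightarrow> rat_class" is "\<lambda>p q. p *\<^sub>Q q"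
    by (simp add: rat_eq_Fn2)

instance ..
end

lemma rat_eqs:
  assumes [simp]: "has_sort [] p Rat" "has_sort [] q Rat" "has_sort [] r Rat"
  shows rat_add_assoc: "rat_eq ((p +\<^sub>Q q) +\<^sub>Q r) (p +\<^sub>Q (q +\<^sub>Q r))"
    and rat_add_comm: "rat_eq (p +\<^sub>Q q) (q +\<^sub>Q p)"
    and rat_add_zero: "rat_eq (p +\<^sub>Q 0\<^sub>Q) p"
    and rat_add_neg: "rat_eq (p +\<^sub>Q -\<^sub>Q p) 0\<^sub>Q"
    and rat_mul_assoc: "rat_eq ((p *\<^sub>Q q) *\<^sub>Q r) (p *\<^sub>Q (q *\<^sub>Q r))"
    and rat_mul_comm: "rat_eq (p *\<^sub>Q q) (q *\<^sub>Q p)"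
    and rat_mul_one: "rat_eq (p *\<^sub>Q 1\<^sub>Q) p"
    and rat_mul_add: "rat_eq (p *\<^sub>Q (q +\<^sub>Q r)) (p *\<^sub>Q q +\<^sub>Q p *\<^sub>Q r)"
  unfolding rat_eq_def
  by (rule prv_axiom3[OF axiom.qadd_assoc] prv_axiom2[OF axiom.qadd_comm] prv_axiom1[OF
      axiom.qadd_zero]
      prv_axiom1[OF axiom.qadd_neg] prv_axiom3[OF axiom.qmul_assoc] prv_axiom2[OF axiom.qmul_comm]
      prv_axiom1[OF axiom.qmul_one] prv_axiom3[OF axiom.qmul_add]; (intro definable_rules
          definable_tm_rules)?; auto)+

instance rat_class :: comm_ring
proof
  have comm: "a + b = b + a" and mult_comm: "a * b = b * a" for a b :: rat_class
    by (transfer, simp add: rat_add_comm rat_mul_comm)+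
  have right: "a + 0 = a" "a + - a = 0" "a * (b + c) = a * b + a * c" for a b c :: rat_class
    by (transfer, simp add: rat_add_zero rat_add_neg rat_mul_add)+
  fix a b c :: rat_class
  show "a + b + c = a + (b + c)" by transfer (simp add: rat_add_assoc)
  show "a + b = b + a" by (rule comm)
  show "0 + a = a" "- a + a = 0" using right comm by metis+
  show "a - b = a + - b" by transfer (simp add: rat_eq_Fn1 rat_eq_Fn2)
  show "a * b * c = a * (b * c)" by transfer (simp add: rat_mul_assoc)
  show "a * b = b * a" by (rule mult_comm)
  show "(a + b) * c = a * c + b * c" using right mult_comm by metis
qed

text \<open>
  The ring is only shown to be an instance of \<open>comm_ring\<close>: a ring class with unit demands \<open>0 \<noteq> 1\<close>,
  which would amount to the consistency of the formal theory.  Hence there are no numerals either,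
  and multiples are written as repeated sums below.
\<close>

lemma rat_class_mult_1 [simp]: "x * 1 = x" "1 * x = x" for x :: rat_class
proof -
  show "x * 1 = x" by transfer (simp add: rat_mul_one)
  then show "1 * x = x" by (simp add: mult.commute)
qed

definition rat_of :: "tm \<Rightarrow> rat_class" where
  "rat_of t = abs_rat_class t"

lemma rat_of_eq_iff:
  assumes "has_sort [] t Rat" "has_sort [] u Rat"
  shows "rat_of t = rat_of u \<longleftrightarrow> rat_eq t u"
  using Quotient3_rel[OF Quotient3_rat_class, of t u] assms by (simp add: rat_of_def)

lemma rat_of_simps [simp]:
  assumes "has_sort [] p Rat" "has_sort [] q Rat"
  shows "rat_of (p +\<^sub>Q q) = rat_of p + rat_of q" "rat_of (p *\<^sub>Q q) = rat_of p * rat_of q"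
  using assms by (simp_all add: rat_of_def plus_rat_class.abs_eq times_rat_class.abs_eq)

lemma rat_of_neg [simp]: "has_sort [] p Rat \<Longrightarrow> rat_of (-\<^sub>Q p) = - rat_of p"
  by (simp add: rat_of_def uminus_rat_class.abs_eq)

lemma rat_of_consts [simp]: "rat_of 0\<^sub>Q = 0" "rat_of 1\<^sub>Q = 1"
  by (simp_all add: rat_of_def zero_rat_class_def one_rat_class_def)

lemma rat_of_prv: "{} \<tturnstile> t =\<^sub>Q u \<Longrightarrow> rat_of t = rat_of u"
  using rat_eq_sorts[of t u] by (auto simp: rat_of_eq_iff rat_eq_def)

lemma rat_of_rconst [simp]:
  assumes "has_sort [] q Rat" "has_sort [] n Nat"
  shows "rat_of (rconst q \<cdot>\<^sub>Q n) = rat_of q"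
  by (rule rat_of_prv, rule prv_axiom2[OF axiom.rconst]; (intro definable_rules
      definable_tm_rules)?; use assms in auto)

lemma rat_of_radd [simp]:
  assumes "has_sort [] x (Seq Rat)" "has_sort [] y (Seq Rat)" "has_sort [] n Nat"
  shows "rat_of ((x +\<^sub>R y) \<cdot>\<^sub>Q n) = rat_of (x \<cdot>\<^sub>Q (n +\<^sub>N n)) + rat_of (y \<cdot>\<^sub>Q (n +\<^sub>N n))"
proof -
  have "rat_of ((x +\<^sub>R y) \<cdot>\<^sub>Q n) = rat_of (x \<cdot>\<^sub>Q (n +\<^sub>N n) +\<^sub>Q y \<cdot>\<^sub>Q (n +\<^sub>N n))"
    by (rule rat_of_prv, rule prv_axiom3[OF axiom.radd]; (intro definable_rules
        definable_tm_rules)?; use assms in auto)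
  then show ?thesis using assms by simp
qed

lemma rat_of_rneg [simp]:
  assumes "has_sort [] x (Seq Rat)" "has_sort [] n Nat"
  shows "rat_of ((-\<^sub>R x) \<cdot>\<^sub>Q n) = - rat_of (x \<cdot>\<^sub>Q n)"
proof -
  have "rat_of ((-\<^sub>R x) \<cdot>\<^sub>Q n) = rat_of (-\<^sub>Q (x \<cdot>\<^sub>Q n))"
    by (rule rat_of_prv, rule prv_axiom2[OF axiom.rneg]; (intro definable_rules
        definable_tm_rules)?; use assms in auto)
  then show ?thesis using assms by simp
qed

lemma rat_of_of_N_succ [simp]:
  assumes "has_sort [] n Nat"
  shows "rat_of (of_N (succ n)) = rat_of (of_N n) + 1"
proof -
  have "rat_of (of_N (succ n)) = rat_of (of_N n +\<^sub>Q 1\<^sub>Q)"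
    by (rule rat_of_prv, rule prv_axiom1[OF axiom.of_N_succ]; (intro definable_rules
        definable_tm_rules)?; use assms in auto)
  then show ?thesis using assms by simp
qed

lemma rat_of_qpow_0 [simp]: "has_sort [] p Rat \<Longrightarrow> rat_of (p ^\<^sub>Q 0\<^sub>N) = 1"
  unfolding rat_of_consts(2)[symmetric]
  by (rule rat_of_prv, rule prv_axiom1[OF axiom.qpow_zero]; (intro definable_rules
      definable_tm_rules)?; simp)

lemma rat_of_qpow_succ [simp]:
  assumes "has_sort [] p Rat" "has_sort [] n Nat"
  shows "rat_of (p ^\<^sub>Q succ n) = rat_of (p ^\<^sub>Q n) * rat_of p"
proof -
  have "rat_of (p ^\<^sub>Q succ n) = rat_of (p ^\<^sub>Q n *\<^sub>Q p)"
    by (rule rat_of_prv, rule prv_axiom2[OF axiom.qpow_succ]; (intro definable_rules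
        definable_tm_rules)?; use assms in auto)
  then show "rat_of (p ^\<^sub>Q succ n) = rat_of (p ^\<^sub>Q n) * rat_of p" using assms by simp
qed

section \<open>Signs of rational terms at a world\<close>

definition positive :: "pre_world \<Rightarrow> rat_class \<Rightarrow> bool" where
  "positive w x \<longleftrightarrow> (\<exists>t\<in>elems w Rat. x = rat_of t \<and> (w \<Vdash> 0\<^sub>Q <\<^sub>Q t))"

definition is_zero :: "pre_world \<Rightarrow> rat_class \<Rightarrow> bool" where
  "is_zero w x \<longleftrightarrow> (\<exists>t\<in>elems w Rat. x = rat_of t \<and> (w \<Vdash> t =\<^sub>Q 0\<^sub>Q))"

definition nonneg :: "pre_world \<Rightarrow> rat_class \<Rightarrow> bool" where
  "nonneg w x \<longleftrightarrow> positive w x \<or> is_zero w x"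

definition represented :: "pre_world \<Rightarrow> rat_class \<Rightarrow> bool" where
  "represented w x \<longleftrightarrow> (\<exists>t\<in>elems w Rat. x = rat_of t)"

lemma elems_Fn [simp]:
  "Fn f [] \<in> elems w s \<longleftrightarrow> fsym_args f = [] \<and> s = fsym_result f"
  "fsym_args f = [r] \<Longrightarrow> Fn f [t] \<in> elems w s \<longleftrightarrow> s = fsym_result f \<and> t \<in> elems w r"
  "fsym_args f = [r, r'] \<Longrightarrow> Fn f [t, t'] \<in> elems w s \<longleftrightarrow>
      s = fsym_result f \<and> t \<in> elems w r \<and> t' \<in> elems w r'"
  by (auto simp: elems_def)

context
  fixes w :: pre_world
  assumes w [simp]: "world w"
begin

lemma rat_of_eqD: "rat_of t = rat_of u \<Longrightarrow> t \<in> elems w Rat \<Longrightarrow> u \<in> elems w Rat \<Longrightarrow> w \<Vdash> t =\<^sub>Q u"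
  using rat_of_eq_iff[of t u] elems_sort by (intro holds_prv_eq) (auto simp: rat_eq_def intro:
      prv_mono)

lemma pos_rat_of: "t \<in> elems w Rat \<Longrightarrow> positive w (rat_of t) \<longleftrightarrow> (w \<Vdash> 0\<^sub>Q <\<^sub>Q t)"
  unfolding positive_def
proof safe
  fix u assume "t \<in> elems w Rat" "u \<in> elems w Rat" "rat_of t = rat_of u" "w \<Vdash> 0\<^sub>Q <\<^sub>Q u"
  then show "w \<Vdash> 0\<^sub>Q <\<^sub>Q t"
    by (intro holds_subst[OF rat_of_eqD[of u t], where F = "\<lambda>x. 0\<^sub>Q <\<^sub>Q x"] definable_rules
        definable_tm_rules) auto
qed auto

lemma is_zero_rat_of: "t \<in> elems w Rat \<Longrightarrow> is_zero w (rat_of t) \<longleftrightarrow> (w \<Vdash> t =\<^sub>Q 0\<^sub>Q)"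
  unfolding is_zero_def by (auto intro: holds_trans[OF rat_of_eqD])

lemma less_subst:
  "w \<Vdash> p <\<^sub>Q q \<Longrightarrow> rat_of p = rat_of p' \<Longrightarrow> rat_of q = rat_of q' \<Longrightarrow> p \<in> elems w Rat \<Longrightarrow> q \<in> elems w Rat \<Longrightarrow>
    p' \<in> elems w Rat \<Longrightarrow> q' \<in> elems w Rat \<Longrightarrow> w \<Vdash> p' <\<^sub>Q q'"
proof -
  assume *: "w \<Vdash> p <\<^sub>Q q" "rat_of p = rat_of p'" "rat_of q = rat_of q'"
      and el [simp]: "p \<in> elems w Rat" "q \<in> elems w Rat"
    "p' \<in> elems w Rat" "q' \<in> elems w Rat"
  note [simp] = el[THEN elems_sort]
  have n: "names_tm q \<subseteq> fst w" "names_tm p' \<subseteq> fst w" using \<open>q \<in> _\<close> \<open>p' \<in> _\<close>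
      by (auto simp: elems_def)
  have "w \<Vdash> p' <\<^sub>Q q"
    by (rule holds_subst[OF rat_of_eqD[OF *(2)], where F = "\<lambda>x. x <\<^sub>Q q"], simp, simp, rule *,
        intro definable_rules definable_tm_rules)
      (use n in auto)
  then show ?thesis
    by (rule holds_subst[OF rat_of_eqD[OF *(3)], where F = "\<lambda>x. p' <\<^sub>Q x", rotated 2],
        intro definable_rules definable_tm_rules)
      (use n in auto)
qed

lemma less_add:
  assumes [simp]: "p \<in> elems w Rat" "q \<in> elems w Rat" "r \<in> elems w Rat" and "w \<Vdash> p <\<^sub>Q q"
  shows "w \<Vdash> p +\<^sub>Q r <\<^sub>Q q +\<^sub>Q r"
proof -
  note [simp] = assms(1-3)[THEN elems_sort]
  have "snd w \<tturnstile> p <\<^sub>Q q \<^bold>\<longrightarrow> p +\<^sub>Q r <\<^sub>Q q +\<^sub>Q r"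
    by (rule prv_axiom3[OF axiom.qless_add]; (intro definable_rules definable_tm_rules)?; auto)
  then have "snd w \<tturnstile> p +\<^sub>Q r <\<^sub>Q q +\<^sub>Q r" using prv_ImpE prv_holds[OF assms(4) w] by blast
  then show ?thesis using assms(1-3) by (intro holds_prv w) (auto simp: sentence_def elems_def)
qed

lemma less_trans:
  assumes [simp]: "p \<in> elems w Rat" "q \<in> elems w Rat" "r \<in> elems w Rat"
      and "w \<Vdash> p <\<^sub>Q q" "w \<Vdash> q <\<^sub>Q r"
  shows "w \<Vdash> p <\<^sub>Q r"
proof -
  note [simp] = assms(1-3)[THEN elems_sort]
  have "snd w \<tturnstile> p <\<^sub>Q q \<^bold>\<longrightarrow> q <\<^sub>Q r \<^bold>\<longrightarrow> p <\<^sub>Q r"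
    by (rule prv_axiom3[OF axiom.qless_trans]; (intro definable_rules definable_tm_rules)?; auto)
  then have "snd w \<tturnstile> p <\<^sub>Q r" using prv_ImpE prv_holds[OF assms(4) w] prv_holds[OF assms(5) w]
      by blast
  then show ?thesis using assms(1-3) by (intro holds_prv w) (auto simp: sentence_def elems_def)
qed

lemma less_irrefl:
  assumes [simp]: "p \<in> elems w Rat" and "w \<Vdash> p <\<^sub>Q p"
  shows False
proof -
  note [simp] = assms(1)[THEN elems_sort]
  have "snd w \<tturnstile> \<^bold>\<not> p <\<^sub>Q p"
    by (rule prv_axiom1[OF axiom.qless_irrefl]; (intro definable_rules definable_tm_rules)?; auto)
  then have "snd w \<tturnstile> \<^bold>\<bottom>" using prv_ImpE prv_holds[OF assms(2) w] by blast
  then have "w \<Vdash> \<^bold>\<bottom>" by (intro holds_prv w) (auto simp: sentence_def)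
  then show ?thesis by (rule holds_FalsumE) simp
qed

lemma less_linear:
  assumes [simp]: "p \<in> elems w Rat" "q \<in> elems w Rat"
  shows "(w \<Vdash> p <\<^sub>Q q) \<or> (w \<Vdash> p =\<^sub>Q q) \<or> (w \<Vdash> q <\<^sub>Q p)"
proof -
  note [simp] = assms(1-2)[THEN elems_sort]
  have "snd w \<tturnstile> p <\<^sub>Q q \<^bold>\<or> p =\<^sub>Q q \<^bold>\<or> q <\<^sub>Q p"
    by (rule prv_axiom2[OF axiom.qless_linear]; (intro definable_rules definable_tm_rules)?; auto)
  then have "w \<Vdash> p <\<^sub>Q q \<^bold>\<or> p =\<^sub>Q q \<^bold>\<or> q <\<^sub>Q p"
    using assms by (intro holds_prv w) (auto simp: sentence_def elems_def)
  then show ?thesis using holds_OrE w by blast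
qed

text \<open>
  Order and equality of terms at a world are the signs of differences in the ring.
\<close>

lemma less_iff:
  assumes [simp]: "p \<in> elems w Rat" "q \<in> elems w Rat"
  shows "(w \<Vdash> p <\<^sub>Q q) \<longleftrightarrow> positive w (rat_of q - rat_of p)"
proof
  note [simp] = assms(1-2)[THEN elems_sort]
  assume "w \<Vdash> p <\<^sub>Q q"
  then have "w \<Vdash> p +\<^sub>Q -\<^sub>Q p <\<^sub>Q q +\<^sub>Q -\<^sub>Q p" by (intro less_add) auto
  then have "w \<Vdash> 0\<^sub>Q <\<^sub>Q q +\<^sub>Q -\<^sub>Q p" by (rule less_subst) auto
  then have "positive w (rat_of (q +\<^sub>Q -\<^sub>Q p))" by (subst pos_rat_of) auto
  then show "positive w (rat_of q - rat_of p)" by simp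
next
  note [simp] = assms(1-2)[THEN elems_sort]
  assume "positive w (rat_of q - rat_of p)"
  then have "positive w (rat_of (q +\<^sub>Q -\<^sub>Q p))" by simp
  then have "w \<Vdash> 0\<^sub>Q <\<^sub>Q q +\<^sub>Q -\<^sub>Q p" by (subst (asm) pos_rat_of) auto
  then have "w \<Vdash> 0\<^sub>Q +\<^sub>Q p <\<^sub>Q (q +\<^sub>Q -\<^sub>Q p) +\<^sub>Q p" by (intro less_add) auto
  then show "w \<Vdash> p <\<^sub>Q q" by (rule less_subst) auto
qed

lemma eq_add:
  assumes "w \<Vdash> p =\<^sub>Q q" "r \<in> elems w Rat"
  shows "w \<Vdash> p +\<^sub>Q r =\<^sub>Q q +\<^sub>Q r"
  using assms holds_eq_elems[OF assms(1) w]
  by (intro holds_cong[where f = "\<lambda>x. x +\<^sub>Q r"] definable_tm_rules) (auto simp: elems_def)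

lemma eq_iff:
  assumes [simp]: "p \<in> elems w Rat" "q \<in> elems w Rat"
  shows "(w \<Vdash> p =\<^sub>Q q) \<longleftrightarrow> is_zero w (rat_of p - rat_of q)"
proof
  note [simp] = assms(1-2)[THEN elems_sort]
  assume "w \<Vdash> p =\<^sub>Q q"
  then have "w \<Vdash> p +\<^sub>Q -\<^sub>Q q =\<^sub>Q q +\<^sub>Q -\<^sub>Q q" by (rule eq_add) simp
  then have "w \<Vdash> p +\<^sub>Q -\<^sub>Q q =\<^sub>Q 0\<^sub>Q" by (rule holds_trans) (auto intro!: rat_of_eqD)
  then have "is_zero w (rat_of (p +\<^sub>Q -\<^sub>Q q))" by (subst is_zero_rat_of) auto
  then show "is_zero w (rat_of p - rat_of q)" by simp
next
  note [simp] = assms(1-2)[THEN elems_sort]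
  assume "is_zero w (rat_of p - rat_of q)"
  then have "is_zero w (rat_of (p +\<^sub>Q -\<^sub>Q q))" by simp
  then have "w \<Vdash> p +\<^sub>Q -\<^sub>Q q =\<^sub>Q 0\<^sub>Q" by (subst (asm) is_zero_rat_of) auto
  then have "w \<Vdash> (p +\<^sub>Q -\<^sub>Q q) +\<^sub>Q q =\<^sub>Q 0\<^sub>Q +\<^sub>Q q" by (rule eq_add) simp
  moreover have "w \<Vdash> p =\<^sub>Q (p +\<^sub>Q -\<^sub>Q q) +\<^sub>Q q" by (rule rat_of_eqD) auto
  moreover have "w \<Vdash> 0\<^sub>Q +\<^sub>Q q =\<^sub>Q q" by (rule rat_of_eqD) auto
  ultimately show "w \<Vdash> p =\<^sub>Q q" using holds_trans w by meson
qed

lemma le_iff: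
  assumes [simp]: "p \<in> elems w Rat" "q \<in> elems w Rat"
  shows "(w \<Vdash> p \<le>\<^sub>Q q) \<longleftrightarrow> nonneg w (rat_of q - rat_of p)"
proof -
  note [simp] = assms(1-2)[THEN elems_sort]
  have "sentence w (p <\<^sub>Q q)" "sentence w (p =\<^sub>Q q)" using assms
      by (auto simp: sentence_def elems_def)
  then have "(w \<Vdash> p \<le>\<^sub>Q q) \<longleftrightarrow> (w \<Vdash> p <\<^sub>Q q) \<or> (w \<Vdash> q =\<^sub>Q p)"
    unfolding qle_def using holds_OrE holds_OrI1 holds_OrI2 w holds_sym by metis
  then show ?thesis by (simp add: less_iff eq_iff nonneg_def)
qed

end

context
  fixes w :: pre_world
  assumes w [simp]: "world w"
begin

lemma represented_rat_of: "t \<in> elems w Rat \<Longrightarrow> represented w (rat_of t)"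
  by (auto simp: represented_def)

lemma pos_represented: "positive w x \<Longrightarrow> represented w x"
  by (auto simp: positive_def represented_def)

lemma is_zero_0: "is_zero w 0"
  unfolding rat_of_consts(1)[symmetric] by (subst is_zero_rat_of) (auto intro!: holds_refl)

lemma is_zero_add: "is_zero w x \<Longrightarrow> is_zero w y \<Longrightarrow> is_zero w (x + y)"
proof -
  assume "is_zero w x" "is_zero w y"
  then obtain t u where *: "t \<in> elems w Rat" "u \<in> elems w Rat" "x = rat_of t" "y = rat_of u"
      "w \<Vdash> t =\<^sub>Q 0\<^sub>Q" "w \<Vdash> u =\<^sub>Q 0\<^sub>Q"
    by (auto simp: is_zero_def)
  note [simp] = *(1,2) *(1,2)[THEN elems_sort]
  have "w \<Vdash> t +\<^sub>Q u =\<^sub>Q 0\<^sub>Q +\<^sub>Q u" by (rule eq_add) (simp_all add: *)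
  moreover have "w \<Vdash> 0\<^sub>Q +\<^sub>Q u =\<^sub>Q u" by (rule rat_of_eqD) auto
  ultimately have "w \<Vdash> t +\<^sub>Q u =\<^sub>Q 0\<^sub>Q" using *(6) holds_trans w by meson
  then have "is_zero w (rat_of (t +\<^sub>Q u))" by (subst is_zero_rat_of) auto
  then show ?thesis by (simp add: *)
qed

lemma is_zero_minus: "is_zero w x \<Longrightarrow> is_zero w (- x)"
proof -
  assume "is_zero w x"
  then obtain t where *: "t \<in> elems w Rat" "x = rat_of t" "w \<Vdash> t =\<^sub>Q 0\<^sub>Q" by (auto simp: is_zero_def)
  then have "w \<Vdash> 0\<^sub>Q =\<^sub>Q t" by (auto intro: holds_sym)
  then show ?thesis using * by (simp add: eq_iff)
qed

lemma is_zero_mult: "is_zero w x \<Longrightarrow> represented w y \<Longrightarrow> is_zero w (x * y)"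
proof -
  assume "is_zero w x" "represented w y"
  then obtain t u where *: "t \<in> elems w Rat" "u \<in> elems w Rat" "x = rat_of t" "y = rat_of u" "w \<Vdash>
      t =\<^sub>Q 0\<^sub>Q"
    by (auto simp: is_zero_def represented_def)
  note [simp] = *(1,2) *(1,2)[THEN elems_sort]
  have "w \<Vdash> t *\<^sub>Q u =\<^sub>Q 0\<^sub>Q *\<^sub>Q u"
    by (rule holds_cong[OF *(5), where f = "\<lambda>x. x *\<^sub>Q u"]; (intro definable_tm_elems
        definable_tm_rules)?; simp)
  moreover have "w \<Vdash> 0\<^sub>Q *\<^sub>Q u =\<^sub>Q 0\<^sub>Q" by (rule rat_of_eqD) auto
  ultimately have "w \<Vdash> t *\<^sub>Q u =\<^sub>Q 0\<^sub>Q" using holds_trans w by meson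
  then have "is_zero w (rat_of (t *\<^sub>Q u))" by (subst is_zero_rat_of) auto
  then show ?thesis by (simp add: *)
qed

lemma pos_is_zero_add: "positive w x \<Longrightarrow> is_zero w y \<Longrightarrow> positive w (x + y)"
proof -
  assume xy: "positive w x" "is_zero w y"
  then obtain t u where *: "t \<in> elems w Rat" "u \<in> elems w Rat" "x = rat_of t" "y = rat_of u" "w \<Vdash>
      0\<^sub>Q <\<^sub>Q t"
    by (auto simp: is_zero_def positive_def)
  note [simp] = *(1,2) *(1,2)[THEN elems_sort]
  have "w \<Vdash> t =\<^sub>Q t +\<^sub>Q u" using is_zero_minus[OF xy(2)] * by (subst eq_iff) auto
  then have "w \<Vdash> 0\<^sub>Q <\<^sub>Q t +\<^sub>Q u"
    by (rule holds_subst[where F = "\<lambda>x. 0\<^sub>Q <\<^sub>Q x"]; (intro definable_tm_elems definable_tm_rules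
        definable_rules)?; simp add: *)
  then have "positive w (rat_of (t +\<^sub>Q u))" by (subst pos_rat_of) auto
  then show ?thesis by (simp add: *)
qed

lemma pos_add: "positive w x \<Longrightarrow> positive w y \<Longrightarrow> positive w (x + y)"
proof -
  assume xy: "positive w x" "positive w y"
  then obtain t u where *: "t \<in> elems w Rat" "u \<in> elems w Rat" "x = rat_of t" "y = rat_of u" "w \<Vdash>
      0\<^sub>Q <\<^sub>Q t"
    by (auto simp: positive_def)
  note [simp] = *(1,2) *(1,2)[THEN elems_sort]
  have "positive w (rat_of (t +\<^sub>Q u) - rat_of t)" using xy(2) by (simp add: *)
  then have "w \<Vdash> t <\<^sub>Q t +\<^sub>Q u" by (simp add: less_iff del: rat_of_simps)
  then have "w \<Vdash> 0\<^sub>Q <\<^sub>Q t +\<^sub>Q u" using *(5) by (rule_tac less_trans[OF w, of "0\<^sub>Q" t "t +\<^sub>Q u"]) auto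
  then have "positive w (rat_of (t +\<^sub>Q u))" by (subst pos_rat_of) auto
  then show ?thesis by (simp add: *)
qed

lemma pos_nonneg_add: "positive w x \<Longrightarrow> nonneg w y \<Longrightarrow> positive w (x + y)"
  by (auto simp: nonneg_def intro: pos_add pos_is_zero_add)

lemma nonneg_add: "nonneg w x \<Longrightarrow> nonneg w y \<Longrightarrow> nonneg w (x + y)"
  using pos_add pos_is_zero_add is_zero_add add.commute unfolding nonneg_def by metis

lemma not_pos_0: "\<not> positive w 0"
  using less_irrefl[of w "0\<^sub>Q"] less_iff[of w "0\<^sub>Q" "0\<^sub>Q"] by auto

text \<open>
  The order of the rationals is decidable at a world because disjunctions hold classically there.
\<close>

lemma pos_trichotomy: "represented w x \<Longrightarrow> positive w x \<or> nonneg w (- x)"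
proof -
  assume "represented w x"
  then obtain t where *: "t \<in> elems w Rat" "x = rat_of t" by (auto simp: represented_def)
  then show ?thesis
    using less_linear[of w "0\<^sub>Q" t] less_iff[of w "0\<^sub>Q" t] less_iff[of w t "0\<^sub>Q"] eq_iff[of w "0\<^sub>Q" t]
    by (auto simp: nonneg_def)
qed

lemma pos_mult: "positive w x \<Longrightarrow> positive w y \<Longrightarrow> positive w (x * y)"
proof -
  assume xy: "positive w x" "positive w y"
  then obtain t u where *: "t \<in> elems w Rat" "u \<in> elems w Rat" "x = rat_of t" "y = rat_of u" "w \<Vdash>
      0\<^sub>Q <\<^sub>Q t" "w \<Vdash> 0\<^sub>Q <\<^sub>Q u"
    by (auto simp: positive_def)
  note [simp] = *(1,2) *(1,2)[THEN elems_sort]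
  have "snd w \<tturnstile> 0\<^sub>Q <\<^sub>Q t \<^bold>\<longrightarrow> 0\<^sub>Q <\<^sub>Q u \<^bold>\<longrightarrow> 0\<^sub>Q <\<^sub>Q t *\<^sub>Q u"
    by (rule prv_axiom2[OF axiom.qless_mul]; (intro definable_rules definable_tm_rules)?; simp)
  then have "snd w \<tturnstile> 0\<^sub>Q <\<^sub>Q t *\<^sub>Q u" using prv_ImpE prv_holds[OF *(5) w] prv_holds[OF *(6) w] by blast
  then have "w \<Vdash> 0\<^sub>Q <\<^sub>Q t *\<^sub>Q u" using *(1,2) by (intro holds_prv w) (auto simp: sentence_def
      elems_def)
  then have "positive w (rat_of (t *\<^sub>Q u))" by (subst pos_rat_of) auto
  then show ?thesis by (simp add: *)
qed

lemma pos_1: "positive w 1"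
proof -
  have "snd w \<tturnstile> 0\<^sub>Q <\<^sub>Q 1\<^sub>Q" by (rule prv_axiom[OF axiom.qless_zero_one]) simp
  then have "w \<Vdash> 0\<^sub>Q <\<^sub>Q 1\<^sub>Q" by (intro holds_prv w) (auto simp: sentence_def)
  then show ?thesis using pos_rat_of[of w "1\<^sub>Q"] by simp
qed

lemma nonneg_mult: "positive w x \<Longrightarrow> nonneg w y \<Longrightarrow> nonneg w (x * y)"
  using is_zero_mult pos_represented by (auto simp: nonneg_def mult.commute[of x] intro: pos_mult)

lemma is_zero_nonneg: "is_zero w x \<Longrightarrow> nonneg w x" "is_zero w x \<Longrightarrow> nonneg w (- x)"
  by (auto simp: nonneg_def is_zero_minus)

lemma pos_nonneg: "positive w x \<Longrightarrow> nonneg w x"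
  by (simp add: nonneg_def)

section \<open>Natural numbers at a world\<close>

lemma holds_cong1:
  assumes "w \<Vdash> t =\<^bsub>s\<^esub> u" "fsym_args f = [s]" "r = fsym_result f"
  shows "w \<Vdash> Fn f [t] =\<^bsub>r\<^esub> Fn f [u]"
  using holds_eq_elems[OF assms(1) w] assms(2,3)
  by (intro holds_cong[OF assms(1), where f = "\<lambda>x. Fn f [x]"] definable_tm_elems
      definable_tm_rules) auto

lemma holds_cong2:
  assumes "w \<Vdash> t =\<^bsub>s\<^esub> u" "w \<Vdash> t' =\<^bsub>s'\<^esub> u'" "fsym_args f = [s, s']" "r = fsym_result f"
  shows "w \<Vdash> Fn f [t, t'] =\<^bsub>r\<^esub> Fn f [u, u']"
proof (rule holds_trans[OF _ _ w])
  note el = holds_eq_elems[OF assms(1) w] holds_eq_elems[OF assms(2) w]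
  show "w \<Vdash> Fn f [t, t'] =\<^bsub>r\<^esub> Fn f [u, t']"
    using el assms(3,4) by (intro holds_cong[OF assms(1), where f = "\<lambda>x. Fn f [x,
        t']"] definable_tm_elems definable_tm_Fn2 definable_tm_hd) auto
  show "w \<Vdash> Fn f [u, t'] =\<^bsub>r\<^esub> Fn f [u, u']"
    using el assms(3,4) by (intro holds_cong[OF assms(2), where f = "\<lambda>x. Fn f [u,
        x]"] definable_tm_elems definable_tm_Fn2 definable_tm_hd) auto
qed

lemma holds_axiom1:
  assumes "axiom (Forall s F)" "t \<in> elems w s" "definable (fst w) [s] (\<lambda>ts. F (hd ts))"
  shows "w \<Vdash> F t"
proof -
  have "definable UNIV [s] (\<lambda>ts. F (hd ts))" using assms(3) by (auto simp: definable_def)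
  then show ?thesis
    using prv_axiom1[OF assms(1)] sentence_definable[OF assms(3) ext_refl[OF w] assms(2)] assms(2)
    by (auto intro!: holds_prv elems_sort)
qed

lemma nat_add_zero: "m \<in> elems w Nat \<Longrightarrow> w \<Vdash> m +\<^sub>N 0\<^sub>N =\<^sub>N m"
  by (rule holds_axiom1[OF axiom.nadd_zero]; (intro definable_tm_elems definable_tm_rules
      definable_rules)?; simp)

lemma nat_add_succ:
  assumes "m \<in> elems w Nat" "n \<in> elems w Nat"
  shows "w \<Vdash> m +\<^sub>N succ n =\<^sub>N succ (m +\<^sub>N n)"
  by (rule holds_prv_eq, simp, rule prv_axiom2[OF axiom.nadd_succ]; (intro definable_tm_rules
      definable_rules)?; use assms elems_sort in auto)

end

lemma nat_zero_add:
  assumes w: "world w" and n: "n \<in> elems w Nat"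
  shows "w \<Vdash> 0\<^sub>N +\<^sub>N n =\<^sub>N n"
proof (rule holds_induct[OF w _ _ _ _ n])
  show "w \<Vdash> 0\<^sub>N +\<^sub>N 0\<^sub>N =\<^sub>N 0\<^sub>N" using w by (simp add: nat_add_zero)
  fix w' n assume *: "w \<sqsubseteq> w'" "n \<in> elems w' Nat" "w' \<Vdash> 0\<^sub>N +\<^sub>N n =\<^sub>N n"
  then have w': "world w'" by (simp add: ext_def)
  show "w' \<Vdash> 0\<^sub>N +\<^sub>N succ n =\<^sub>N succ n"
    using holds_trans[OF nat_add_succ[OF w'] holds_cong1[OF w' *(3)] w'] * by simp
qed (intro definable_tm_rules definable_rules; simp)+

lemma nat_succ_add:
  assumes w: "world w" and m: "m \<in> elems w Nat" and n: "n \<in> elems w Nat"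
  shows "w \<Vdash> succ m +\<^sub>N n =\<^sub>N succ (m +\<^sub>N n)"
proof (rule holds_induct[OF w _ _ _ _ n])
  show "w \<Vdash> succ m +\<^sub>N 0\<^sub>N =\<^sub>N succ (m +\<^sub>N 0\<^sub>N)"
    using holds_trans[OF nat_add_zero[OF w] holds_sym[OF holds_cong1[OF w nat_add_zero[OF w m]] w]
        w] m by simp
  fix w' n assume *: "w \<sqsubseteq> w'" "n \<in> elems w' Nat" "w' \<Vdash> succ m +\<^sub>N n =\<^sub>N succ (m +\<^sub>N n)"
  then have w': "world w'" and m': "m \<in> elems w' Nat" using m elems_mono by (auto simp: ext_def)
  show "w' \<Vdash> succ m +\<^sub>N succ n =\<^sub>N succ (m +\<^sub>N succ n)"
    using holds_trans[OF holds_trans[OF nat_add_succ[OF w'] holds_cong1[OF w' *(3)] w']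
        holds_sym[OF holds_cong1[OF w' nat_add_succ[OF w' m' *(2)]] w'] w'] * m' by simp
qed (use m in \<open>intro definable_tm_elems definable_tm_rules definable_rules; simp\<close>)+

lemma nat_add_assoc:
  assumes w: "world w" and k: "k \<in> elems w Nat" and m: "m \<in> elems w Nat" and n: "n \<in> elems w Nat"
  shows "w \<Vdash> (k +\<^sub>N m) +\<^sub>N n =\<^sub>N k +\<^sub>N (m +\<^sub>N n)"
proof (rule holds_induct[OF w _ _ _ _ n])
  show "w \<Vdash> (k +\<^sub>N m) +\<^sub>N 0\<^sub>N =\<^sub>N k +\<^sub>N (m +\<^sub>N 0\<^sub>N)"
    using holds_trans[OF nat_add_zero[OF w] holds_sym[OF holds_cong2[OF w holds_refl[OF w k]
        nat_add_zero[OF w m]] w] w] k m by simp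
  fix w' n assume *: "w \<sqsubseteq> w'" "n \<in> elems w' Nat" "w' \<Vdash> (k +\<^sub>N m) +\<^sub>N n =\<^sub>N k +\<^sub>N (m +\<^sub>N n)"
  then have w' [simp]: "world w'" and [simp]: "k \<in> elems w' Nat" "m \<in> elems w' Nat" "n \<in> elems w'
      Nat"
    using k m elems_mono by (auto simp: ext_def)
  have 1: "w' \<Vdash> (k +\<^sub>N m) +\<^sub>N succ n =\<^sub>N succ ((k +\<^sub>N m) +\<^sub>N n)" by (rule nat_add_succ) auto
  have 2: "w' \<Vdash> succ ((k +\<^sub>N m) +\<^sub>N n) =\<^sub>N succ (k +\<^sub>N (m +\<^sub>N n))" by (rule holds_cong1[OF _ *(3)]) auto
  have 3: "w' \<Vdash> k +\<^sub>N (m +\<^sub>N succ n) =\<^sub>N k +\<^sub>N succ (m +\<^sub>N n)"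
    by (rule holds_cong2[OF _ holds_refl nat_add_succ]) auto
  have 4: "w' \<Vdash> k +\<^sub>N succ (m +\<^sub>N n) =\<^sub>N succ (k +\<^sub>N (m +\<^sub>N n))" by (rule nat_add_succ) auto
  show "w' \<Vdash> (k +\<^sub>N m) +\<^sub>N succ n =\<^sub>N k +\<^sub>N (m +\<^sub>N succ n)"
    by (rule holds_trans[OF holds_trans[OF 1 2] holds_sym[OF holds_trans[OF 3 4]]]) simp_all
qed (use k m in \<open>intro definable_tm_elems definable_tm_rules definable_rules; simp\<close>)+

lemmas definable_intros = definable_rules definable_tm_elems definable_tm_rules

lemma nle_I: "world w \<Longrightarrow> m \<in> elems w Nat \<Longrightarrow> n \<in> elems w Nat \<Longrightarrow> k \<in> elems w Nat \<Longrightarrow>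
    w \<Vdash> m +\<^sub>N k =\<^sub>N n \<Longrightarrow> w \<Vdash> m \<le>\<^sub>N n"
  unfolding nle_def by (rule holds_ExistsI[where t = k
      and N = "fst w"]; (intro definable_intros)?; simp)

lemma nle_E:
  assumes "w \<Vdash> m \<le>\<^sub>N n" "world w" "m \<in> elems w Nat" "n \<in> elems w Nat"
  obtains k where "k \<in> elems w Nat" "w \<Vdash> m +\<^sub>N k =\<^sub>N n"
  using assms(1) unfolding nle_def
  by (rule holds_ExistsE[where N = "fst w"]) ((intro definable_intros)?; use assms that in simp)+

lemma succ_not_zero: "w \<Vdash> succ n =\<^sub>N 0\<^sub>N \<Longrightarrow> world w \<Longrightarrow> P"
proof -
  assume *: "w \<Vdash> succ n =\<^sub>N 0\<^sub>N" "world w"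
  then have n: "n \<in> elems w Nat" using holds_eq_elems[OF *] by simp
  have "w \<Vdash> \<^bold>\<not> succ n =\<^sub>N 0\<^sub>N"
    by (rule holds_axiom1[OF *(2) axiom.succ_nonzero n]) (intro definable_intros; simp)
  then show ?thesis using * holds_ImpE holds_FalsumE by blast
qed

text \<open>
  Provable by induction in the formal theory; at a world the disjunction yields an actual case
  distinction.
\<close>

lemma nat_cases:
  assumes w: "world w" and n: "n \<in> elems w Nat"
  obtains "w \<Vdash> n =\<^sub>N 0\<^sub>N" | k where "k \<in> elems w Nat" "w \<Vdash> n =\<^sub>N succ k"
proof -
  have "w \<Vdash> n =\<^sub>N 0\<^sub>N \<^bold>\<or> (\<^bold>\<exists>k:Nat. n =\<^sub>N succ k)"
  proof (rule holds_induct[OF w _ _ _ _ n])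
    show "w \<Vdash> 0\<^sub>N =\<^sub>N 0\<^sub>N \<^bold>\<or> (\<^bold>\<exists>k:Nat. 0\<^sub>N =\<^sub>N succ k)"
      by (rule holds_OrI1[OF holds_refl[OF w] w], simp) (unfold sentence_iff,
          intro definable_intros; simp)
    fix w' n assume *: "w \<sqsubseteq> w'" "n \<in> elems w' Nat"
    then have w': "world w'" by (simp add: ext_def)
    have "w' \<Vdash> (\<^bold>\<exists>k:Nat. succ n =\<^sub>N succ k)"
      using * w' by (intro holds_ExistsI[where t = n
          and N = "fst w'"] holds_refl) ((intro definable_intros)?; simp)+
    then show "w' \<Vdash> succ n =\<^sub>N 0\<^sub>N \<^bold>\<or> (\<^bold>\<exists>k:Nat. succ n =\<^sub>N succ k)"
      by (rule holds_OrI2[OF _ w']) (unfold sentence_iff, intro definable_intros; use * in simp)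
  qed (intro definable_intros; simp)+
  then have "(w \<Vdash> n =\<^sub>N 0\<^sub>N) \<or> (w \<Vdash> (\<^bold>\<exists>k:Nat. n =\<^sub>N succ k))" using holds_OrE w by blast
  then show ?thesis
  proof
    assume "w \<Vdash> (\<^bold>\<exists>k:Nat. n =\<^sub>N succ k)"
    then show ?thesis
      by (rule holds_ExistsE[where N = "fst w"]) ((intro definable_intros)?; use n w that in simp)+
  qed (rule that)
qed

definition posnat :: "pre_world \<Rightarrow> tm \<Rightarrow> bool" where
  "posnat w n \<longleftrightarrow> n \<in> elems w Nat \<and> (w \<Vdash> 1\<^sub>N \<le>\<^sub>N n)"

lemma posnat_elems: "posnat w n \<Longrightarrow> n \<in> elems w Nat"
  by (simp add: posnat_def)

lemma posnat_mono: "posnat w n \<Longrightarrow> w \<sqsubseteq> w' \<Longrightarrow> posnat w' n"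
  by (auto simp: posnat_def intro: elems_mono holds_mono)

lemma nat_one_add:
  assumes "world w" "k \<in> elems w Nat"
  shows "w \<Vdash> 1\<^sub>N +\<^sub>N k =\<^sub>N succ k"
  using holds_trans[OF nat_succ_add[OF assms(1) _ assms(2)] holds_cong1[OF assms(1)
      nat_zero_add[OF assms]]] assms by simp

lemma posnatI: "world w \<Longrightarrow> k \<in> elems w Nat \<Longrightarrow> w \<Vdash> n =\<^sub>N succ k \<Longrightarrow> posnat w n"
proof -
  assume w: "world w" and *: "k \<in> elems w Nat" "w \<Vdash> n =\<^sub>N succ k"
  then have "n \<in> elems w Nat" using holds_eq_elems by blast
  then show ?thesis unfolding posnat_def using * w
    by (auto intro!: nle_I[of w _ n k] holds_trans[OF nat_one_add holds_sym])
qed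

lemma posnat_succ: "world w \<Longrightarrow> k \<in> elems w Nat \<Longrightarrow> posnat w (succ k)"
  by (rule posnatI) (auto intro: holds_refl)

lemma posnatE:
  assumes "posnat w n" "world w"
  obtains k where "k \<in> elems w Nat" "w \<Vdash> n =\<^sub>N succ k"
proof -
  have "w \<Vdash> 1\<^sub>N \<le>\<^sub>N n" "n \<in> elems w Nat" using assms by (auto simp: posnat_def)
  then obtain k where k: "k \<in> elems w Nat" "w \<Vdash> 1\<^sub>N +\<^sub>N k =\<^sub>N n"
    using assms(2) by (elim nle_E) auto
  show ?thesis
    using that[OF k(1)] holds_trans[OF holds_sym[OF k(2)] nat_one_add] assms k by blast
qed

lemma posnat_add: "world w \<Longrightarrow> m \<in> elems w Nat \<Longrightarrow> posnat w n \<Longrightarrow> posnat w (m +\<^sub>N n)"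
proof -
  assume w: "world w" and m: "m \<in> elems w Nat" and n: "posnat w n"
  obtain k where k: "k \<in> elems w Nat" "w \<Vdash> n =\<^sub>N succ k" using posnatE[OF n w] .
  show ?thesis
    by (rule posnatI[OF w, of "m +\<^sub>N k"])
      (use k m w holds_trans[OF holds_cong2[OF w holds_refl[OF w m] k(2),
          of NAdd Nat] nat_add_succ[OF w m k(1)] w] in simp_all)
qed

abbreviation dbl :: "tm \<Rightarrow> tm" where "dbl n \<equiv> n +\<^sub>N n"

lemma posnat_dbl: "world w \<Longrightarrow> posnat w n \<Longrightarrow> posnat w (dbl n)"
  by (simp add: posnat_add posnat_elems)

lemma posnat_one: "world w \<Longrightarrow> posnat w 1\<^sub>N"
  by (rule posnat_succ) auto

lemma holds_Forall_posI:
  assumes "world w" "definable (fst w) [Nat] (\<lambda>ts. F (hd ts))"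
    and "\<And>w' n. w \<sqsubseteq> w' \<Longrightarrow> posnat w' n \<Longrightarrow> w' \<Vdash> F n"
  shows "w \<Vdash> Forall_pos F"
  unfolding Forall_pos_def
  by (rule holds_Forall_ImpI[OF assms(1)]; (intro definable_Imp definable_nle definable_tm_rules
      assms(2))?; use assms(3) in \<open>simp add: posnat_def\<close>)

lemma holds_Forall_posE:
  assumes "w \<Vdash> Forall_pos F" "definable (fst w) [Nat] (\<lambda>ts. F (hd ts))" "posnat w n" "world w"
  shows "w \<Vdash> F n"
proof -
  have "w \<Vdash> 1\<^sub>N \<le>\<^sub>N n \<^bold>\<longrightarrow> F n"
    by (rule holds_ForallE[OF assms(1)[unfolded Forall_pos_def], where N = "fst w"];
        (intro definable_Imp definable_nle definable_tm_rules assms(2))?; use assms in \<open>simp add: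
            posnat_def\<close>)
  then show ?thesis using assms holds_ImpE by (auto simp: posnat_def)
qed

lemma holds_Exists_posI:
  assumes "w \<Vdash> F n" "posnat w n" "definable (fst w) [Nat] (\<lambda>ts. F (hd ts))" "world w"
  shows "w \<Vdash> Exists_pos F"
  unfolding Exists_pos_def
  by (rule holds_ExistsI[where t = n and N = "fst w"]; (intro definable_And definable_nle
      definable_tm_rules assms(3))?;
      use assms in \<open>simp add: posnat_def holds_And\<close>)

lemma holds_Exists_posE:
  assumes "w \<Vdash> Exists_pos F" "definable (fst w) [Nat] (\<lambda>ts. F (hd ts))" "world w"
  obtains n where "posnat w n" "w \<Vdash> F n"
proof -
  have "definable (fst w) [Nat] (\<lambda>ts. 1\<^sub>N \<le>\<^sub>N hd ts \<^bold>\<and> F (hd ts))"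
    by (intro definable_And definable_nle definable_tm_rules assms(2)) simp_all
  from holds_ExistsE[OF assms(1)[unfolded Exists_pos_def] this assms(3)]
  obtain n where "n \<in> elems w Nat" "w \<Vdash> 1\<^sub>N \<le>\<^sub>N n \<^bold>\<and> F n" .
  then show ?thesis using that assms(3) by (auto simp: posnat_def holds_And)
qed

section \<open>Reciprocals\<close>

definition recip_of :: "tm \<Rightarrow> rat_class" where
  "recip_of n = rat_of (recip n)"

lemma of_N_add:
  assumes w: "world w" and m: "m \<in> elems w Nat" and n: "n \<in> elems w Nat"
  shows "w \<Vdash> of_N (m +\<^sub>N n) =\<^sub>Q of_N m +\<^sub>Q of_N n"
proof (rule holds_induct[OF w _ _ _ _ n])
  note [simp] = m elems_sort[OF m]
  have "w \<Vdash> of_N (m +\<^sub>N 0\<^sub>N) =\<^sub>Q of_N m" by (rule holds_cong1[OF w nat_add_zero[OF w m]]) auto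
  moreover have "w \<Vdash> of_N m =\<^sub>Q of_N m +\<^sub>Q 0\<^sub>Q" using w by (intro rat_of_eqD) auto
  ultimately show "w \<Vdash> of_N (m +\<^sub>N 0\<^sub>N) =\<^sub>Q of_N m +\<^sub>Q 0\<^sub>Q" using w holds_trans by blast
  fix w' n assume *: "w \<sqsubseteq> w'" "n \<in> elems w' Nat" "w' \<Vdash> of_N (m +\<^sub>N n) =\<^sub>Q of_N m +\<^sub>Q of_N n"
  note w' = ext_world[OF *(1)] and m' [simp] = elems_mono[OF m *(1)]
  note [simp] = elems_sort[OF *(2)] *(2)
  have "w' \<Vdash> of_N (m +\<^sub>N succ n) =\<^sub>Q of_N (succ (m +\<^sub>N n))"
      by (rule holds_cong1[OF w' nat_add_succ[OF w']]) auto
  moreover have "w' \<Vdash> of_N (succ (m +\<^sub>N n)) =\<^sub>Q of_N (m +\<^sub>N n) +\<^sub>Q 1\<^sub>Q" using w'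
      by (intro rat_of_eqD) auto
  moreover have "w' \<Vdash> of_N (m +\<^sub>N n) +\<^sub>Q 1\<^sub>Q =\<^sub>Q (of_N m +\<^sub>Q of_N n) +\<^sub>Q 1\<^sub>Q"
      by (rule eq_add[OF w' *(3)]) auto
  moreover have "w' \<Vdash> (of_N m +\<^sub>Q of_N n) +\<^sub>Q 1\<^sub>Q =\<^sub>Q of_N m +\<^sub>Q of_N (succ n)"
    using w' by (intro rat_of_eqD) (auto simp: algebra_simps)
  ultimately show "w' \<Vdash> of_N (m +\<^sub>N succ n) =\<^sub>Q of_N m +\<^sub>Q of_N (succ n)" using w' holds_trans by meson
qed (intro definable_intros; use m in simp)+

lemma of_N_nonneg:
  assumes w: "world w" and n: "n \<in> elems w Nat"
  shows "nonneg w (rat_of (of_N n))"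
proof -
  have "w \<Vdash> 0\<^sub>Q \<le>\<^sub>Q of_N n"
  proof (rule holds_induct[OF w _ _ _ _ n])
    show "w \<Vdash> 0\<^sub>Q \<le>\<^sub>Q 0\<^sub>Q" using w by (simp add: le_iff is_zero_nonneg is_zero_0)
    fix w' n assume *: "w \<sqsubseteq> w'" "n \<in> elems w' Nat" "w' \<Vdash> 0\<^sub>Q \<le>\<^sub>Q of_N n"
    then have w': "world w'" by (auto simp: ext_def)
    then show "w' \<Vdash> 0\<^sub>Q \<le>\<^sub>Q of_N (succ n)"
      using *(2,3) elems_sort[OF *(2)] nonneg_add[OF w' _ pos_nonneg[OF w' pos_1]]
          by (simp add: le_iff)
  qed (intro definable_intros; simp)+
  then show ?thesis using w n by (simp add: le_iff)
qed

lemma of_N_pos: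
  assumes w: "world w" and n: "posnat w n"
  shows "positive w (rat_of (of_N n))"
proof -
  obtain k where k: "k \<in> elems w Nat" "w \<Vdash> n =\<^sub>N succ k" using posnatE[OF n w] .
  have "w \<Vdash> of_N n =\<^sub>Q of_N (succ k)" by (rule holds_cong1[OF w k(2)]) auto
  then have 1: "is_zero w (rat_of (of_N n) - rat_of (of_N (succ k)))" using k w n posnat_elems
      by (subst (asm) eq_iff) auto
  have "positive w (1 + rat_of (of_N k))" by (rule pos_nonneg_add[OF w pos_1[OF w] of_N_nonneg[OF
      w k(1)]])
  from pos_is_zero_add[OF w this 1] show ?thesis using elems_sort[OF k(1)]
      by (simp add: algebra_simps)
qed

text \<open>
  The axiom on inverses asks for \<open>\<not> n = 0\<close> in the rationals, which follows from \<open>n > 0\<close>.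
\<close>

lemma recip_inverse:
  assumes w: "world w" and n: "posnat w n"
  shows "is_zero w (rat_of (of_N n) * recip_of n - 1)"
proof -
  have [simp]: "n \<in> elems w Nat" "has_sort [] n Nat" using posnat_elems[OF n] elems_sort by auto
  have "w \<Vdash> \<^bold>\<not> of_N n =\<^sub>Q 0\<^sub>Q"
  proof (rule holds_ImpI[OF w])
    show "sentence w (\<^bold>\<not> of_N n =\<^sub>Q 0\<^sub>Q)" unfolding sentence_iff by (intro definable_intros; simp)
    fix w' assume w': "w \<sqsubseteq> w'" and eq: "w' \<Vdash> of_N n =\<^sub>Q 0\<^sub>Q"
    note ww = ext_world[OF w']
    have "n \<in> elems w' Nat" using elems_mono[OF _ w'] by simp
    then have "is_zero w' (rat_of (of_N n))" using eq ww by (simp add: is_zero_rat_of)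
    then have "positive w' 0" using pos_is_zero_add[OF ww of_N_pos[OF ww posnat_mono[OF n w']]
        is_zero_minus[OF ww]] by fastforce
    then show "w' \<Vdash> \<^bold>\<bottom>" using not_pos_0[OF ww] by simp
  qed
  moreover have "w \<Vdash> \<^bold>\<not> of_N n =\<^sub>Q 0\<^sub>Q \<^bold>\<longrightarrow> of_N n *\<^sub>Q recip n =\<^sub>Q 1\<^sub>Q"
    by (rule holds_axiom1[OF w axiom.qmul_inv]; (intro definable_intros)?; simp)
  ultimately have "w \<Vdash> of_N n *\<^sub>Q recip n =\<^sub>Q 1\<^sub>Q" using holds_ImpE w by blast
  then show ?thesis using w by (simp add: eq_iff recip_of_def)
qed

lemma recip_of_represented: "world w \<Longrightarrow> posnat w n \<Longrightarrow> represented w (recip_of n)"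
  unfolding recip_of_def by (intro represented_rat_of) (simp_all add: posnat_elems)

text \<open>
  A nonpositive reciprocal would give \<open>n \<cdot> 1/n \<le> 0\<close>.
\<close>

lemma recip_of_pos:
  assumes w: "world w" and n: "posnat w n"
  shows "positive w (recip_of n)"
proof -
  have "\<not> nonneg w (- recip_of n)"
  proof
    assume "nonneg w (- recip_of n)"
    then have "nonneg w (rat_of (of_N n) * - recip_of n)" using nonneg_mult w of_N_pos[OF w n]
        by blast
    from pos_nonneg_add[OF w pos_1[OF w] nonneg_add[OF w this is_zero_nonneg(1)[OF w
        recip_inverse[OF w n]]]]
    have "positive w 0" by simp
    then show False using not_pos_0 w by blast
  qed
  then show ?thesis using pos_trichotomy[OF w recip_of_represented[OF w n]] by blast
qed

text \<open>
  With \<open>N\<close> and \<open>D\<close> the values of \<open>n\<close> and \<open>2n\<close>, the difference \<open>1/n - 2/(2n)\<close> is a combination of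
  the vanishing elements \<open>D \<cdot> 1/(2n) - 1\<close>, \<open>D - 2N\<close> and \<open>N \<cdot> 1/n - 1\<close>.
\<close>

lemma recip_of_dbl:
  assumes w: "world w" and n: "posnat w n"
  shows "is_zero w (recip_of n - recip_of (dbl n) - recip_of (dbl n))"
proof -
  have el [simp]: "n \<in> elems w Nat" "has_sort [] n Nat" using posnat_elems[OF n] elems_sort by auto
  note n2 = posnat_dbl[OF w n]
  let ?N = "rat_of (of_N n)" and ?D = "rat_of (of_N (dbl n))"
  have vals: "represented w (recip_of n)" "represented w (recip_of (dbl n))" "represented w
      (recip_of n * recip_of (dbl n))"
    using recip_of_represented[OF w n] recip_of_represented[OF w n2] represented_rat_of[OF w,
        of "recip n *\<^sub>Q recip (dbl n)"] by (auto simp: recip_of_def)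
  have 1: "is_zero w (?D - (?N + ?N))" using of_N_add[OF w el(1) el(1)] w by (simp add: eq_iff)
  let ?A = "?D * recip_of (dbl n) - 1" and ?B = "?D - (?N + ?N)" and ?C = "?N * recip_of n - 1"
  have "is_zero w (- (?A * recip_of n) + ?B * (recip_of n * recip_of (dbl n)) + (?C * recip_of
      (dbl n) + ?C * recip_of (dbl n)))"
    using is_zero_add is_zero_minus is_zero_mult vals 1 recip_inverse[OF w n] recip_inverse[OF w
        n2] w by metis
  then show ?thesis by (simp add: algebra_simps)
qed

section \<open>Real numbers at a world\<close>

abbreviation approx :: "tm \<Rightarrow> tm \<Rightarrow> rat_class" where "approx x n \<equiv> rat_of (x \<cdot>\<^sub>Q n)"

text \<open>
  The relations between real numbers are unfolded to inequalities between rational approximations.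
  The doubled index comes from Bishop's definition of addition.
\<close>

lemma rle_E:
  assumes "w \<Vdash> x \<le>\<^sub>R y" "world w" "x \<in> elems w (Seq Rat)" "y \<in> elems w (Seq Rat)" "posnat w n"
  shows "nonneg w (approx y (dbl n) - approx x (dbl n) + recip_of n)"
proof -
  have n [simp]: "n \<in> elems w Nat" using assms by (simp add: posnat_elems)
  note [simp] = assms(3,4) assms(3,4)[THEN elems_sort] n[THEN elems_sort]
  have "w \<Vdash> -\<^sub>Q recip n \<le>\<^sub>Q (y +\<^sub>R -\<^sub>R x) \<cdot>\<^sub>Q n"
    by (rule holds_Forall_posE[OF assms(1)[unfolded rle_def rnonneg_def] _ assms(5,2)]) (intro
        definable_intros; simp)
  then show ?thesis using assms(2) by (simp add: le_iff recip_of_def)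
qed

lemma rless_I:
  assumes "positive w (approx y (dbl n) - approx x (dbl n) - recip_of n)" "world w" "x \<in> elems w
      (Seq Rat)" "y \<in> elems w (Seq Rat)" "posnat w n"
  shows "w \<Vdash> x <\<^sub>R y"
proof -
  have n [simp]: "n \<in> elems w Nat" using assms by (simp add: posnat_elems)
  note [simp] = assms(3,4) assms(3,4)[THEN elems_sort] n[THEN elems_sort]
  have "w \<Vdash> recip n <\<^sub>Q (y +\<^sub>R -\<^sub>R x) \<cdot>\<^sub>Q n"
    using assms(1,2) by (simp add: less_iff recip_of_def)
  then show ?thesis unfolding rless_def rpos_def
    by (rule holds_Exists_posI[OF _ assms(5) _ assms(2)]) (intro definable_intros; simp)
qed

lemma rless_E:
  assumes "w \<Vdash> x <\<^sub>R y" "world w" "x \<in> elems w (Seq Rat)" "y \<in> elems w (Seq Rat)"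
  obtains n where "posnat w n" "positive w (approx y (dbl n) - approx x (dbl n) - recip_of n)"
proof -
  note [simp] = assms(3,4) assms(3,4)[THEN elems_sort]
  obtain n where n: "posnat w n" "w \<Vdash> recip n <\<^sub>Q (y +\<^sub>R -\<^sub>R x) \<cdot>\<^sub>Q n"
    by (rule holds_Exists_posE[OF assms(1)[unfolded rless_def rpos_def] _ assms(2)]) (intro
        definable_intros; simp)+
  note [simp] = posnat_elems[OF n(1)] posnat_elems[OF n(1), THEN elems_sort]
  show ?thesis by (rule that[OF n(1)]) (use n(2) assms(2) in \<open>simp add: less_iff recip_of_def\<close>)
qed

lemma is_real_E:
  assumes "w \<Vdash> is_real x" "world w" "x \<in> elems w (Seq Rat)" "posnat w m" "posnat w n"
  shows "nonneg w (recip_of m + recip_of n - (approx x m - approx x n))"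
proof -
  have mn [simp]: "m \<in> elems w Nat" "n \<in> elems w Nat" using assms by (simp_all add: posnat_elems)
  note [simp] = assms(3) assms(3)[THEN elems_sort] mn[THEN elems_sort]
  have "w \<Vdash> (\<^bold>\<forall>\<^sup>+n. qdist_le (x \<cdot>\<^sub>Q m) (x \<cdot>\<^sub>Q n) (recip m +\<^sub>Q recip n))"
    by (rule holds_Forall_posE[OF assms(1)[unfolded is_real_def] _ assms(4,2)]) (intro
        definable_intros; simp)
  then have "w \<Vdash> qdist_le (x \<cdot>\<^sub>Q m) (x \<cdot>\<^sub>Q n) (recip m +\<^sub>Q recip n)"
    by (rule holds_Forall_posE[OF _ _ assms(5,2)]) (intro definable_intros; simp)
  then show ?thesis using assms(2) by (simp add: qdist_le_def holds_And le_iff recip_of_def)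
qed

lemma req_E:
  assumes "w \<Vdash> x =\<^sub>R y" "world w" "x \<in> elems w (Seq Rat)" "y \<in> elems w (Seq Rat)" "posnat w n"
  shows "nonneg w (recip_of n + recip_of n - (approx x n - approx y n))" "nonneg w (recip_of n +
      recip_of n - (approx y n - approx x n))"
proof -
  have n [simp]: "n \<in> elems w Nat" using assms by (simp add: posnat_elems)
  note [simp] = assms(3,4) assms(3,4)[THEN elems_sort] n[THEN elems_sort]
  have "w \<Vdash> qdist_le (x \<cdot>\<^sub>Q n) (y \<cdot>\<^sub>Q n) (recip n +\<^sub>Q recip n)"
    by (rule holds_Forall_posE[OF assms(1)[unfolded req_def] _ assms(5,2)]) (intro
        definable_intros; simp)
  then show "nonneg w (recip_of n + recip_of n - (approx x n - approx y n))" "nonneg w (recip_of n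
      + recip_of n - (approx y n - approx x n))"
    using assms(2) by (simp_all add: qdist_le_def holds_And le_iff recip_of_def)
qed

lemma req_I:
  assumes "world w" "x \<in> elems w (Seq Rat)" "y \<in> elems w (Seq Rat)"
    and "\<And>w' n. w \<sqsubseteq> w' \<Longrightarrow> posnat w' n \<Longrightarrow> nonneg w' (recip_of n + recip_of n - (approx x n - approx y
        n))"
    and "\<And>w' n. w \<sqsubseteq> w' \<Longrightarrow> posnat w' n \<Longrightarrow> nonneg w' (recip_of n + recip_of n - (approx y n - approx x
        n))"
  shows "w \<Vdash> x =\<^sub>R y"
  unfolding req_def
proof (rule holds_Forall_posI[OF assms(1)])
  note [simp] = assms(2,3)
  show "definable (fst w) [Nat] (\<lambda>ts. qdist_le (x \<cdot>\<^sub>Q hd ts) (y \<cdot>\<^sub>Q hd ts) (recip (hd ts) +\<^sub>Q recip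
      (hd ts)))"
    by (intro definable_intros; simp)
  fix w' n assume *: "w \<sqsubseteq> w'" "posnat w' n"
  note [simp] = ext_world[OF *(1)] assms(2,3)[THEN elems_mono, OF *(1)] assms(2,3)[THEN elems_sort]
    posnat_elems[OF *(2)] posnat_elems[OF *(2), THEN elems_sort]
  show "w' \<Vdash> qdist_le (x \<cdot>\<^sub>Q n) (y \<cdot>\<^sub>Q n) (recip n +\<^sub>Q recip n)"
    using assms(4,5)[OF *] by (simp add: qdist_le_def holds_And le_iff recip_of_def)
qed

lemma is_real_rconst:
  assumes w: "world w" and q: "q \<in> elems w Rat"
  shows "w \<Vdash> is_real (rconst q)"
  unfolding is_real_def
proof (rule holds_Forall_posI[OF w])
  note [simp] = q q[THEN elems_sort]
  show "definable (fst w) [Nat] (\<lambda>ts. \<^bold>\<forall>\<^sup>+n. qdist_le (rconst q \<cdot>\<^sub>Q hd ts) (rconst q \<cdot>\<^sub>Q n) (recip (hd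
      ts) +\<^sub>Q recip n))"
    by (intro definable_intros; simp)
  fix w' m assume m: "w \<sqsubseteq> w'" "posnat w' m"
  note w' = ext_world[OF m(1)] and [simp] = posnat_elems[OF m(2)] elems_mono[OF q m(1)]
  show "w' \<Vdash> (\<^bold>\<forall>\<^sup>+n. qdist_le (rconst q \<cdot>\<^sub>Q m) (rconst q \<cdot>\<^sub>Q n) (recip m +\<^sub>Q recip n))"
  proof (rule holds_Forall_posI[OF w'])
    show "definable (fst w') [Nat] (\<lambda>ts. qdist_le (rconst q \<cdot>\<^sub>Q m) (rconst q \<cdot>\<^sub>Q hd ts) (recip m +\<^sub>Q
        recip (hd ts)))"
      by (intro definable_intros; simp)
    fix w'' n assume n: "w' \<sqsubseteq> w''" "posnat w'' n"
    note w'' = ext_world[OF n(1)] and m'' = posnat_mono[OF m(2) n(1)]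
    note el = posnat_elems[OF n(2)] posnat_elems[OF m'']
    note [simp] = el el[THEN elems_sort] elems_mono[OF elems_mono[OF q m(1)] n(1)]
    have "nonneg w'' (recip_of m + recip_of n)" by (intro nonneg_add pos_nonneg recip_of_pos w'' n
        m'')
    then show "w'' \<Vdash> qdist_le (rconst q \<cdot>\<^sub>Q m) (rconst q \<cdot>\<^sub>Q n) (recip m +\<^sub>Q recip n)"
      using w'' by (simp add: qdist_le_def holds_And le_iff recip_of_def)
  qed
qed

lemma rconst_recip_pos:
  assumes w: "world w" and n: "posnat w n"
  shows "w \<Vdash> 0\<^sub>R <\<^sub>R rconst (recip n)"
proof (rule rless_I[OF _ w _ _ posnat_dbl[OF w n]])
  note el = posnat_elems[OF n]
  note [simp] = el el[THEN elems_sort]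
  have "positive w (recip_of (dbl n) + (recip_of n - recip_of (dbl n) - recip_of (dbl n)))"
    by (intro pos_is_zero_add recip_of_dbl recip_of_pos posnat_dbl w n)
  then show "positive w (approx (rconst (recip n)) (dbl (dbl n)) - approx 0\<^sub>R (dbl (dbl n)) -
      recip_of (dbl n))"
    by (simp add: recip_of_def)
qed (use posnat_elems[OF n] in simp_all)

section \<open>Powers of one half\<close>

abbreviation half :: tm where "half \<equiv> qinv (1\<^sub>Q +\<^sub>Q 1\<^sub>Q)"

lemma half_half:
  assumes w: "world w"
  shows "is_zero w (rat_of half + rat_of half - 1)"
proof -
  have two: "posnat w (succ 1\<^sub>N)" using w by (intro posnat_succ) auto
  have "w \<Vdash> 1\<^sub>Q +\<^sub>Q 1\<^sub>Q =\<^sub>Q of_N (succ 1\<^sub>N)" by (rule rat_of_eqD[OF w]) auto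
  then have "w \<Vdash> half =\<^sub>Q recip (succ 1\<^sub>N)" by (rule holds_cong1[OF w]) auto
  then have 1: "is_zero w (rat_of half - recip_of (succ 1\<^sub>N))" using w
      by (simp add: eq_iff recip_of_def)
  have "rat_of (of_N (succ 1\<^sub>N)) = 1 + 1" by simp
  then have 2: "is_zero w ((1 + 1) * recip_of (succ 1\<^sub>N) - 1)" using recip_inverse[OF w two] by metis
  have "is_zero w ((rat_of half - recip_of (succ 1\<^sub>N)) + (rat_of half - recip_of (succ 1\<^sub>N)) + ((1 +
      1) * recip_of (succ 1\<^sub>N) - 1))"
    by (intro is_zero_add w 1 2)
  then show ?thesis by (simp add: algebra_simps)
qed

text \<open>
  All estimates use reciprocals of positive integers, so powers of one half are expressed as such:
  \<open>2\<^sup>-\<^sup>n = 1/N\<close>, where \<open>N\<close> is doubled in each step.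
\<close>

lemma half_pow_recip:
  assumes w: "world w" and n: "n \<in> elems w Nat"
  obtains N where "posnat w N" "is_zero w (recip_of N - rat_of (half ^\<^sub>Q n))"
proof -
  have "w \<Vdash> (\<^bold>\<exists>\<^sup>+N. recip N =\<^sub>Q half ^\<^sub>Q n)"
  proof (rule holds_induct[OF w _ _ _ _ n])
    have "is_zero w (rat_of (of_N 1\<^sub>N) * recip_of 1\<^sub>N - 1)"
        by (rule recip_inverse[OF w posnat_one[OF w]])
    then have "w \<Vdash> recip 1\<^sub>N =\<^sub>Q half ^\<^sub>Q 0\<^sub>N" using w by (simp add: eq_iff recip_of_def)
    then show "w \<Vdash> (\<^bold>\<exists>\<^sup>+N. recip N =\<^sub>Q half ^\<^sub>Q 0\<^sub>N)"
      by (rule holds_Exists_posI[OF _ posnat_one[OF w] _ w]) (intro definable_intros; simp)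
    fix w' n assume *: "w \<sqsubseteq> w'" "n \<in> elems w' Nat" "w' \<Vdash> (\<^bold>\<exists>\<^sup>+N. recip N =\<^sub>Q half ^\<^sub>Q n)"
    note w' = ext_world[OF *(1)]
    note [simp] = *(2) *(2)[THEN elems_sort]
    obtain N where N: "posnat w' N" "w' \<Vdash> recip N =\<^sub>Q half ^\<^sub>Q n"
      by (rule holds_Exists_posE[OF *(3) _ w']) (intro definable_intros; simp)+
    note el = posnat_elems[OF N(1)] and N2 = posnat_dbl[OF w' N(1)]
    note [simp] = el el[THEN elems_sort]
    have 1: "is_zero w' (recip_of N - rat_of (half ^\<^sub>Q n))" using N(2) w'
        by (simp add: eq_iff recip_of_def)
    have v: "represented w' (rat_of half)" by (rule represented_rat_of[OF w']) simp
    have "is_zero w' (- ((rat_of half + rat_of half - 1) * recip_of (dbl N)) + - ((recip_of N -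
        recip_of (dbl N) - recip_of (dbl N)) * rat_of half)
        + (recip_of N - rat_of (half ^\<^sub>Q n)) * rat_of half)"
      by (intro is_zero_add is_zero_minus is_zero_mult half_half recip_of_dbl w' N(1) 1 v
          recip_of_represented N2)
    then have "is_zero w' (recip_of (dbl N) - rat_of (half ^\<^sub>Q n) * rat_of half)"
        by (simp add: algebra_simps)
    then have "w' \<Vdash> recip (dbl N) =\<^sub>Q half ^\<^sub>Q succ n" using w' by (simp add: eq_iff recip_of_def)
    then show "w' \<Vdash> (\<^bold>\<exists>\<^sup>+N. recip N =\<^sub>Q half ^\<^sub>Q succ n)"
      by (rule holds_Exists_posI[OF _ N2 _ w']) (intro definable_intros; simp)
  qed (intro definable_intros; simp)+
  then obtain N where N: "posnat w N" "w \<Vdash> recip N =\<^sub>Q half ^\<^sub>Q n"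
    by (rule holds_Exists_posE[OF _ _ w]) (intro definable_intros; use n in simp)+
  show ?thesis by (rule that[OF N(1)]) (use N n posnat_elems[OF N(1)] w in \<open>simp add: eq_iff
      recip_of_def\<close>)
qed

section \<open>Metric estimates\<close>

lemma holds_Forall2E:
  assumes "w \<Vdash> Forall s (\<lambda>x. Forall r (F x))" "definable (fst w) [r,
      s] (\<lambda>ts. F (hd (tl ts)) (hd ts))"
    "definable (fst w) [r] (\<lambda>ts. F t (hd ts))" "t \<in> elems w s" "u \<in> elems w r" "world w"
  shows "w \<Vdash> F t u"
proof (rule holds_ForallE[OF _ assms(3,5,6)])
  have "definable (fst w) [s] (\<lambda>ts. Forall r (F (hd ts)))" using assms(2)
      by (intro definable_Forall)
  then show "w \<Vdash> Forall r (F t)" using holds_ForallE[OF assms(1) _ assms(4,6)] by simp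
qed

lemma metric_spaceE:
  assumes ms: "w \<Vdash> metric_space" and w: "world w"
    and el: "x \<in> elems w Pt" "y \<in> elems w Pt" "z \<in> elems w Pt"
  shows "w \<Vdash> is_real (\<rho> x y)" "w \<Vdash> 0\<^sub>R \<le>\<^sub>R \<rho> x y" "w \<Vdash> \<rho> x x =\<^sub>R 0\<^sub>R"
    "w \<Vdash> \<rho> x y =\<^sub>R \<rho> y x" "w \<Vdash> \<rho> x z \<le>\<^sub>R \<rho> x y +\<^sub>R \<rho> y z"
proof -
  note [simp] = el
  have ax: "w \<Vdash> (\<^bold>\<forall>x:Pt. \<^bold>\<forall>y:Pt. is_real (\<rho> x y) \<^bold>\<and> 0\<^sub>R \<le>\<^sub>R \<rho> x y)" "w \<Vdash> (\<^bold>\<forall>x:Pt. \<rho> x x =\<^sub>R 0\<^sub>R)"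
    "w \<Vdash> (\<^bold>\<forall>x:Pt. \<^bold>\<forall>y:Pt. \<rho> x y =\<^sub>R \<rho> y x)"
    "w \<Vdash> (\<^bold>\<forall>x:Pt. \<^bold>\<forall>y:Pt. \<^bold>\<forall>z:Pt. \<rho> x z \<le>\<^sub>R \<rho> x y +\<^sub>R \<rho> y z)"
    using ms w by (auto simp: metric_space_def holds_And)
  have "w \<Vdash> is_real (\<rho> x y) \<^bold>\<and> 0\<^sub>R \<le>\<^sub>R \<rho> x y"
    by (rule holds_Forall2E[OF ax(1) _ _ el(1,2) w]) (intro definable_intros; simp)+
  then show "w \<Vdash> is_real (\<rho> x y)" "w \<Vdash> 0\<^sub>R \<le>\<^sub>R \<rho> x y" using w by (auto simp: holds_And)
  show "w \<Vdash> \<rho> x x =\<^sub>R 0\<^sub>R" by (rule holds_ForallE[OF ax(2) _ el(1) w,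
      where N = "fst w"]) (intro definable_intros; simp)
  show "w \<Vdash> \<rho> x y =\<^sub>R \<rho> y x" by (rule holds_Forall2E[OF ax(3) _ _ el(1,2) w]) (intro
      definable_intros; simp)+
  have "w \<Vdash> (\<^bold>\<forall>z:Pt. \<rho> x z \<le>\<^sub>R \<rho> x y +\<^sub>R \<rho> y z)"
    by (rule holds_Forall2E[OF ax(4) _ _ el(1,2) w]) (intro definable_intros; simp)+
  then show "w \<Vdash> \<rho> x z \<le>\<^sub>R \<rho> x y +\<^sub>R \<rho> y z"
    by (rule holds_ForallE[OF _ _ el(3) w, where N = "fst w"]) (intro definable_intros; simp)
qed

text \<open>
  The slack in \<open>triangle_bound\<close>.  With \<open>j = 8n\<close>, the sum \<open>2/j + 2/(2j) + 6/(4j)\<close> is \<open>9/16\<close> of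
  \<open>1/n\<close>.
\<close>

lemma recip_of_budget:
  assumes w: "world w" and n: "posnat w n"
  defines "j \<equiv> dbl (dbl (dbl n))"
  defines "e \<equiv> recip_of (dbl (dbl j))"
  shows "positive w (recip_of n - (recip_of j + recip_of j) - (recip_of (dbl j) + recip_of (dbl
      j)) - (e + e + e + e + e + e))"
proof -
  note p = n posnat_dbl[OF w n] posnat_dbl[OF w posnat_dbl[OF w n]]
  have j: "posnat w j" "posnat w (dbl j)" "posnat w (dbl (dbl j))"
    unfolding j_def by (intro posnat_dbl w n)+
  define z where "z k = recip_of k - recip_of (dbl k) - recip_of (dbl k)" for k
  have z: "nonneg w (z n)" "nonneg w (z (dbl n))" "nonneg w (z (dbl (dbl n)))" "nonneg w (z j)"
      "nonneg w (z (dbl j))"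
    unfolding z_def by (intro is_zero_nonneg recip_of_dbl w p j)+
  have e: "nonneg w (recip_of j)" "nonneg w e" "positive w e" unfolding e_def
      by (intro pos_nonneg recip_of_pos w j)+
  \<comment> \<open>The multiplicities express the claim through the vanishing differences \<open>z k = 1/k - 2/(2k)\<close>
      and the positive rest \<open>3/j + 2e\<close>.\<close>
  have "positive w (e + (e + ((recip_of j + (recip_of j + recip_of j)) + (z n + ((z (dbl n) + z
      (dbl n)) +
      ((z (dbl (dbl n)) + z (dbl (dbl n)) + (z (dbl (dbl n)) + z (dbl (dbl n)))) +
      ((z j + (z j + z j)) + (z (dbl j) + z (dbl j) + (z (dbl j) + z (dbl j))))))))))"
    by (intro pos_nonneg_add nonneg_add w z e)
  then show ?thesis
    by (simp add: z_def e_def algebra_simps flip: j_def)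
qed

text \<open>
  If \<open>a + b\<close> is small, then so is \<open>c \<le> a + b\<close>.  The index is raised to \<open>2j\<close> by regularity, at the
  price of \<open>1/n + 1/(2j)\<close>, and the inequality \<open>c \<le> a + b\<close> relates \<open>c\<^sub>2\<^sub>j\<close> to the terms of \<open>a\<close> and
  \<open>b\<close> with index \<open>J = 4j\<close>, at the price of \<open>1/j\<close>.
\<close>

lemma triangle_bound:
  assumes w: "world w" and n: "posnat w n"
    and el: "a \<in> elems w (Seq Rat)" "b \<in> elems w (Seq Rat)" "c \<in> elems w (Seq Rat)"
    and c: "w \<Vdash> is_real c" "w \<Vdash> c \<le>\<^sub>R a +\<^sub>R b"
  defines "j \<equiv> dbl (dbl (dbl n))"
  defines "J \<equiv> dbl (dbl j)"
  assumes ab: "nonneg w (recip_of j + recip_of (dbl j) + (recip_of J + recip_of J + recip_of J +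
      recip_of J + recip_of J + recip_of J) - (approx a J + approx b J))"
  shows "positive w (recip_of n + recip_of n - approx c n)"
proof -
  have j: "posnat w j" "posnat w (dbl j)" unfolding j_def by (intro posnat_dbl w n)+
  note [simp] = el el[THEN elems_sort] posnat_elems[OF j(1)] posnat_elems[OF j(1), THEN elems_sort]
  have 1: "nonneg w (recip_of n + recip_of (dbl j) - (approx c n - approx c (dbl j)))"
    by (rule is_real_E[OF c(1) w]) (simp_all add: n j)
  have 2: "nonneg w (approx a J + approx b J - approx c (dbl j) + recip_of j)"
    using rle_E[OF c(2) w _ _ j(1)] by (simp add: J_def)
  have "positive w ((recip_of n - (recip_of j + recip_of j) - (recip_of (dbl j) + recip_of (dbl
      j)) - (recip_of J + recip_of J + recip_of J + recip_of J + recip_of J + recip_of J)) +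
      ((recip_of n + recip_of (dbl j) - (approx c n - approx c (dbl j))) + ((approx a J + approx b
          J - approx c (dbl j) + recip_of j) +
      (recip_of j + recip_of (dbl j) + (recip_of J + recip_of J + recip_of J + recip_of J +
          recip_of J + recip_of J) - (approx a J + approx b J)))))"
    using recip_of_budget[OF w n] by (intro pos_nonneg_add nonneg_add w 1 2 ab) (simp add: J_def
        j_def)
  then show ?thesis by (simp add: algebra_simps)
qed

text \<open>
  If \<open>s = u\<close> and \<open>s\<close> is close to \<open>z\<close>, then \<open>u\<close> is close to \<open>z\<close>.  The bound \<open>2/n\<close> on the \<open>n\<close>-th
  approximation serves two purposes: for all \<open>n\<close> it says that the distance is zero, and for a
  single even \<open>n\<close> it refutes the corresponding witness that the distance is positive.
\<close>

lemma metric_bound: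
  assumes w: "world w" and ms: "w \<Vdash> metric_space" and n: "posnat w n"
    and el: "s \<in> elems w Pt" "u \<in> elems w Pt" "z \<in> elems w Pt"
    and su: "w \<Vdash> s =\<^sub>X u" and sz: "w \<Vdash> \<rho> s z \<le>\<^sub>R rconst (recip (dbl (dbl (dbl n))))"
  shows "positive w (recip_of n + recip_of n - approx (\<rho> u z) n)" "positive w (recip_of n +
      recip_of n - approx (\<rho> z u) n)"
proof -
  define j where "j = dbl (dbl (dbl n))"
  define J where "J = dbl (dbl j)"
  have j: "posnat w j" "posnat w (dbl j)" "posnat w J" unfolding j_def J_def
      by (intro posnat_dbl w n)+
  note [simp] = el el[THEN elems_sort] posnat_elems[OF j(1)] posnat_elems[OF j(1), THEN elems_sort]
    posnat_elems[OF j(3)] posnat_elems[OF j(3), THEN elems_sort]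
  have 1: "nonneg w (recip_of J + recip_of J - approx (\<rho> s u) J)"
    using req_E(1)[OF su[unfolded eqX_def] w _ _ j(3)] by simp
  have 2: "nonneg w (recip_of J + recip_of J - (approx (\<rho> u s) J - approx (\<rho> s u) J))"
    by (rule req_E(1)[OF metric_spaceE(4)[OF ms w el(2,1,1)] w]) (simp_all add: j)
  have 3: "nonneg w (recip_of j - approx (\<rho> s z) J + recip_of (dbl j))"
    using rle_E[OF sz[folded j_def] w _ _ j(2)] by (simp add: J_def recip_of_def)
  have 4: "nonneg w (recip_of J + recip_of J - (approx (\<rho> z s) J - approx (\<rho> s z) J))"
    by (rule req_E(1)[OF metric_spaceE(4)[OF ms w el(3,1,1)] w]) (simp_all add: j)
  have e: "nonneg w (recip_of J + recip_of J)" by (intro nonneg_add pos_nonneg recip_of_pos w j)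
  note bound = triangle_bound[OF w n, folded j_def, folded J_def]
  have "nonneg w ((recip_of J + recip_of J - approx (\<rho> s u) J) + ((recip_of J + recip_of J -
      (approx (\<rho> u s) J - approx (\<rho> s u) J)) +
      ((recip_of j - approx (\<rho> s z) J + recip_of (dbl j)) + (recip_of J + recip_of J))))"
    by (intro nonneg_add w 1 2 3 e)
  then show "positive w (recip_of n + recip_of n - approx (\<rho> u z) n)"
    by (intro bound[OF _ _ _ metric_spaceE(1)[OF ms w el(2,3,3)] metric_spaceE(5)[OF ms w
        el(2,1,3)]])
      (simp_all add: algebra_simps)
  have "nonneg w ((recip_of J + recip_of J - approx (\<rho> s u) J) + ((recip_of J + recip_of J -
      (approx (\<rho> z s) J - approx (\<rho> s z) J)) +
      ((recip_of j - approx (\<rho> s z) J + recip_of (dbl j)) + (recip_of J + recip_of J))))"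
    by (intro nonneg_add w 1 4 3 e)
  then show "positive w (recip_of n + recip_of n - approx (\<rho> z u) n)"
    by (intro bound[OF _ _ _ metric_spaceE(1)[OF ms w el(3,2,2)] metric_spaceE(5)[OF ms w
        el(3,1,2)]])
      (simp_all add: algebra_simps)
qed

lemma nonneg_real_bound:
  assumes w: "world w" and n: "posnat w n" and c: "c \<in> elems w (Seq Rat)" "w \<Vdash> is_real c" "w \<Vdash> 0\<^sub>R
      \<le>\<^sub>R c"
  shows "nonneg w (recip_of n + recip_of n + approx c n)"
proof -
  define j where "j = dbl n"
  have j: "posnat w j" "posnat w (dbl j)" unfolding j_def by (intro posnat_dbl w n)+
  note [simp] = c(1) c(1)[THEN elems_sort] posnat_elems[OF j(1)] posnat_elems[OF j(1),
      THEN elems_sort]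
  have 1: "nonneg w (approx c (dbl j) + recip_of j)" using rle_E[OF c(3) w _ c(1) j(1)] by simp
  have 2: "nonneg w (recip_of (dbl j) + recip_of n - (approx c (dbl j) - approx c n))"
      by (rule is_real_E[OF c(2) w c(1) j(2) n])
  have "nonneg w (recip_of (dbl j) + ((recip_of n - recip_of j - recip_of j) + ((recip_of j -
      recip_of (dbl j) - recip_of (dbl j)) +
      ((approx c (dbl j) + recip_of j) + (recip_of (dbl j) + recip_of n - (approx c (dbl j) -
          approx c n))))))"
    using recip_of_dbl[OF w n] recip_of_dbl[OF w j(1)] recip_of_pos[OF w j(2)]
    by (intro nonneg_add w 1 2) (auto simp: j_def intro: is_zero_nonneg[OF w] pos_nonneg[OF w])
  then show ?thesis by (simp add: algebra_simps)
qed

text \<open>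
  \<open>1 > 1/2 + 1/4 + 1/8 + 1/16\<close>, scaled by \<open>1/m\<close>.
\<close>

lemma recip_of_geometric:
  assumes w: "world w" and m: "posnat w m"
  shows "positive w (recip_of m - recip_of (dbl m) - recip_of (dbl (dbl m)) - recip_of (dbl (dbl
      (dbl m))) - recip_of (dbl (dbl (dbl (dbl m)))))"
proof -
  define z where "z k = recip_of k - recip_of (dbl k) - recip_of (dbl k)" for k
  note p = m posnat_dbl[OF w m] posnat_dbl[OF w posnat_dbl[OF w m]] posnat_dbl[OF w posnat_dbl[OF
      w posnat_dbl[OF w m]]]
    posnat_dbl[OF w posnat_dbl[OF w posnat_dbl[OF w posnat_dbl[OF w m]]]]
  have "positive w (recip_of (dbl (dbl (dbl (dbl m)))) + (z m + (z (dbl m) + (z (dbl (dbl m)) + z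
      (dbl (dbl (dbl m)))))))"
    unfolding z_def by (intro pos_nonneg_add nonneg_add w is_zero_nonneg recip_of_dbl p
        recip_of_pos)
  then show ?thesis by (simp add: z_def algebra_simps)
qed

section \<open>The distance to the subset\<close>

text \<open>
  The infimum property for \<open>\<epsilon> = 1/N\<close>; \<open>m\<close> is the witness that \<open>\<rho>(a, x) < d + 1/N\<close>.
\<close>

lemma dist_approx:
  assumes w: "world w" and dist: "w \<Vdash> is_dist_Q x d" and N: "posnat w N"
    and el: "x \<in> elems w Pt" "d \<in> elems w (Seq Rat)"
  obtains a m where "a \<in> elems w Pt" "w \<Vdash> a \<in>\<^sub>Q" "posnat w m"
    "positive w (approx d (dbl (dbl m)) + recip_of N - approx (\<rho> a x) (dbl m) - recip_of m)"
proof -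
  note [simp] = el el[THEN elems_sort] posnat_elems[OF N] posnat_elems[OF N, THEN elems_sort]
  have "w \<Vdash> (\<^bold>\<forall>\<^sub>R\<epsilon>. 0\<^sub>R <\<^sub>R \<epsilon> \<^bold>\<longrightarrow> (\<^bold>\<exists>a:Pt. a \<in>\<^sub>Q \<^bold>\<and> \<rho> a x <\<^sub>R d +\<^sub>R \<epsilon>))"
    using dist w by (simp add: is_dist_Q_def holds_And)
  then have "w \<Vdash> is_real (rconst (recip N)) \<^bold>\<longrightarrow> 0\<^sub>R <\<^sub>R rconst (recip N) \<^bold>\<longrightarrow>
      (\<^bold>\<exists>a:Pt. a \<in>\<^sub>Q \<^bold>\<and> \<rho> a x <\<^sub>R d +\<^sub>R rconst (recip N))"
    unfolding Forall_real_def
    by (rule holds_ForallE[where N = "fst w"]) ((intro definable_intros)?; simp add: w)+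
  then have "w \<Vdash> (\<^bold>\<exists>a:Pt. a \<in>\<^sub>Q \<^bold>\<and> \<rho> a x <\<^sub>R d +\<^sub>R rconst (recip N))"
    using holds_ImpE[OF holds_ImpE[OF _ is_real_rconst[OF w] w] rconst_recip_pos[OF w N] w] by simp
  then obtain a where a: "a \<in> elems w Pt" "w \<Vdash> a \<in>\<^sub>Q \<^bold>\<and> \<rho> a x <\<^sub>R d +\<^sub>R rconst (recip N)"
    by (rule holds_ExistsE[where N = "fst w"]) ((intro definable_intros)?; simp add: w)+
  note [simp] = a(1) a(1)[THEN elems_sort]
  from a(2) have aQ: "w \<Vdash> a \<in>\<^sub>Q" "w \<Vdash> \<rho> a x <\<^sub>R d +\<^sub>R rconst (recip N)" using w
      by (simp_all add: holds_And)
  obtain m where m: "posnat w m" "positive w (approx (d +\<^sub>R rconst (recip N)) (dbl m) - approx (\<rho> a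
      x) (dbl m) - recip_of m)"
    by (rule rless_E[OF aQ(2) w]) simp_all
  show ?thesis
    by (rule that[OF a(1) aQ(1) m(1)]) (use m(2) posnat_elems[OF m(1),
        THEN elems_sort] in \<open>simp add: recip_of_def\<close>)
qed

text \<open>
  \<open>d \<ge> 0\<close>: since \<open>0 \<le> \<rho>(a, x) < d + 1/n\<close>, only the passage between indices has to be paid for. The
  strict inequality provides \<open>1/m\<close>, and \<open>1/(2m) + 1/(4m) + 1/(8m) + 1/(16m)\<close> is spent.
\<close>

lemma dist_lower_bound:
  assumes w: "world w" and ms: "w \<Vdash> metric_space" and dist: "w \<Vdash> is_dist_Q x d"
      and d: "w \<Vdash> is_real d"
    and n: "posnat w n" and el: "x \<in> elems w Pt" "d \<in> elems w (Seq Rat)"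
  shows "positive w (recip_of n + recip_of n + approx d n)"
proof -
  obtain a m where a: "a \<in> elems w Pt" "posnat w m"
      and am: "positive w (approx d (dbl (dbl m)) + recip_of n - approx (\<rho> a x) (dbl m) - recip_of
          m)"
    using dist_approx[OF w dist n el] by metis
  note p = posnat_dbl[OF w a(2)] posnat_dbl[OF w posnat_dbl[OF w a(2)]] posnat_dbl[OF w
      posnat_dbl[OF w posnat_dbl[OF w a(2)]]]
    posnat_dbl[OF w posnat_dbl[OF w posnat_dbl[OF w posnat_dbl[OF w a(2)]]]]
  note [simp] = el el[THEN elems_sort] a(1) a(1)[THEN elems_sort] posnat_elems[OF a(2)]
      posnat_elems[OF a(2), THEN elems_sort]
  have 1: "nonneg w (recip_of (dbl (dbl m)) + recip_of n - (approx d (dbl (dbl m)) - approx d n))"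
      by (rule is_real_E[OF d w el(2) p(2) n])
  have 2: "nonneg w (recip_of (dbl (dbl (dbl (dbl m)))) + recip_of (dbl m) - (approx (\<rho> a x) (dbl
      (dbl (dbl (dbl m)))) - approx (\<rho> a x) (dbl m)))"
    by (rule is_real_E[OF metric_spaceE(1)[OF ms w a(1) el(1,1)] w _ p(4,1)]) simp
  have 3: "nonneg w (approx (\<rho> a x) (dbl (dbl (dbl (dbl m)))) + recip_of (dbl (dbl (dbl m))))"
    using rle_E[OF metric_spaceE(2)[OF ms w a(1) el(1,1)] w _ _ p(3)] by simp
  have "positive w ((approx d (dbl (dbl m)) + recip_of n - approx (\<rho> a x) (dbl m) - recip_of m) +
     ((recip_of (dbl (dbl m)) + recip_of n - (approx d (dbl (dbl m)) - approx d n)) +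
     ((recip_of (dbl (dbl (dbl (dbl m)))) + recip_of (dbl m) - (approx (\<rho> a x) (dbl (dbl (dbl (dbl
         m)))) - approx (\<rho> a x) (dbl m))) +
     ((approx (\<rho> a x) (dbl (dbl (dbl (dbl m)))) + recip_of (dbl (dbl (dbl m)))) +
      (recip_of m - recip_of (dbl m) - recip_of (dbl (dbl m)) - recip_of (dbl (dbl (dbl m))) -
          recip_of (dbl (dbl (dbl (dbl m)))))))))"
    by (intro pos_nonneg_add nonneg_add w am 1 2 3 pos_nonneg recip_of_geometric a(2))
  then show ?thesis by (simp add: algebra_simps)
qed

text \<open>
  If the \<open>2N\<close>-th approximation of \<open>d\<close> is at most \<open>1/N\<close>, then \<open>d\<close> is less than \<open>2/N\<close>, and some
  point of \<open>Q\<close> is within \<open>r = 4/N\<close> of \<open>x\<close>.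
\<close>

lemma close_point:
  assumes w: "world w" and ms: "w \<Vdash> metric_space" and dist: "w \<Vdash> is_dist_Q x d"
      and d: "w \<Vdash> is_real d"
    and N: "posnat w N" and el: "x \<in> elems w Pt" "d \<in> elems w (Seq Rat)" "r \<in> elems w Rat"
    and r: "is_zero w (rat_of r - (recip_of N + recip_of N + recip_of N + recip_of N))"
        and small: "nonneg w (recip_of N - approx d (dbl N))"
  obtains a where "a \<in> elems w Pt" "w \<Vdash> a \<in>\<^sub>Q" "w \<Vdash> \<rho> a x <\<^sub>R rconst r"
proof -
  obtain a m where a: "a \<in> elems w Pt" "posnat w m" "w \<Vdash> a \<in>\<^sub>Q"
      and am: "positive w (approx d (dbl (dbl m)) + recip_of N - approx (\<rho> a x) (dbl m) - recip_of
          m)"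
    using dist_approx[OF w dist N el(1,2)] by metis
  note p = posnat_dbl[OF w a(2)] posnat_dbl[OF w posnat_dbl[OF w a(2)]] posnat_dbl[OF w
      posnat_dbl[OF w posnat_dbl[OF w a(2)]]]
    posnat_dbl[OF w posnat_dbl[OF w posnat_dbl[OF w posnat_dbl[OF w a(2)]]]]
  note [simp] = el el[THEN elems_sort] a(1) a(1)[THEN elems_sort] posnat_elems[OF a(2)]
      posnat_elems[OF a(2), THEN elems_sort]
  have 1: "nonneg w (recip_of (dbl (dbl m)) + recip_of (dbl N) - (approx d (dbl (dbl m)) - approx
      d (dbl N)))"
    by (rule is_real_E[OF d w el(2) p(2) posnat_dbl[OF w N]])
  have 2: "nonneg w (recip_of (dbl (dbl (dbl (dbl m)))) + recip_of (dbl m) - (approx (\<rho> a x) (dbl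
      (dbl (dbl (dbl m)))) - approx (\<rho> a x) (dbl m)))"
    by (rule is_real_E[OF metric_spaceE(1)[OF ms w a(1) el(1,1)] w _ p(4,1)]) simp
  have "positive w ((approx d (dbl (dbl m)) + recip_of N - approx (\<rho> a x) (dbl m) - recip_of m) +
     ((recip_of (dbl (dbl m)) + recip_of (dbl N) - (approx d (dbl (dbl m)) - approx d (dbl N))) +
     ((recip_of (dbl (dbl (dbl (dbl m)))) + recip_of (dbl m) - (approx (\<rho> a x) (dbl (dbl (dbl (dbl
         m)))) - approx (\<rho> a x) (dbl m))) +
     ((recip_of N - approx d (dbl N)) +
      ((recip_of m - recip_of (dbl m) - recip_of (dbl (dbl m)) - recip_of (dbl (dbl (dbl m))) -
          recip_of (dbl (dbl (dbl (dbl m))))) +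
      ((rat_of r - (recip_of N + recip_of N + recip_of N + recip_of N)) + ((recip_of N - recip_of
          (dbl N) - recip_of (dbl N)) + (recip_of (dbl N) + recip_of N))))))))"
    by (intro pos_nonneg_add nonneg_add w am 1 2 small pos_nonneg[OF w recip_of_geometric] a(2)
        is_zero_nonneg(1)[OF w r]
        is_zero_nonneg(1)[OF w recip_of_dbl] N pos_nonneg[OF w recip_of_pos] posnat_dbl)
  then have "positive w (rat_of r - approx (\<rho> a x) (dbl (dbl (dbl (dbl m)))) - recip_of (dbl (dbl
      (dbl m))))"
    by (simp add: algebra_simps)
  then have "w \<Vdash> \<rho> a x <\<^sub>R rconst r"
    by (intro rless_I[OF _ w _ _ p(3)]) simp_all
  then show ?thesis using that a by blast
qed

text \<open>
  Whether \<open>N\<close> witnesses \<open>d > 0\<close> is decidable, and if it does not then \<open>d\<close> is small.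
\<close>

lemma sign_test:
  assumes w: "world w" and N: "posnat w N" and el: "d \<in> elems w (Seq Rat)"
  shows "(w \<Vdash> 0\<^sub>R <\<^sub>R d) \<or> nonneg w (recip_of N - approx d (dbl N))"
proof -
  note [simp] = el el[THEN elems_sort] posnat_elems[OF N] posnat_elems[OF N, THEN elems_sort]
  have "represented w (rat_of (d \<cdot>\<^sub>Q dbl N +\<^sub>Q -\<^sub>Q recip N))" by (rule represented_rat_of[OF w]) simp
  then have "represented w (approx d (dbl N) - recip_of N)" by (simp add: recip_of_def)
  then consider "positive w (approx d (dbl N) - recip_of N)" | "nonneg w (- (approx d (dbl N) -
      recip_of N))"
    using pos_trichotomy[OF w] by blast
  then show ?thesis
  proof cases
    case 1
    then have "w \<Vdash> 0\<^sub>R <\<^sub>R d" by (intro rless_I[OF _ w _ _ N]) simp_all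
    then show ?thesis ..
  qed simp
qed

section \<open>The order of the natural numbers\<close>

lemma succ_inject:
  assumes "w \<Vdash> succ m =\<^sub>N succ n" "world w"
  shows "w \<Vdash> m =\<^sub>N n"
proof -
  have el: "m \<in> elems w Nat" "n \<in> elems w Nat" using holds_eq_elems[OF assms] by simp_all
  have "snd w \<tturnstile> succ m =\<^sub>N succ n \<^bold>\<longrightarrow> m =\<^sub>N n"
    by (rule prv_axiom2[OF axiom.succ_inject]; (intro definable_rules definable_tm_rules)?; use el
        elems_sort in simp)
  then have "snd w \<tturnstile> m =\<^sub>N n" using prv_ImpE prv_holds[OF assms] by blast
  then show ?thesis using assms(2) el by (intro holds_prv_eq)
qed

lemma nat_add_comm:
  assumes w: "world w" and m: "m \<in> elems w Nat" and n: "n \<in> elems w Nat"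
  shows "w \<Vdash> m +\<^sub>N n =\<^sub>N n +\<^sub>N m"
proof (rule holds_induct[OF w _ _ _ _ n])
  show "w \<Vdash> m +\<^sub>N 0\<^sub>N =\<^sub>N 0\<^sub>N +\<^sub>N m"
    by (rule holds_trans[OF nat_add_zero[OF w m] holds_sym[OF nat_zero_add[OF w m] w] w])
  fix w' n assume *: "w \<sqsubseteq> w'" "n \<in> elems w' Nat" "w' \<Vdash> m +\<^sub>N n =\<^sub>N n +\<^sub>N m"
  note w' = ext_world[OF *(1)] and m' = elems_mono[OF m *(1)]
  have "w' \<Vdash> succ (m +\<^sub>N n) =\<^sub>N succ (n +\<^sub>N m)" by (rule holds_cong1[OF w' *(3)]) simp_all
  from holds_trans[OF holds_trans[OF nat_add_succ[OF w' m' *(2)] this w'] holds_sym[OF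
      nat_succ_add[OF w' *(2) m'] w'] w']
  show "w' \<Vdash> m +\<^sub>N succ n =\<^sub>N succ n +\<^sub>N m" .
qed (intro definable_intros; use m in simp)+

lemma nle_add1: "world w \<Longrightarrow> m \<in> elems w Nat \<Longrightarrow> n \<in> elems w Nat \<Longrightarrow> w \<Vdash> m \<le>\<^sub>N m +\<^sub>N n"
  by (rule nle_I[where k = n]) (simp_all add: holds_refl)

lemma nle_add2: "world w \<Longrightarrow> m \<in> elems w Nat \<Longrightarrow> n \<in> elems w Nat \<Longrightarrow> w \<Vdash> n \<le>\<^sub>N m +\<^sub>N n"
  by (rule nle_I[where k = m]) (simp_all add: nat_add_comm)

lemma nle_refl: "world w \<Longrightarrow> n \<in> elems w Nat \<Longrightarrow> w \<Vdash> n \<le>\<^sub>N n"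
  by (rule nle_I[where k = "0\<^sub>N"]) (simp_all add: nat_add_zero)

lemma nle_subst:
  assumes w: "world w" and "w \<Vdash> m \<le>\<^sub>N n" "w \<Vdash> m =\<^sub>N m'" "w \<Vdash> n =\<^sub>N n'"
  shows "w \<Vdash> m' \<le>\<^sub>N n'"
proof -
  note el = holds_eq_elems[OF assms(3) w] holds_eq_elems[OF assms(4) w]
  have "w \<Vdash> m' \<le>\<^sub>N n"
    by (rule holds_subst[OF assms(3), where F = "\<lambda>m. m \<le>\<^sub>N n",
        OF assms(2) _ w]) (intro definable_intros; use el in simp)
  then show ?thesis
    by (rule holds_subst[OF assms(4), where F = "\<lambda>n. m' \<le>\<^sub>N n",
        OF _ _ w]) (intro definable_intros; use el in simp)
qed

lemma nle_trans:
  assumes w: "world w" and le: "w \<Vdash> k \<le>\<^sub>N m" "w \<Vdash> m \<le>\<^sub>N n"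
    and el: "k \<in> elems w Nat" "m \<in> elems w Nat" "n \<in> elems w Nat"
  shows "w \<Vdash> k \<le>\<^sub>N n"
proof -
  obtain i where i: "i \<in> elems w Nat" "w \<Vdash> k +\<^sub>N i =\<^sub>N m" by (rule nle_E[OF le(1) w el(1,2)])
  obtain j where j: "j \<in> elems w Nat" "w \<Vdash> m +\<^sub>N j =\<^sub>N n" by (rule nle_E[OF le(2) w el(2,3)])
  have "w \<Vdash> (k +\<^sub>N i) +\<^sub>N j =\<^sub>N m +\<^sub>N j"
    by (rule holds_cong2[OF w i(2) holds_refl[OF w j(1)]]) simp_all
  then have "w \<Vdash> k +\<^sub>N (i +\<^sub>N j) =\<^sub>N n"
    using holds_trans[OF holds_trans[OF holds_sym[OF nat_add_assoc[OF w el(1) i(1) j(1)] w] _ w]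
        j(2) w] by blast
  then show ?thesis using i j el w by (intro nle_I[where k = "i +\<^sub>N j"]) simp_all
qed

lemma succ_nle_succ:
  assumes w: "world w" and el: "m \<in> elems w Nat" "n \<in> elems w Nat"
  shows "(w \<Vdash> succ m \<le>\<^sub>N succ n) \<longleftrightarrow> (w \<Vdash> m \<le>\<^sub>N n)"
proof
  assume "w \<Vdash> succ m \<le>\<^sub>N succ n"
  then obtain k where k: "k \<in> elems w Nat" "w \<Vdash> succ m +\<^sub>N k =\<^sub>N succ n"
    by (rule nle_E[OF _ w]) (use el in simp_all)
  have "w \<Vdash> m +\<^sub>N k =\<^sub>N n"
    by (rule succ_inject[OF holds_trans[OF holds_sym[OF nat_succ_add[OF w el(1) k(1)] w] k(2) w] w])
  then show "w \<Vdash> m \<le>\<^sub>N n" using k el w by (intro nle_I[where k = k]) simp_all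
next
  assume "w \<Vdash> m \<le>\<^sub>N n"
  then obtain k where k: "k \<in> elems w Nat" "w \<Vdash> m +\<^sub>N k =\<^sub>N n" by (rule nle_E[OF _ w el])
  have "w \<Vdash> succ (m +\<^sub>N k) =\<^sub>N succ n" by (rule holds_cong1[OF w k(2)]) simp_all
  then show "w \<Vdash> succ m \<le>\<^sub>N succ n"
    using k el w holds_trans[OF nat_succ_add[OF w el(1) k(1)] _ w]
        by (intro nle_I[where k = k]) simp_all
qed

lemma not_succ_nle_zero:
  assumes w: "world w" and el: "m \<in> elems w Nat" and le: "w \<Vdash> succ m \<le>\<^sub>N 0\<^sub>N"
  shows P
proof -
  obtain k where k: "k \<in> elems w Nat" "w \<Vdash> succ m +\<^sub>N k =\<^sub>N 0\<^sub>N"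
    by (rule nle_E[OF le w]) (use el in simp_all)
  show P by (rule succ_not_zero[OF holds_trans[OF holds_sym[OF nat_succ_add[OF w el k(1)] w] k(2)
      w] w])
qed

lemma nle_cases:
  assumes w: "world w" and le: "w \<Vdash> m \<le>\<^sub>N n" and el: "m \<in> elems w Nat" "n \<in> elems w Nat"
  obtains "w \<Vdash> m =\<^sub>N n" | "w \<Vdash> succ m \<le>\<^sub>N n"
proof -
  obtain k where k: "k \<in> elems w Nat" "w \<Vdash> m +\<^sub>N k =\<^sub>N n" by (rule nle_E[OF le w el])
  show ?thesis
  proof (cases rule: nat_cases[OF w k(1)])
    case 1
    have "w \<Vdash> m +\<^sub>N k =\<^sub>N m +\<^sub>N 0\<^sub>N" by (rule holds_cong2[OF w holds_refl[OF w el(1)] 1]) simp_all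
    then have "w \<Vdash> m =\<^sub>N n"
      using holds_sym[OF holds_trans[OF _ nat_add_zero[OF w el(1)] w] w] holds_trans[OF _ k(2) w]
          by blast
    then show ?thesis by (rule that)
  next
    case (2 i)
    have "w \<Vdash> m +\<^sub>N k =\<^sub>N m +\<^sub>N succ i" by (rule holds_cong2[OF w holds_refl[OF w el(1)] 2(2)])
        simp_all
    from holds_trans[OF holds_trans[OF nat_succ_add[OF w el(1) 2(1)] holds_sym[OF holds_trans[OF
        this nat_add_succ[OF w el(1) 2(1)] w] w] w] k(2) w]
    have "w \<Vdash> succ m \<le>\<^sub>N n" using el 2 w by (intro nle_I[where k = i]) simp_all
    then show ?thesis by (rule that)
  qed
qed

lemma nat_trichotomy:
  assumes w: "world w" and m: "m \<in> elems w Nat" and n: "n \<in> elems w Nat"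
  obtains "w \<Vdash> m =\<^sub>N n" | "w \<Vdash> succ m \<le>\<^sub>N n" | "w \<Vdash> succ n \<le>\<^sub>N m"
proof -
  \<comment> \<open>Equality is split off the first alternative afterwards.\<close>
  have "w \<Vdash> m \<le>\<^sub>N n \<^bold>\<or> succ n \<le>\<^sub>N m"
  proof (rule holds_induct[OF w _ _ _ _ n])
    have ok: "sentence w (m \<le>\<^sub>N 0\<^sub>N)" "sentence w (1\<^sub>N \<le>\<^sub>N m)" unfolding sentence_iff
        by (intro definable_intros; use m in simp)+
    show "w \<Vdash> m \<le>\<^sub>N 0\<^sub>N \<^bold>\<or> 1\<^sub>N \<le>\<^sub>N m"
    proof (cases rule: nat_cases[OF w m])
      case 1
      have "w \<Vdash> m \<le>\<^sub>N 0\<^sub>N" using nle_subst[OF w nle_refl[OF w m] holds_refl[OF w m] 1] .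
      then show ?thesis using w ok by (intro holds_OrI1)
    next
      case 2
      have "w \<Vdash> 1\<^sub>N \<le>\<^sub>N m" using posnatI[OF w 2] by (simp add: posnat_def)
      then show ?thesis using w ok by (intro holds_OrI2)
    qed
    fix w' n assume *: "w \<sqsubseteq> w'" "n \<in> elems w' Nat" "w' \<Vdash> m \<le>\<^sub>N n \<^bold>\<or> succ n \<le>\<^sub>N m"
    note w' = ext_world[OF *(1)] and m' = elems_mono[OF m *(1)]
    have ok: "sentence w' (m \<le>\<^sub>N succ n)" "sentence w' (succ (succ n) \<le>\<^sub>N m)"
      unfolding sentence_iff by (intro definable_intros; use m' * in simp)+
    have n': "w' \<Vdash> n \<le>\<^sub>N succ n"
      using * w' holds_trans[OF nat_add_succ[OF w'] holds_cong1[OF w' nat_add_zero[OF w']] w']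
          by (intro nle_I[where k = "1\<^sub>N"]) simp_all
    from holds_OrE[OF *(3) w'] show "w' \<Vdash> m \<le>\<^sub>N succ n \<^bold>\<or> succ (succ n) \<le>\<^sub>N m"
    proof
      assume "w' \<Vdash> m \<le>\<^sub>N n"
      then have "w' \<Vdash> m \<le>\<^sub>N succ n" by (rule nle_trans[OF w' _ n']) (use m' * in simp_all)
      then show ?thesis using w' ok by (intro holds_OrI1)
    next
      assume le: "w' \<Vdash> succ n \<le>\<^sub>N m"
      have sn: "succ n \<in> elems w' Nat" using * by simp
      show ?thesis
      proof (cases rule: nle_cases[OF w' le sn m'])
        case 1
        have "w' \<Vdash> m \<le>\<^sub>N succ n"
          by (rule nle_subst[OF w' nle_refl[OF w' m'] holds_refl[OF w' m'] holds_sym[OF 1 w']])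
        then show ?thesis using w' ok by (intro holds_OrI1)
      next
        case 2
        then show ?thesis using w' ok by (intro holds_OrI2)
      qed
    qed
  qed (intro definable_intros; use m in simp)+
  then have "(w \<Vdash> m \<le>\<^sub>N n) \<or> (w \<Vdash> succ n \<le>\<^sub>N m)" using holds_OrE w by blast
  then show ?thesis using that nle_cases[OF w _ m n] by blast
qed

section \<open>Binary sequences and choice for positive indices\<close>

lemma zero_not_one: "w \<Vdash> t =\<^sub>N 0\<^sub>N \<Longrightarrow> w \<Vdash> t =\<^sub>N 1\<^sub>N \<Longrightarrow> world w \<Longrightarrow> P"
  using succ_not_zero[OF holds_trans[OF holds_sym]] by blast

abbreviation zero_at :: "tm \<Rightarrow> tm \<Rightarrow> fm" where
  "zero_at l n \<equiv> l \<cdot>\<^sub>N n =\<^sub>N 0\<^sub>N"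

abbreviation one_at :: "tm \<Rightarrow> tm \<Rightarrow> fm" where
  "one_at l n \<equiv> l \<cdot>\<^sub>N n =\<^sub>N 1\<^sub>N"

lemma binaryE:
  assumes "w \<Vdash> binary l" "world w" "l \<in> elems w (Seq Nat)" "posnat w n"
  obtains "w \<Vdash> zero_at l n" | "w \<Vdash> one_at l n"
proof -
  have "w \<Vdash> zero_at l n \<^bold>\<or> one_at l n"
    by (rule holds_Forall_posE[OF assms(1)[unfolded binary_def] _ assms(4,2)])
      (intro definable_intros; use assms in \<open>simp add: posnat_elems\<close>)
  then show ?thesis using holds_OrE assms(2) that by blast
qed

lemma seq_cong:
  assumes "world w" "f \<in> elems w (Seq s)" "w \<Vdash> m =\<^sub>N n"
  shows "w \<Vdash> f \<cdot>\<^bsub>s\<^esub> m =\<^bsub>s\<^esub> f \<cdot>\<^bsub>s\<^esub> n"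
  by (rule holds_cong2[OF assms(1) holds_refl[OF assms(1) assms(2)] assms(3)]) simp_all

text \<open>
  Fixing a variable of a definable family leaves a definable family, over any world that contains
  the value.
\<close>

lemma definable_inst:
  assumes F: "definable (fst w) [s, r] (\<lambda>ts. F (hd (tl ts)) (hd ts))" and w': "w \<sqsubseteq> w'"
      and n: "n \<in> elems w' r"
  shows "definable (fst w') [s] (\<lambda>ts. F n (hd ts))"
proof -
  obtain B where B: "wf [s, r] B" "names B \<subseteq> fst w" "\<And>ts. env [s, r] ts \<Longrightarrow>
      F (hd (tl ts)) (hd ts) = sub 0 ts B"
    using F by (auto simp: definable_def)
  let ?B = "sub (Suc 0) [n] B"
  have wf: "wf [s] ?B" using wf_sub[of "[s]" "[r]" B "[n]"] B(1) elems_sort[OF n] by simp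
  have "names ?B \<subseteq> fst w'"
    using names_opn[of "Suc 0" n B] opn_eq_sub[OF B(1), of "Suc 0" n] B(2) n w'
        by (auto simp: elems_def ext_def)
  moreover have "F n t = sub 0 [t] ?B" if "closed t" for t
    using B(3)[of "[t, n]"] that elems_closed[OF n] opn_sub[OF B(1),
        of 0 "[n]" t] opn_eq_sub[OF wf, of 0 t] by simp
  ultimately show ?thesis
    unfolding definable_def by (intro exI[of _ ?B]) (auto simp: wf elim!: env_ConsE)
qed

text \<open>
  Countable choice speaks about all natural numbers, including zero, which is not an index of a
  sequence.  There the arbitrary element \<open>t0\<close> is taken.
\<close>

lemma holds_choice_pos:
  assumes w: "world w" and t0: "t0 \<in> elems w s"
    and F: "definable (fst w) [Nat, s] (\<lambda>ts. F (hd ts) (hd (tl ts)))" "definable (fst w) [s,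
        Nat] (\<lambda>ts. F (hd (tl ts)) (hd ts))"
      "definable (fst w) [Nat, Seq s] (\<lambda>ts. F (hd ts) (hd (tl ts) \<cdot>\<^bsub>s\<^esub> hd ts))"
    and total: "\<And>w' n. w \<sqsubseteq> w' \<Longrightarrow> posnat w' n \<Longrightarrow> \<exists>y\<in>elems w' s. w' \<Vdash> F n y"
  obtains f where "f \<in> elems w (Seq s)" "w \<Vdash> (\<^bold>\<forall>\<^sup>+n. F n (f \<cdot>\<^bsub>s\<^esub> n))"
proof (rule holds_choice[OF w, where s = s and F = "\<lambda>n y. 1\<^sub>N \<le>\<^sub>N n \<^bold>\<longrightarrow> F n y"])
  show "definable (fst w) [Nat, s] (\<lambda>ts. 1\<^sub>N \<le>\<^sub>N hd ts \<^bold>\<longrightarrow> F (hd ts) (hd (tl ts)))"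
    by (intro definable_Imp definable_nle definable_tm_rules F) simp_all
  have F2: "definable (fst w) [s, Nat] (\<lambda>ts. 1\<^sub>N \<le>\<^sub>N hd (tl ts) \<^bold>\<longrightarrow> F (hd (tl ts)) (hd ts))"
    by (intro definable_Imp definable_nle definable_tm_rules F) simp_all
  then show "definable (fst w) [Nat] (\<lambda>ts. \<^bold>\<exists>y:s. 1\<^sub>N \<le>\<^sub>N hd ts \<^bold>\<longrightarrow> F (hd ts) y)"
      by (intro definable_Exists)
  show "definable (fst w) [Seq s] (\<lambda>ts. \<^bold>\<forall>n:Nat. 1\<^sub>N \<le>\<^sub>N n \<^bold>\<longrightarrow> F n (hd ts \<cdot>\<^bsub>s\<^esub> n))"
    by (intro definable_Forall definable_Imp definable_nle definable_tm_rules F) simp_all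
  note result = that
  show thesis if "f \<in> elems w (Seq s)" "w \<Vdash> (\<^bold>\<forall>n:Nat. 1\<^sub>N \<le>\<^sub>N n \<^bold>\<longrightarrow> F n (f \<cdot>\<^bsub>s\<^esub> n))" for f
    using that(2) by (intro result[OF that(1)]) (simp add: Forall_pos_def)
  fix w' n assume w': "w \<sqsubseteq> w'" and n: "n \<in> elems w' Nat"
  note ww = ext_world[OF w'] and d = definable_inst[OF F2 w' n]
  have "\<exists>y\<in>elems w' s. w' \<Vdash> 1\<^sub>N \<le>\<^sub>N n \<^bold>\<longrightarrow> F n y"
  proof (cases rule: nat_cases[OF ww n])
    case 1
    have "w' \<Vdash> 1\<^sub>N \<le>\<^sub>N n \<^bold>\<longrightarrow> F n t0"
    proof (rule holds_ImpI[OF ww sentence_definable[OF d ext_refl[OF ww] elems_mono[OF t0 w']]])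
      fix w'' assume w'': "w' \<sqsubseteq> w''" and "w'' \<Vdash> 1\<^sub>N \<le>\<^sub>N n"
      then have "w'' \<Vdash> 1\<^sub>N \<le>\<^sub>N 0\<^sub>N"
        using nle_subst[OF ext_world[OF w''] _ holds_refl[OF ext_world[OF w'']] holds_mono[OF 1
            w'']] by simp
      then show "w'' \<Vdash> F n t0" by (rule not_succ_nle_zero[OF ext_world[OF w''], rotated]) simp
    qed
    then show ?thesis using elems_mono[OF t0 w'] by blast
  next
    case (2 k)
    then obtain y where y: "y \<in> elems w' s" "w' \<Vdash> F n y" using total[OF w'] posnatI[OF ww] by blast
    have "w' \<Vdash> 1\<^sub>N \<le>\<^sub>N n \<^bold>\<longrightarrow> F n y"
      by (rule holds_ImpI[OF ww sentence_definable[OF d ext_refl[OF ww] y(1)]]) (rule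
          holds_mono[OF y(2)])
    then show ?thesis using y(1) by blast
  qed
  then show "w' \<Vdash> (\<^bold>\<exists>y:s. 1\<^sub>N \<le>\<^sub>N n \<^bold>\<longrightarrow> F n y)" using holds_ExistsI[OF _ _ d ww] by blast
qed

lemma holds_Forall_pos_ImpI:
  assumes w: "world w" and ok: "definable (fst w) [Nat] (\<lambda>ts. F (hd ts) \<^bold>\<longrightarrow> G (hd ts))"
    and *: "\<And>w' n. w \<sqsubseteq> w' \<Longrightarrow> posnat w' n \<Longrightarrow> w' \<Vdash> F n \<Longrightarrow> w' \<Vdash> G n"
  shows "w \<Vdash> (\<^bold>\<forall>\<^sup>+n. F n \<^bold>\<longrightarrow> G n)"
proof (rule holds_Forall_posI[OF w ok])
  fix w' n assume n: "w \<sqsubseteq> w'" "posnat w' n"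
  show "w' \<Vdash> F n \<^bold>\<longrightarrow> G n"
    by (rule holds_ImpI[OF ext_world[OF n(1)] sentence_definable[OF ok n(1) posnat_elems[OF n(2)]]])
      (use * ext_trans[OF n(1)] posnat_mono[OF n(2)] in blast)
qed

section \<open>Searching a binary sequence\<close>

text \<open>
  The index \<open>n\<close> itself is excluded, so that the flags below start with the value zero.
\<close>

definition none_before :: "tm \<Rightarrow> tm \<Rightarrow> fm" where
  "none_before a n = (\<^bold>\<forall>\<^sup>+k. succ k \<le>\<^sub>N n \<^bold>\<longrightarrow> zero_at a k)"

definition some_before :: "tm \<Rightarrow> tm \<Rightarrow> fm" where
  "some_before a n = (\<^bold>\<exists>\<^sup>+k. succ k \<le>\<^sub>N n \<^bold>\<and> one_at a k)"

lemma definable_none_before: "definable_tm N \<Delta> f (Seq Nat) \<Longrightarrow> definable_tm N \<Delta> g Nat \<Longrightarrow>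
    definable N \<Delta> (\<lambda>ts. none_before (f ts) (g ts))"
  unfolding none_before_def by (intro definable_rules definable_tm_rules) auto

lemma definable_some_before: "definable_tm N \<Delta> f (Seq Nat) \<Longrightarrow> definable_tm N \<Delta> g Nat \<Longrightarrow>
    definable N \<Delta> (\<lambda>ts. some_before (f ts) (g ts))"
  unfolding some_before_def by (intro definable_rules definable_tm_rules) auto

lemmas definable_search = definable_none_before definable_some_before definable_intros

lemma none_beforeE:
  assumes "w \<Vdash> none_before a n" "world w" "a \<in> elems w (Seq Nat)" "n \<in> elems w Nat" "posnat w k"
      "w \<Vdash> succ k \<le>\<^sub>N n"
  shows "w \<Vdash> zero_at a k"
proof -
  have "w \<Vdash> succ k \<le>\<^sub>N n \<^bold>\<longrightarrow> zero_at a k"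
    by (rule holds_Forall_posE[OF assms(1)[unfolded none_before_def] _ assms(5,2)]) (intro
        definable_intros; use assms in simp)
  then show ?thesis using assms holds_ImpE by blast
qed

lemma none_beforeI:
  assumes "world w" "a \<in> elems w (Seq Nat)" "n \<in> elems w Nat"
    and "\<And>w' k. w \<sqsubseteq> w' \<Longrightarrow> posnat w' k \<Longrightarrow> w' \<Vdash> succ k \<le>\<^sub>N n \<Longrightarrow> w' \<Vdash> zero_at a k"
  shows "w \<Vdash> none_before a n"
  unfolding none_before_def
  by (rule holds_Forall_pos_ImpI[OF assms(1) _ assms(4)],
      intro definable_intros) (use assms(2,3) in simp_all)

lemma some_beforeE:
  assumes "w \<Vdash> some_before a n" "world w" "a \<in> elems w (Seq Nat)" "n \<in> elems w Nat"
  obtains k where "posnat w k" "w \<Vdash> succ k \<le>\<^sub>N n" "w \<Vdash> one_at a k"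
proof -
  have "definable (fst w) [Nat] (\<lambda>ts. succ (hd ts) \<le>\<^sub>N n \<^bold>\<and> one_at a (hd ts))"
    by (intro definable_intros; use assms in simp)
  from holds_Exists_posE[OF assms(1)[unfolded some_before_def] this assms(2)]
  obtain k where "posnat w k" "w \<Vdash> succ k \<le>\<^sub>N n \<^bold>\<and> one_at a k" .
  then show ?thesis using that assms(2) by (auto simp: holds_And)
qed

lemma some_beforeI:
  assumes "world w" "a \<in> elems w (Seq Nat)" "n \<in> elems w Nat"
    and "posnat w k" "w \<Vdash> succ k \<le>\<^sub>N n" "w \<Vdash> one_at a k"
  shows "w \<Vdash> some_before a n"
proof -
  have "definable (fst w) [Nat] (\<lambda>ts. succ (hd ts) \<le>\<^sub>N n \<^bold>\<and> one_at a (hd ts))"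
    by (intro definable_intros; use assms in simp)
  from holds_Exists_posI[OF _ assms(4) this assms(1)] show ?thesis
    using assms by (simp add: some_before_def holds_And)
qed

lemma none_or_some_before:
  assumes w: "world w" and a: "a \<in> elems w (Seq Nat)" and bin: "w \<Vdash> binary a"
      and n: "n \<in> elems w Nat"
  shows "w \<Vdash> none_before a n \<^bold>\<or> some_before a n"
proof (rule holds_induct[OF w _ _ _ _ n])
  have ok: "sentence w (some_before a 0\<^sub>N)" unfolding sentence_iff
      by (intro definable_search; use a in simp)
  have "w \<Vdash> none_before a 0\<^sub>N"
    by (rule none_beforeI[OF w a]) (simp, erule not_succ_nle_zero[OF ext_world posnat_elems])
  then show "w \<Vdash> none_before a 0\<^sub>N \<^bold>\<or> some_before a 0\<^sub>N" using w ok by (intro holds_OrI1)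
  fix w' n assume ext: "w \<sqsubseteq> w'" and n: "n \<in> elems w' Nat"
      and IH: "w' \<Vdash> none_before a n \<^bold>\<or> some_before a n"
  note w' = ext_world[OF ext] and a' = elems_mono[OF a ext]
  have sn: "succ n \<in> elems w' Nat" using n by simp
  have ok: "sentence w' (none_before a (succ n))" "sentence w' (some_before a (succ n))"
    unfolding sentence_iff by (intro definable_search; use a' n in simp)+
  from holds_OrE[OF IH w'] show "w' \<Vdash> none_before a (succ n) \<^bold>\<or> some_before a (succ n)"
  proof
    assume "w' \<Vdash> some_before a n"
    then obtain k where k: "posnat w' k" "w' \<Vdash> succ k \<le>\<^sub>N n" "w' \<Vdash> one_at a k"
      by (rule some_beforeE[OF _ w' a' n])
    have "w' \<Vdash> n \<le>\<^sub>N succ n"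
      using n w' holds_trans[OF nat_add_succ[OF w'] holds_cong1[OF w' nat_add_zero[OF w']] w']
          by (intro nle_I[where k = "1\<^sub>N"]) simp_all
    then have "w' \<Vdash> succ k \<le>\<^sub>N succ n" by (rule nle_trans[OF w' k(2)]) (use k n in \<open>simp_all add:
        posnat_elems\<close>)
    then show ?thesis using some_beforeI[OF w' a' sn k(1) _ k(3)] w' ok by (intro holds_OrI2)
  next
    assume none: "w' \<Vdash> none_before a n"
    have step: "w' \<Vdash> none_before a (succ n)"
      if an: "posnat w' n \<Longrightarrow> w' \<Vdash> zero_at a n" and n_pos: "posnat w' n \<or> (w' \<Vdash> n =\<^sub>N 0\<^sub>N)"
    proof (rule none_beforeI[OF w' a' sn])
      fix v k assume v: "w' \<sqsubseteq> v" and k: "posnat v k" "v \<Vdash> succ k \<le>\<^sub>N succ n"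
      note ww = ext_world[OF v] and kel = posnat_elems[OF k(1)] and nel = elems_mono[OF n v]
          and av = elems_mono[OF a' v]
      have le: "v \<Vdash> k \<le>\<^sub>N n" using k(2) succ_nle_succ[OF ww kel nel] by simp
      show "v \<Vdash> zero_at a k"
      proof (cases rule: nle_cases[OF ww le kel nel])
        case 1
        from n_pos have "posnat w' n"
        proof
          assume "w' \<Vdash> n =\<^sub>N 0\<^sub>N"
          then have "v \<Vdash> n =\<^sub>N 0\<^sub>N" using v by (rule holds_mono)
          with 1 have "v \<Vdash> k =\<^sub>N 0\<^sub>N" using ww by (rule holds_trans)
          moreover obtain i where "i \<in> elems v Nat" "v \<Vdash> k =\<^sub>N succ i" by (rule posnatE[OF k(1) ww])
          ultimately show ?thesis using succ_not_zero[OF holds_trans[OF holds_sym] ww] ww by blast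
        qed
        from holds_trans[OF seq_cong[OF ww av 1] holds_mono[OF an[OF this] v] ww] show ?thesis .
      next
        case 2
        show ?thesis by (rule none_beforeE[OF holds_mono[OF none v] ww av nel k(1) 2])
      qed
    qed
    show ?thesis
    proof (cases rule: nat_cases[OF w' n])
      case 1
      have "\<not> posnat w' n"
      proof
        assume "posnat w' n"
        then obtain i where "w' \<Vdash> n =\<^sub>N succ i" by (rule posnatE[OF _ w'])
        then show False using succ_not_zero[OF holds_trans[OF holds_sym 1] w'] w' by blast
      qed
      then have "w' \<Vdash> none_before a (succ n)" using step 1 by blast
      then show ?thesis using w' ok by (intro holds_OrI1)
    next
      case (2 i)
      note p = posnatI[OF w' 2]
      show ?thesis
      proof (cases rule: binaryE[OF holds_mono[OF bin ext] w' a' p])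
        case 1
        then have "w' \<Vdash> none_before a (succ n)" using step p by blast
        then show ?thesis using w' ok by (intro holds_OrI1)
      next
        case 2
        then have "w' \<Vdash> some_before a (succ n)" using some_beforeI[OF w' a' sn p nle_refl[OF w'
            sn]] by blast
        then show ?thesis using w' ok by (intro holds_OrI2)
      qed
    qed
  qed
qed (intro definable_search; use a in simp)+

text \<open>
  \<open>y\<close> is the value at \<open>n\<close> of the increasing flag that turns from zero to one after the first one
  in \<open>a\<close>.
\<close>

definition search_flag :: "tm \<Rightarrow> tm \<Rightarrow> tm \<Rightarrow> fm" where
  "search_flag a n y = ((y =\<^sub>N 0\<^sub>N \<^bold>\<and> none_before a n) \<^bold>\<or> (y =\<^sub>N 1\<^sub>N \<^bold>\<and> some_before a n))"

lemma search_flagE: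
  assumes "w \<Vdash> search_flag a n y" "world w"
  obtains "w \<Vdash> y =\<^sub>N 0\<^sub>N" "w \<Vdash> none_before a n" | "w \<Vdash> y =\<^sub>N 1\<^sub>N" "w \<Vdash> some_before a n"
  using assms holds_OrE[of w] unfolding search_flag_def by (metis holds_And)

lemma definable_search_flag:
  "definable_tm N \<Delta> f (Seq Nat) \<Longrightarrow> definable_tm N \<Delta> g Nat \<Longrightarrow> definable_tm N \<Delta> h Nat \<Longrightarrow>
      definable N \<Delta> (\<lambda>ts. search_flag (f ts) (g ts) (h ts))"
  unfolding search_flag_def by (intro definable_none_before definable_some_before definable_rules
      definable_tm_rules) auto

text \<open>
  The flags come from countable choice.  They are increasing because a one that is found before
  \<open>m\<close> is also found before every \<open>n \<ge> m\<close>.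
\<close>

lemma increasing_flags:
  assumes w: "world w" and a: "a \<in> elems w (Seq Nat)" and bin: "w \<Vdash> binary a"
  obtains l where "l \<in> elems w (Seq Nat)" "w \<Vdash> binary l" "w \<Vdash> increasing l" "w \<Vdash> zero_at l 1\<^sub>N"
    "\<And>w' n. w \<sqsubseteq> w' \<Longrightarrow> posnat w' n \<Longrightarrow> w' \<Vdash> search_flag a n (l \<cdot>\<^sub>N n)"
proof -
  have "\<exists>y\<in>elems v Nat. v \<Vdash> search_flag a n y" if v: "w \<sqsubseteq> v" and n: "posnat v n" for v n
  proof -
    note ww = ext_world[OF v] and av = elems_mono[OF a v] and nel = posnat_elems[OF n]
    have ok: "sentence v (0\<^sub>N =\<^sub>N 0\<^sub>N \<^bold>\<and> none_before a n)" "sentence v (1\<^sub>N =\<^sub>N 1\<^sub>N \<^bold>\<and> some_before a n)"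
      "sentence v (1\<^sub>N =\<^sub>N 0\<^sub>N \<^bold>\<and> none_before a n)" "sentence v (0\<^sub>N =\<^sub>N 1\<^sub>N \<^bold>\<and> some_before a n)"
      unfolding sentence_iff by (intro definable_search; use av nel in simp)+
    from holds_OrE[OF none_or_some_before[OF ww av holds_mono[OF bin v] nel] ww] show ?thesis
    proof
      assume "v \<Vdash> none_before a n"
      then have "v \<Vdash> search_flag a n 0\<^sub>N"
        unfolding search_flag_def using ww ok by (intro holds_OrI1) (simp_all add: holds_And
            holds_refl)
      then show ?thesis by (intro bexI[of _ "0\<^sub>N"]) simp_all
    next
      assume "v \<Vdash> some_before a n"
      then have "v \<Vdash> search_flag a n 1\<^sub>N"
        unfolding search_flag_def using ww ok by (intro holds_OrI2) (simp_all add: holds_And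
            holds_refl)
      then show ?thesis by (intro bexI[of _ "1\<^sub>N"]) simp_all
    qed
  qed
  then obtain l where l: "l \<in> elems w (Seq Nat)" "w \<Vdash> (\<^bold>\<forall>\<^sup>+n. search_flag a n (l \<cdot>\<^sub>N n))"
    by (rule holds_choice_pos[OF w, of "0\<^sub>N" Nat "search_flag a",
        rotated 4]) (intro definable_search_flag definable_tm_elems definable_tm_rules | simp add:
        a)+
  have fl: "v \<Vdash> search_flag a n (l \<cdot>\<^sub>N n)" if v: "w \<sqsubseteq> v" and n: "posnat v n" for v n
    by (rule holds_Forall_posE[OF holds_mono[OF l(2) v] _ n ext_world[OF v]])
      (intro definable_search_flag definable_tm_elems definable_tm_rules; use elems_mono[OF a v]
          elems_mono[OF l(1) v] in simp)
  show ?thesis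
  proof (rule that[OF l(1) _ _ _ fl])
    show "w \<Vdash> binary l" unfolding binary_def
    proof (rule holds_Forall_posI[OF w])
      show d: "definable (fst w) [Nat] (\<lambda>ts. zero_at l (hd ts) \<^bold>\<or> one_at l (hd ts))"
        by (intro definable_intros; use l in simp)
      fix v n assume v: "w \<sqsubseteq> v" and n: "posnat v n"
      have ok: "sentence v (zero_at l n)" "sentence v (one_at l n)"
        using sentence_definable[OF d v posnat_elems[OF n]] by (auto simp: sentence_def)
      show "v \<Vdash> zero_at l n \<^bold>\<or> one_at l n"
        using search_flagE[OF fl[OF v n] ext_world[OF v]] holds_OrI1[OF _ ext_world[OF v] ok(2)]
            holds_OrI2[OF _ ext_world[OF v] ok(1)] by metis
    qed
    show "w \<Vdash> zero_at l 1\<^sub>N"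
    proof (cases rule: search_flagE[OF fl[OF ext_refl[OF w] posnat_one[OF w]] w])
      case 2
      obtain k where k: "posnat w k" "w \<Vdash> succ k \<le>\<^sub>N 1\<^sub>N" by (rule some_beforeE[OF 2(2) w a]) simp_all
      obtain i where i: "i \<in> elems w Nat" "w \<Vdash> k =\<^sub>N succ i" by (rule posnatE[OF k(1) w])
      have "w \<Vdash> k \<le>\<^sub>N 0\<^sub>N" using k succ_nle_succ[OF w posnat_elems[OF k(1)]] by simp
      then have "w \<Vdash> succ i \<le>\<^sub>N 0\<^sub>N" using nle_subst[OF w _ i(2) holds_refl[OF w]] by simp
      then show ?thesis by (rule not_succ_nle_zero[OF w i(1)])
    qed
    show "w \<Vdash> increasing l" unfolding increasing_def
    proof (rule holds_Forall_posI[OF w])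
      show "definable (fst w) [Nat] (\<lambda>ts. \<^bold>\<forall>\<^sup>+n. hd ts \<le>\<^sub>N n \<^bold>\<longrightarrow> l \<cdot>\<^sub>N hd ts \<le>\<^sub>N l \<cdot>\<^sub>N n)"
        by (intro definable_intros; use l in simp)
      fix v' m assume v': "w \<sqsubseteq> v'" and m': "posnat v' m"
      show "v' \<Vdash> (\<^bold>\<forall>\<^sup>+n. m \<le>\<^sub>N n \<^bold>\<longrightarrow> l \<cdot>\<^sub>N m \<le>\<^sub>N l \<cdot>\<^sub>N n)"
      proof (rule holds_Forall_pos_ImpI[OF ext_world[OF v']])
        show "definable (fst v') [Nat] (\<lambda>ts. m \<le>\<^sub>N hd ts \<^bold>\<longrightarrow> l \<cdot>\<^sub>N m \<le>\<^sub>N l \<cdot>\<^sub>N hd ts)"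
          by (intro definable_intros; use elems_mono[OF l(1) v'] posnat_elems[OF m'] in simp)
        fix v n assume "v' \<sqsubseteq> v" and n: "posnat v n" and le: "v \<Vdash> m \<le>\<^sub>N n"
        have v: "w \<sqsubseteq> v" and m: "posnat v m" using v' m' \<open>v' \<sqsubseteq> v\<close>
            by (auto intro: ext_trans posnat_mono)
        note vv = ext_world[OF v] and av = elems_mono[OF a v] and lv = elems_mono[OF l(1) v]
        note el = posnat_elems[OF m] posnat_elems[OF n]
        have lel: "l \<cdot>\<^sub>N m \<in> elems v Nat" "l \<cdot>\<^sub>N n \<in> elems v Nat" using el lv by simp_all
        show "v \<Vdash> l \<cdot>\<^sub>N m \<le>\<^sub>N l \<cdot>\<^sub>N n"
        proof (cases rule: search_flagE[OF fl[OF v m] vv])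
          case 1
          have "v \<Vdash> 0\<^sub>N \<le>\<^sub>N l \<cdot>\<^sub>N n"
            using nat_zero_add[OF vv lel(2)] lel vv by (intro nle_I[where k = "l \<cdot>\<^sub>N n"]) simp_all
          then show ?thesis by (rule nle_subst[OF vv _ holds_sym[OF 1(1) vv] holds_refl[OF vv
              lel(2)]])
        next
          case 2
          obtain k where k: "posnat v k" "v \<Vdash> succ k \<le>\<^sub>N m" "v \<Vdash> one_at a k"
            by (rule some_beforeE[OF 2(2) vv av el(1)])
          show ?thesis
          proof (cases rule: search_flagE[OF fl[OF v n] vv])
            case 1
            have "v \<Vdash> succ k \<le>\<^sub>N n" by (rule nle_trans[OF vv k(2) le]) (use el posnat_elems[OF
                k(1)] in simp_all)
            then have "v \<Vdash> zero_at a k" by (rule none_beforeE[OF 1(2) vv av el(2) k(1)])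
            then show ?thesis using zero_not_one k(3) vv by blast
          next
            case 3: 2
            have "v \<Vdash> 1\<^sub>N \<le>\<^sub>N 1\<^sub>N" by (rule nle_refl[OF vv]) simp
            then show ?thesis by (rule nle_subst[OF vv _ holds_sym[OF 2(1) vv] holds_sym[OF 3(1)
                vv]])
          qed
        qed
      qed
    qed
  qed
qed

section \<open>The limit argument\<close>

text \<open>
  Since \<open>l\<close> starts with zero, a position with value one is preceded by a switch; it is found by
  induction.
\<close>

lemma switch_index:
  assumes w: "world w" and l: "l \<in> elems w (Seq Nat)" and bin: "w \<Vdash> binary l"
    and l1: "w \<Vdash> zero_at l 1\<^sub>N" and n: "posnat w n" and ln: "w \<Vdash> one_at l n"
  obtains m where "posnat w m" "w \<Vdash> zero_at l m" "w \<Vdash> one_at l (succ m)"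
proof -
  obtain k where k: "k \<in> elems w Nat" "w \<Vdash> n =\<^sub>N succ k" by (rule posnatE[OF n w])
  let ?E = "\<^bold>\<exists>\<^sup>+m. zero_at l m \<^bold>\<and> one_at l (succ m)"
  have d: "definable (fst v) [Nat] (\<lambda>ts. zero_at l (hd ts) \<^bold>\<and> one_at l (succ (hd ts)))"
    if "w \<sqsubseteq> v" for v
    by (intro definable_intros; use elems_mono[OF l that] in simp)
  have "w \<Vdash> zero_at l (succ k) \<^bold>\<or> ?E"
  proof (rule holds_induct[OF w _ _ _ _ k(1)])
    have "sentence w ?E" unfolding sentence_iff by (intro definable_intros; use l in simp)
    then show "w \<Vdash> zero_at l 1\<^sub>N \<^bold>\<or> ?E" using l1 w by (intro holds_OrI1)
    fix v k assume v: "w \<sqsubseteq> v" and k: "k \<in> elems v Nat" and IH: "v \<Vdash> zero_at l (succ k) \<^bold>\<or> ?E"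
    note vv = ext_world[OF v] and lv = elems_mono[OF l v]
    have ok: "sentence v ?E" "sentence v (zero_at l (succ (succ k)))"
      unfolding sentence_iff by (intro definable_intros; use lv k in simp)+
    from holds_OrE[OF IH vv] show "v \<Vdash> zero_at l (succ (succ k)) \<^bold>\<or> ?E"
    proof
      assume lk: "v \<Vdash> zero_at l (succ k)"
      have "posnat v (succ (succ k))" using k vv by (intro posnat_succ) simp_all
      then show ?thesis
      proof (cases rule: binaryE[OF holds_mono[OF bin v] vv lv, of "succ (succ k)", consumes 1])
        case 1
        then show ?thesis using vv ok by (intro holds_OrI1)
      next
        case 2
        have "v \<Vdash> ?E"
          by (rule holds_Exists_posI[OF _ posnat_succ[OF vv k] d[OF v] vv]) (use lk 2 vv in \<open>simp
              add: holds_And\<close>)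
        then show ?thesis using vv ok by (intro holds_OrI2)
      qed
    next
      assume "v \<Vdash> ?E"
      then show ?thesis using vv ok by (intro holds_OrI2)
    qed
  qed (intro definable_intros; use l in simp)+
  from holds_OrE[OF this w] show ?thesis
  proof
    assume "w \<Vdash> zero_at l (succ k)"
    from holds_trans[OF seq_cong[OF w l k(2)] this w] show ?thesis using zero_not_one ln w by blast
  next
    assume "w \<Vdash> ?E"
    from holds_Exists_posE[OF this d[OF ext_refl[OF w]] w]
    obtain m where "posnat w m" "w \<Vdash> zero_at l m \<^bold>\<and> one_at l (succ m)" .
    then show ?thesis using that w by (auto simp: holds_And)
  qed
qed

lemma increasing_one:
  assumes w: "world w" and l: "l \<in> elems w (Seq Nat)" and bin: "w \<Vdash> binary l"
      and inc: "w \<Vdash> increasing l"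
    and m: "posnat w m" and n: "posnat w n" and le: "w \<Vdash> m \<le>\<^sub>N n" and lm: "w \<Vdash> one_at l m"
  shows "w \<Vdash> one_at l n"
proof (cases rule: binaryE[OF bin w l n])
  case 1
  note [simp] = l posnat_elems[OF m] posnat_elems[OF n]
  have "w \<Vdash> (\<^bold>\<forall>\<^sup>+n. m \<le>\<^sub>N n \<^bold>\<longrightarrow> l \<cdot>\<^sub>N m \<le>\<^sub>N l \<cdot>\<^sub>N n)"
    by (rule holds_Forall_posE[OF inc[unfolded increasing_def] _ m w]) (intro definable_intros;
        simp)
  then have "w \<Vdash> m \<le>\<^sub>N n \<^bold>\<longrightarrow> l \<cdot>\<^sub>N m \<le>\<^sub>N l \<cdot>\<^sub>N n"
    by (rule holds_Forall_posE[OF _ _ n w]) (intro definable_intros; simp)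
  from nle_subst[OF w holds_ImpE[OF this le w] lm 1] show ?thesis
    by (rule not_succ_nle_zero[OF w, rotated]) simp
qed

lemma switch_unique:
  assumes w: "world w" and l: "l \<in> elems w (Seq Nat)" and bin: "w \<Vdash> binary l"
      and inc: "w \<Vdash> increasing l"
    and m: "posnat w m" "w \<Vdash> zero_at l m" "w \<Vdash> one_at l (succ m)"
    and n: "posnat w n" "w \<Vdash> zero_at l n" "w \<Vdash> one_at l (succ n)"
  shows "w \<Vdash> m =\<^sub>N n"
proof (cases rule: nat_trichotomy[OF w posnat_elems[OF m(1)] posnat_elems[OF n(1)]])
  case 2
  show ?thesis
    using increasing_one[OF w l bin inc posnat_succ[OF w posnat_elems[OF m(1)]] n(1) 2 m(3)]
        zero_not_one[OF n(2) _ w] by blast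
next
  case 3
  show ?thesis
    using increasing_one[OF w l bin inc posnat_succ[OF w posnat_elems[OF n(1)]] m(1) 3 n(3)]
        zero_not_one[OF m(2) _ w] by blast
qed

lemma eqX_refl: "w \<Vdash> metric_space \<Longrightarrow> world w \<Longrightarrow> x \<in> elems w Pt \<Longrightarrow> w \<Vdash> x =\<^sub>X x"
  unfolding eqX_def by (rule metric_spaceE(3))

text \<open>
  For \<open>l\<^sub>n = 1\<close> the term has to equal \<open>q\<^sub>m\<close> for every switch \<open>m\<close>; as \<open>l\<close> is increasing, there is
  only one.
\<close>

lemma switch_sequence:
  assumes w: "world w" and ms: "w \<Vdash> metric_space"
    and l: "l \<in> elems w (Seq Nat)" "w \<Vdash> binary l" "w \<Vdash> increasing l" "w \<Vdash> zero_at l 1\<^sub>N"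
    and q: "q \<in> elems w (Seq Pt)" and x: "x \<in> elems w Pt"
  obtains s where "s \<in> elems w (Seq Pt)" "w \<Vdash> is_switch l q (\<lambda>n. x) s"
proof -
  define F where "F n y = ((zero_at l n \<^bold>\<longrightarrow> y =\<^sub>X x) \<^bold>\<and>
    (one_at l n \<^bold>\<longrightarrow>
      (\<^bold>\<forall>\<^sup>+m. zero_at l m \<^bold>\<and> one_at l (succ m) \<^bold>\<longrightarrow> y =\<^sub>X q \<cdot>\<^sub>P m)))" for n y
  have total: "\<exists>y\<in>elems v Pt. v \<Vdash> F n y" if v: "w \<sqsubseteq> v" and n: "posnat v n" for v n
  proof -
    note vv = ext_world[OF v] and lv = elems_mono[OF l(1) v] and xv = elems_mono[OF x v]
        and q_v = elems_mono[OF q v]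
    note [simp] = lv xv q_v posnat_elems[OF n]
    have ok: "sentence v (zero_at l n \<^bold>\<longrightarrow> y =\<^sub>X x)" "sentence v (one_at l n \<^bold>\<longrightarrow>
      (\<^bold>\<forall>\<^sup>+m. zero_at l m \<^bold>\<and> one_at l (succ m) \<^bold>\<longrightarrow> y =\<^sub>X q \<cdot>\<^sub>P m))" if "y \<in> elems v Pt" for y
      unfolding sentence_iff by (intro definable_intros; use that in simp)+
    show ?thesis
    proof (cases rule: binaryE[OF holds_mono[OF l(2) v] vv lv n])
      case 1
      have "v \<Vdash> F n x" unfolding F_def holds_And[OF vv]
      proof
        show "v \<Vdash> zero_at l n \<^bold>\<longrightarrow> x =\<^sub>X x"
          by (rule holds_ImpI[OF vv ok(1)[OF xv]]) (rule holds_mono[OF eqX_refl[OF holds_mono[OF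
              ms v] vv xv]])
        show "v \<Vdash> one_at l n \<^bold>\<longrightarrow>
            (\<^bold>\<forall>\<^sup>+m. zero_at l m \<^bold>\<and> one_at l (succ m) \<^bold>\<longrightarrow> x =\<^sub>X q \<cdot>\<^sub>P m)"
          by (rule holds_ImpI[OF vv ok(2)[OF xv]]) (rule zero_not_one[OF holds_mono[OF 1] _
              ext_world])
      qed
      then show ?thesis using xv by blast
    next
      case 2
      obtain m where m: "posnat v m" "v \<Vdash> zero_at l m" "v \<Vdash> one_at l (succ m)"
        by (rule switch_index[OF vv lv holds_mono[OF l(2) v] holds_mono[OF l(4) v] n 2])
      have qm: "q \<cdot>\<^sub>P m \<in> elems v Pt" using posnat_elems[OF m(1)] by simp
      have "v \<Vdash> F n (q \<cdot>\<^sub>P m)" unfolding F_def holds_And[OF vv]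
      proof
        show "v \<Vdash> zero_at l n \<^bold>\<longrightarrow> q \<cdot>\<^sub>P m =\<^sub>X x"
          by (rule holds_ImpI[OF vv ok(1)[OF qm]]) (rule zero_not_one[OF _ holds_mono[OF 2]
              ext_world])
        show "v \<Vdash> one_at l n \<^bold>\<longrightarrow>
            (\<^bold>\<forall>\<^sup>+k. zero_at l k \<^bold>\<and> one_at l (succ k) \<^bold>\<longrightarrow> q \<cdot>\<^sub>P m =\<^sub>X q \<cdot>\<^sub>P k)"
        proof (rule holds_ImpI[OF vv ok(2)[OF qm]])
          fix v' assume v': "v \<sqsubseteq> v'"
          show "v' \<Vdash> (\<^bold>\<forall>\<^sup>+k. zero_at l k \<^bold>\<and> one_at l (succ k) \<^bold>\<longrightarrow> q \<cdot>\<^sub>P m =\<^sub>X q \<cdot>\<^sub>P k)"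
          proof (rule holds_Forall_pos_ImpI[OF ext_world[OF v']])
            show "definable (fst v') [Nat] (\<lambda>ts. zero_at l (hd ts) \<^bold>\<and> one_at l (succ (hd ts)) \<^bold>\<longrightarrow>
                q \<cdot>\<^sub>P m =\<^sub>X q \<cdot>\<^sub>P hd ts)"
              by (intro definable_intros; use elems_mono[OF _ v'] posnat_elems[OF m(1)] in simp)
            fix v'' k assume "v' \<sqsubseteq> v''" and k: "posnat v'' k"
              and lk: "v'' \<Vdash> zero_at l k \<^bold>\<and> one_at l (succ k)"
            have u: "v \<sqsubseteq> v''" "w \<sqsubseteq> v''" using ext_trans v v' \<open>v' \<sqsubseteq> v''\<close> by blast+
            note uu = ext_world[OF u(1)]
            have lk': "v'' \<Vdash> zero_at l k" "v'' \<Vdash> one_at l (succ k)"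
              using lk uu by (simp_all add: holds_And)
            have qu: "q \<in> elems v'' (Seq Pt)" "q \<cdot>\<^sub>P m \<in> elems v'' Pt"
                using elems_mono[OF q u(2)] elems_mono[OF qm u(1)] by auto
            have "v'' \<Vdash> m =\<^sub>N k"
              by (rule switch_unique[OF uu elems_mono[OF l(1) u(2)] holds_mono[OF l(2) u(2)]
                  holds_mono[OF l(3) u(2)]
                    posnat_mono[OF m(1) u(1)] holds_mono[OF m(2) u(1)] holds_mono[OF m(3) u(1)] k
                        lk'])
            then have "v'' \<Vdash> q \<cdot>\<^sub>P m =\<^bsub>Pt\<^esub> q \<cdot>\<^sub>P k" by (rule seq_cong[OF uu qu(1)])
            then show "v'' \<Vdash> q \<cdot>\<^sub>P m =\<^sub>X q \<cdot>\<^sub>P k"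
              by (rule holds_subst[where F = "\<lambda>y. q \<cdot>\<^sub>P m =\<^sub>X y",
                  OF _ eqX_refl[OF holds_mono[OF ms u(2)] uu qu(2)] _ uu])
                (intro definable_intros; use qu in simp)
          qed
        qed
      qed
      then show ?thesis using qm by blast
    qed
  qed
  obtain s where s: "s \<in> elems w (Seq Pt)" "w \<Vdash> (\<^bold>\<forall>\<^sup>+n. F n (s \<cdot>\<^sub>P n))"
    by (rule holds_choice_pos[OF w x, of F]) (unfold F_def,
        (intro definable_intros; use l(1) q x in simp)+, fold F_def, blast intro: total)
  show ?thesis by (rule that[OF s(1)]) (use s(2) in \<open>simp add: is_switch_def F_def\<close>)
qed

lemma convergesE:
  assumes w: "world w" and s: "s \<in> elems w (Seq Pt)" and conv: "w \<Vdash> converges s"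
  obtains z where "z \<in> elems w Pt"
    "\<And>v k. w \<sqsubseteq> v \<Longrightarrow> posnat v k \<Longrightarrow> \<exists>M. posnat v M \<and>
      (\<forall>n. n \<in> elems v Nat \<longrightarrow> (v \<Vdash> M \<le>\<^sub>N n) \<longrightarrow> (v \<Vdash> \<rho> (s \<cdot>\<^sub>P n) z \<le>\<^sub>R rconst (recip k)))"
proof -
  have "definable (fst w) [Pt] (\<lambda>ts. \<^bold>\<forall>\<^sup>+k. \<^bold>\<exists>\<^sup>+N. \<^bold>\<forall>n:Nat. N \<le>\<^sub>N n \<^bold>\<longrightarrow>
      \<rho> (s \<cdot>\<^sub>P n) (hd ts) \<le>\<^sub>R rconst (recip k))"
    by (intro definable_intros; use s in simp)
  from holds_ExistsE[OF conv[unfolded converges_def] this w] obtain z where z: "z \<in> elems w Pt"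
      "w \<Vdash> (\<^bold>\<forall>\<^sup>+k. \<^bold>\<exists>\<^sup>+N. \<^bold>\<forall>n:Nat. N \<le>\<^sub>N n \<^bold>\<longrightarrow> \<rho> (s \<cdot>\<^sub>P n) z \<le>\<^sub>R rconst (recip k))" .
  show ?thesis
  proof (rule that[OF z(1)])
    fix v k assume v: "w \<sqsubseteq> v" and k: "posnat v k"
    note vv = ext_world[OF v]
    note [simp] = elems_mono[OF s v] elems_mono[OF z(1) v] posnat_elems[OF k]
    have 1: "v \<Vdash> (\<^bold>\<exists>\<^sup>+N. \<^bold>\<forall>n:Nat. N \<le>\<^sub>N n \<^bold>\<longrightarrow> \<rho> (s \<cdot>\<^sub>P n) z \<le>\<^sub>R rconst (recip k))"
      by (rule holds_Forall_posE[OF holds_mono[OF z(2) v] _ k vv]) (intro definable_intros; simp)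
    have "definable (fst v) [Nat] (\<lambda>ts. \<^bold>\<forall>n:Nat. hd ts \<le>\<^sub>N n \<^bold>\<longrightarrow> \<rho> (s \<cdot>\<^sub>P n) z \<le>\<^sub>R rconst (recip k))"
      by (intro definable_intros; simp)
    from holds_Exists_posE[OF 1 this vv] obtain M where M: "posnat v M"
        "v \<Vdash> (\<^bold>\<forall>n:Nat. M \<le>\<^sub>N n \<^bold>\<longrightarrow> \<rho> (s \<cdot>\<^sub>P n) z \<le>\<^sub>R rconst (recip k))" .
    note [simp] = posnat_elems[OF M(1)]
    have "v \<Vdash> \<rho> (s \<cdot>\<^sub>P n) z \<le>\<^sub>R rconst (recip k)" if "n \<in> elems v Nat" "v \<Vdash> M \<le>\<^sub>N n" for n
    proof -
      have "v \<Vdash> M \<le>\<^sub>N n \<^bold>\<longrightarrow> \<rho> (s \<cdot>\<^sub>P n) z \<le>\<^sub>R rconst (recip k)"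
        by (rule holds_ForallE[OF M(2) _ that(1) vv,
            where N = "fst v"]) (intro definable_intros; simp)
      then show ?thesis using that(2) vv by (rule holds_ImpE)
    qed
    with M(1) show "\<exists>M. posnat v M \<and>
      (\<forall>n. n \<in> elems v Nat \<longrightarrow> (v \<Vdash> M \<le>\<^sub>N n) \<longrightarrow> (v \<Vdash> \<rho> (s \<cdot>\<^sub>P n) z \<le>\<^sub>R rconst (recip k)))" by blast
  qed
qed

lemma is_switchE:
  assumes w: "world w" and sw: "w \<Vdash> is_switch l q (\<lambda>n. x) s" and n: "posnat w n"
    and el: "l \<in> elems w (Seq Nat)" "q \<in> elems w (Seq Pt)" "x \<in> elems w Pt" "s \<in> elems w (Seq Pt)"
  shows "w \<Vdash> zero_at l n \<Longrightarrow> w \<Vdash> s \<cdot>\<^sub>P n =\<^sub>X x"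
    and "w \<Vdash> one_at l n \<Longrightarrow> posnat w m \<Longrightarrow> w \<Vdash> zero_at l m \<Longrightarrow>
      w \<Vdash> one_at l (succ m) \<Longrightarrow> w \<Vdash> s \<cdot>\<^sub>P n =\<^sub>X q \<cdot>\<^sub>P m"
proof -
  note [simp] = el posnat_elems[OF n]
  have 1: "w \<Vdash> (zero_at l n \<^bold>\<longrightarrow> s \<cdot>\<^sub>P n =\<^sub>X x) \<^bold>\<and>
    (one_at l n \<^bold>\<longrightarrow>
      (\<^bold>\<forall>\<^sup>+m. zero_at l m \<^bold>\<and> one_at l (succ m) \<^bold>\<longrightarrow> s \<cdot>\<^sub>P n =\<^sub>X q \<cdot>\<^sub>P m))"
    by (rule holds_Forall_posE[OF sw[unfolded is_switch_def] _ n w]) (intro definable_intros; simp)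
  then show "w \<Vdash> zero_at l n \<Longrightarrow> w \<Vdash> s \<cdot>\<^sub>P n =\<^sub>X x"
    using holds_And[OF w] holds_ImpE[OF _ _ w] by blast
  assume "w \<Vdash> one_at l n"
    and m: "posnat w m" "w \<Vdash> zero_at l m" "w \<Vdash> one_at l (succ m)"
  then have "w \<Vdash> (\<^bold>\<forall>\<^sup>+m. zero_at l m \<^bold>\<and> one_at l (succ m) \<^bold>\<longrightarrow> s \<cdot>\<^sub>P n =\<^sub>X q \<cdot>\<^sub>P m)"
    using 1 holds_And[OF w] holds_ImpE[OF _ _ w] by blast
  then have "w \<Vdash> zero_at l m \<^bold>\<and> one_at l (succ m) \<^bold>\<longrightarrow> s \<cdot>\<^sub>P n =\<^sub>X q \<cdot>\<^sub>P m"
    by (rule holds_Forall_posE[OF _ _ m(1) w]) (intro definable_intros; simp)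
  then show "w \<Vdash> s \<cdot>\<^sub>P n =\<^sub>X q \<cdot>\<^sub>P m" using m(2,3) holds_And[OF w] holds_ImpE[OF _ _ w] by blast
qed

lemma switch_converges:
  assumes w: "world w" and ce: "w \<Vdash> complete_enough x"
    and el: "l \<in> elems w (Seq Nat)" "q \<in> elems w (Seq Pt)" "x \<in> elems w Pt" "s \<in> elems w (Seq Pt)"
    and l: "w \<Vdash> binary l" "w \<Vdash> increasing l" "w \<Vdash> zero_at l 1\<^sub>N"
    and q: "w \<Vdash> (\<^bold>\<forall>\<^sup>+n. (q \<cdot>\<^sub>P n) \<in>\<^sub>Q)" "w \<Vdash> (\<^bold>\<forall>\<^sup>+n. zero_at l n \<^bold>\<longrightarrow> \<rho> (q \<cdot>\<^sub>P n) x <\<^sub>R 2\<^sup>-\<^sup>n)"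
    and sw: "w \<Vdash> is_switch l q (\<lambda>n. x) s"
  shows "w \<Vdash> converges s"
proof -
  note [simp] = el
  let ?C = "\<lambda>q l s. (\<^bold>\<forall>\<^sup>+n. (q \<cdot>\<^sub>P n) \<in>\<^sub>Q) \<^bold>\<and> binary l \<^bold>\<and> increasing l \<^bold>\<and> zero_at l 1\<^sub>N \<^bold>\<longrightarrow>
    ((\<^bold>\<forall>\<^sup>+n. zero_at l n \<^bold>\<longrightarrow> \<rho> (q \<cdot>\<^sub>P n) x <\<^sub>R 2\<^sup>-\<^sup>n) \<^bold>\<and>
      is_switch l q (\<lambda>n. x) s \<^bold>\<longrightarrow> converges s) \<^bold>\<and>
    ((\<^bold>\<forall>\<^sup>+n. \<rho> (q \<cdot>\<^sub>P n) x <\<^sub>R 2\<^sup>-\<^sup>n) \<^bold>\<and>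
      is_switch l q (\<lambda>n. q \<cdot>\<^sub>P n) s \<^bold>\<longrightarrow> converges s)"
  have "w \<Vdash> (\<^bold>\<forall>s:Seq Pt. ?C q l s)"
    by (rule holds_Forall2E[OF ce[unfolded complete_enough_def] _ _ el(2,1) w]) (intro
        definable_intros; simp)+
  then have "w \<Vdash> ?C q l s"
    by (rule holds_ForallE[OF _ _ el(4) w, where N = "fst w"]) (intro definable_intros; simp)
  then show ?thesis
    using l q sw holds_And[OF w] holds_ImpE[OF _ _ w] by meson
qed

text \<open>
  The heart of the proof: the limit \<open>z\<close> of the switching sequence is \<open>x\<close> if all flags are zero,
  and in \<open>Q\<close> if some flag is one.  Knowing that one of the two is impossible decides between them.
\<close>

lemma apart_decides:
  assumes w: "world w" and ms: "w \<Vdash> metric_space" and sub: "w \<Vdash> subset_Q"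
      and ce: "w \<Vdash> complete_enough x"
    and apart: "w \<Vdash> (\<^bold>\<forall>z:Pt. z \<noteq>\<^sub>X x \<^bold>\<or> \<^bold>\<not> z \<in>\<^sub>Q)" and x: "x \<in> elems w Pt"
    and l: "l \<in> elems w (Seq Nat)" "w \<Vdash> binary l" "w \<Vdash> increasing l" "w \<Vdash> zero_at l 1\<^sub>N"
    and near: "\<And>v n. w \<sqsubseteq> v \<Longrightarrow> posnat v n \<Longrightarrow> \<exists>q\<in>elems v Pt. (v \<Vdash> q \<in>\<^sub>Q) \<and>
      ((v \<Vdash> zero_at l n) \<longrightarrow> (v \<Vdash> \<rho> q x <\<^sub>R 2\<^sup>-\<^sup>n))"
  shows "(w \<Vdash> (\<^bold>\<forall>\<^sup>+n. zero_at l n)) \<or> (w \<Vdash> (\<^bold>\<exists>\<^sup>+n. one_at l n))"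
proof -
  define F where "F n y = (y \<in>\<^sub>Q \<^bold>\<and> (zero_at l n \<^bold>\<longrightarrow> \<rho> y x <\<^sub>R 2\<^sup>-\<^sup>n))" for n y
  have total: "\<exists>y\<in>elems v Pt. v \<Vdash> F n y" if v: "w \<sqsubseteq> v" and n: "posnat v n" for v n
  proof -
    note vv = ext_world[OF v] and lv = elems_mono[OF l(1) v]
    note [simp] = lv elems_mono[OF x v] posnat_elems[OF n]
    obtain y where y: "y \<in> elems v Pt" "v \<Vdash> y \<in>\<^sub>Q" "(v \<Vdash> zero_at l n) \<longrightarrow> (v \<Vdash> \<rho> y x <\<^sub>R 2\<^sup>-\<^sup>n)"
      using near[OF v n] by blast
    have "v \<Vdash> zero_at l n \<^bold>\<longrightarrow> \<rho> y x <\<^sub>R 2\<^sup>-\<^sup>n"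
    proof (rule holds_ImpI[OF vv])
      show "sentence v (zero_at l n \<^bold>\<longrightarrow> \<rho> y x <\<^sub>R 2\<^sup>-\<^sup>n)"
        unfolding sentence_iff by (intro definable_intros; use y in simp)
      fix u assume u: "v \<sqsubseteq> u" and lu: "u \<Vdash> zero_at l n"
      show "u \<Vdash> \<rho> y x <\<^sub>R 2\<^sup>-\<^sup>n"
      proof (cases rule: binaryE[OF holds_mono[OF l(2) v] vv lv n])
        case 1
        then show ?thesis using y(3) holds_mono[OF _ u] by blast
      next
        case 2
        show ?thesis by (rule zero_not_one[OF lu holds_mono[OF 2 u] ext_world[OF u]])
      qed
    qed
    then show ?thesis using y vv by (auto simp: F_def holds_And)
  qed
  obtain q where q: "q \<in> elems w (Seq Pt)" "w \<Vdash> (\<^bold>\<forall>\<^sup>+n. F n (q \<cdot>\<^sub>P n))"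
    by (rule holds_choice_pos[OF w x, of F])
      (unfold F_def, (intro definable_intros; use l(1) x in simp)+, fold F_def, blast intro: total)
  note [simp] = q(1) l(1) x
  have Fq: "v \<Vdash> F n (q \<cdot>\<^sub>P n)" if v: "w \<sqsubseteq> v" and n: "posnat v n" for v n
    by (rule holds_Forall_posE[OF holds_mono[OF q(2) v] _ n ext_world[OF v]])
      (unfold F_def, intro definable_intros; use elems_mono[OF _ v] in simp)
  have qQ: "w \<Vdash> (\<^bold>\<forall>\<^sup>+n. (q \<cdot>\<^sub>P n) \<in>\<^sub>Q)"
  proof (rule holds_Forall_posI[OF w])
    show "definable (fst w) [Nat] (\<lambda>ts. (q \<cdot>\<^sub>P hd ts) \<in>\<^sub>Q)" by (intro definable_intros; simp)
  qed (use Fq ext_world in \<open>auto simp: F_def holds_And\<close>)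
  have near_q: "w \<Vdash> (\<^bold>\<forall>\<^sup>+n. zero_at l n \<^bold>\<longrightarrow> \<rho> (q \<cdot>\<^sub>P n) x <\<^sub>R 2\<^sup>-\<^sup>n)"
  proof (rule holds_Forall_posI[OF w])
    show "definable (fst w) [Nat] (\<lambda>ts. zero_at l (hd ts) \<^bold>\<longrightarrow> \<rho> (q \<cdot>\<^sub>P hd ts) x <\<^sub>R 2\<^sup>-\<^sup>(hd ts))"
        by (intro definable_intros; simp)
  qed (use Fq ext_world in \<open>auto simp: F_def holds_And\<close>)
  obtain s where s: "s \<in> elems w (Seq Pt)" "w \<Vdash> is_switch l q (\<lambda>n. x) s"
    by (rule switch_sequence[OF w ms l q(1) x])
  have "w \<Vdash> converges s" by (rule switch_converges[OF w ce l(1) q(1) x s(1) l(2,3,4) qQ near_q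
      s(2)])
  then obtain z where z: "z \<in> elems w Pt" and lim: "\<And>v k. w \<sqsubseteq> v \<Longrightarrow> posnat v k \<Longrightarrow> \<exists>M. posnat v M \<and>
      (\<forall>n. n \<in> elems v Nat \<longrightarrow> (v \<Vdash> M \<le>\<^sub>N n) \<longrightarrow> (v \<Vdash> \<rho> (s \<cdot>\<^sub>P n) z \<le>\<^sub>R rconst (recip k)))"
    by (rule convergesE[OF w s(1)]) blast
  note [simp] = z s(1)
  have "w \<Vdash> z \<noteq>\<^sub>X x \<^bold>\<or> \<^bold>\<not> z \<in>\<^sub>Q"
    by (rule holds_ForallE[OF apart _ z w, where N = "fst w"]) (intro definable_intros; simp)
  from holds_OrE[OF this w] show ?thesis
  proof
    assume "w \<Vdash> z \<noteq>\<^sub>X x"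
    then obtain n where n: "posnat w n" and far: "positive w (approx (\<rho> z x) (dbl n) - approx 0\<^sub>R
        (dbl n) - recip_of n)"
      unfolding neqX_def by (rule rless_E[OF _ w]) simp_all
    note n2 = posnat_dbl[OF w n]
    note [simp] = posnat_elems[OF n] posnat_elems[OF n, THEN elems_sort]
    obtain M where M: "posnat w M"
        and "\<forall>k. k \<in> elems w Nat \<longrightarrow> (w \<Vdash> M \<le>\<^sub>N k) \<longrightarrow>
          (w \<Vdash> \<rho> (s \<cdot>\<^sub>P k) z \<le>\<^sub>R rconst (recip (dbl (dbl (dbl (dbl n))))))"
      using lim[OF ext_refl[OF w], of "dbl (dbl (dbl (dbl n)))"] posnat_dbl[OF w] n by blast
    then have close: "w \<Vdash> \<rho> (s \<cdot>\<^sub>P M) z \<le>\<^sub>R rconst (recip (dbl (dbl (dbl (dbl n)))))"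
      using nle_refl[OF w] posnat_elems[OF M] by blast
    show ?thesis
    proof (cases rule: binaryE[OF l(2) w l(1) M])
      case 1
      have "w \<Vdash> s \<cdot>\<^sub>P M =\<^sub>X x" by (rule is_switchE(1)[OF w s(2) M _ _ _ _ 1]) simp_all
      then have bound: "positive w (recip_of (dbl n) + recip_of (dbl n) - approx (\<rho> z x) (dbl n))"
        using posnat_elems[OF M] by (intro metric_bound(2)[OF w ms n2 _ _ _ _ close]) simp_all
      have "positive w (approx (\<rho> z x) (dbl n) - recip_of n)" using far by simp
      from pos_nonneg_add[OF w this nonneg_add[OF w pos_nonneg[OF w bound] is_zero_nonneg(1)[OF w
          recip_of_dbl[OF w n]]]]
      have "positive w 0" by (simp add: algebra_simps)
      then show ?thesis using not_pos_0[OF w] by blast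
    next
      case 2
      have "w \<Vdash> (\<^bold>\<exists>\<^sup>+n. one_at l n)"
        by (rule holds_Exists_posI[where n = M, OF _ M _ w], rule 2) (intro definable_intros; simp)
      then show ?thesis ..
    qed
  next
    assume not_Q: "w \<Vdash> \<^bold>\<not> z \<in>\<^sub>Q"
    have "w \<Vdash> (\<^bold>\<forall>\<^sup>+n. zero_at l n)"
    proof (rule holds_Forall_posI[OF w])
      show "definable (fst w) [Nat] (\<lambda>ts. zero_at l (hd ts))" by (intro definable_intros; simp)
      fix v n assume v: "w \<sqsubseteq> v" and n: "posnat v n"
      note vv = ext_world[OF v] and lv = elems_mono[OF l(1) v]
      have zv: "z \<in> elems v Pt" by (rule elems_mono[OF z v])
      show "v \<Vdash> zero_at l n"
      proof (cases rule: binaryE[OF holds_mono[OF l(2) v] vv lv n])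
        case 2
        obtain m where m: "posnat v m" "v \<Vdash> zero_at l m" "v \<Vdash> one_at l (succ m)"
          by (rule switch_index[OF vv lv holds_mono[OF l(2) v] holds_mono[OF l(4) v] n 2])
        let ?q = "q \<cdot>\<^sub>P m"
        have qm: "?q \<in> elems v Pt" using elems_mono[OF q(1) v] posnat_elems[OF m(1)] by simp
        have "v \<Vdash> ?q =\<^sub>X z" unfolding eqX_def
        proof (rule req_I[OF vv])
          fix u k assume vu: "v \<sqsubseteq> u" and k: "posnat u k"
          have u: "w \<sqsubseteq> u" by (rule ext_trans[OF v vu])
          note uu = ext_world[OF u]
          note mu = posnat_mono[OF m(1) vu] and nu = posnat_mono[OF n vu]
          note el = elems_mono[OF q(1) u] elems_mono[OF l(1) u] elems_mono[OF s(1) u]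
              elems_mono[OF x u]
            elems_mono[OF z u] posnat_elems[OF k] posnat_elems[OF mu] posnat_elems[OF nu]
          note [simp] = el el[THEN elems_sort]
          obtain M where M: "posnat u M" and close: "\<forall>n. n \<in> elems u Nat \<longrightarrow> (u \<Vdash> M \<le>\<^sub>N n) \<longrightarrow>
              (u \<Vdash> \<rho> (s \<cdot>\<^sub>P n) z \<le>\<^sub>R rconst (recip (dbl (dbl (dbl k)))))"
            using lim[OF u, of "dbl (dbl (dbl k))"] posnat_dbl[OF uu] k by blast
          \<comment> \<open>An index after the switch at which \<open>s\<close> is already close to its limit.\<close>
          let ?i = "M +\<^sub>N n"
          note Mel = posnat_elems[OF M]
          have i: "posnat u ?i" by (rule posnat_add[OF uu Mel nu])
          have "u \<Vdash> one_at l ?i"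
            by (rule increasing_one[OF uu _ holds_mono[OF l(2) u] holds_mono[OF l(3) u] nu i
                nle_add2[OF uu Mel] holds_mono[OF 2 vu]])
              simp_all
          then have "u \<Vdash> s \<cdot>\<^sub>P ?i =\<^sub>X ?q"
            by (rule is_switchE(2)[OF uu holds_mono[OF s(2) u] i _ _ _ _ _ mu holds_mono[OF m(2)
                vu] holds_mono[OF m(3) vu], rotated 4])
              simp_all
          moreover have "u \<Vdash> \<rho> (s \<cdot>\<^sub>P ?i) z \<le>\<^sub>R rconst (recip (dbl (dbl (dbl k))))"
            using close nle_add1[OF uu Mel el(8)] posnat_elems[OF i] by blast
          ultimately have "positive u (recip_of k + recip_of k - approx (\<rho> ?q z) k)"
            using Mel by (intro metric_bound(1)[OF uu holds_mono[OF ms u] k]) simp_all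
          then show "nonneg u (recip_of k + recip_of k - (approx (\<rho> ?q z) k - approx 0\<^sub>R k))"
              using uu by (simp add: pos_nonneg)
          have "?q \<in> elems u Pt" by simp
          note d = metric_spaceE[OF holds_mono[OF ms u] uu this el(5,5)]
          have "nonneg u (recip_of k + recip_of k + approx (\<rho> ?q z) k)"
            by (rule nonneg_real_bound[OF uu k _ d(1,2)]) simp
          then show "nonneg u (recip_of k + recip_of k - (approx 0\<^sub>R k - approx (\<rho> ?q z) k))" by simp
        qed (use qm zv in simp_all)
        moreover have "v \<Vdash> ?q \<in>\<^sub>Q" using Fq[OF v m(1)] vv by (simp add: F_def holds_And)
        moreover have "v \<Vdash> ?q =\<^sub>X z \<^bold>\<longrightarrow> ?q \<in>\<^sub>Q \<^bold>\<longrightarrow> z \<in>\<^sub>Q"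
          by (rule holds_Forall2E[OF holds_mono[OF sub v, unfolded subset_Q_def] _ _ qm zv vv])
            (intro definable_intros; use qm in simp)+
        ultimately have "v \<Vdash> z \<in>\<^sub>Q" using holds_ImpE[OF _ _ vv] by blast
        then have "v \<Vdash> \<^bold>\<bottom>" using holds_ImpE[OF holds_mono[OF not_Q v] _ vv] by blast
        then show ?thesis using vv by (rule holds_FalsumE)
      qed
    qed
    then show ?thesis ..
  qed
qed

section \<open>Deciding the distance\<close>

text \<open>
  The assumption on \<open>a\<close> is that each initial segment without a one yields a point of \<open>Q\<close> that is
  correspondingly close to \<open>x\<close>.
\<close>

lemma search_decides:
  assumes w: "world w" and ms: "w \<Vdash> metric_space" and sub: "w \<Vdash> subset_Q"
      and ce: "w \<Vdash> complete_enough x"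
    and apart: "w \<Vdash> (\<^bold>\<forall>z:Pt. z \<noteq>\<^sub>X x \<^bold>\<or> \<^bold>\<not> z \<in>\<^sub>Q)" and x: "x \<in> elems w Pt"
    and a: "a \<in> elems w (Seq Nat)" and bin: "w \<Vdash> binary a"
    and near: "\<And>v n. w \<sqsubseteq> v \<Longrightarrow> posnat v n \<Longrightarrow> \<exists>q\<in>elems v Pt. (v \<Vdash> q \<in>\<^sub>Q) \<and>
      ((v \<Vdash> none_before a n) \<longrightarrow> (v \<Vdash> \<rho> q x <\<^sub>R 2\<^sup>-\<^sup>n))"
  shows "(w \<Vdash> (\<^bold>\<forall>\<^sup>+n. zero_at a n)) \<or> (w \<Vdash> (\<^bold>\<exists>\<^sup>+n. one_at a n))"
proof -
  obtain l where l: "l \<in> elems w (Seq Nat)" "w \<Vdash> binary l" "w \<Vdash> increasing l" "w \<Vdash> zero_at l 1\<^sub>N"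
    and fl: "\<And>v n. w \<sqsubseteq> v \<Longrightarrow> posnat v n \<Longrightarrow> v \<Vdash> search_flag a n (l \<cdot>\<^sub>N n)"
    by (rule increasing_flags[OF w a bin]) blast
  note [simp] = a l(1)
  have zero: "v \<Vdash> none_before a n" if v: "w \<sqsubseteq> v" and n: "posnat v n"
      and ln: "v \<Vdash> zero_at l n" for v n
    by (cases rule: search_flagE[OF fl[OF v n] ext_world[OF v]]) (use zero_not_one[OF ln _
        ext_world[OF v]] in blast)+
  have "(w \<Vdash> (\<^bold>\<forall>\<^sup>+n. zero_at l n)) \<or> (w \<Vdash> (\<^bold>\<exists>\<^sup>+n. one_at l n))"
    using near zero by (intro apart_decides[OF w ms sub ce apart x l]) blast
  then show ?thesis
  proof
    assume all: "w \<Vdash> (\<^bold>\<forall>\<^sup>+n. zero_at l n)"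
    have "w \<Vdash> (\<^bold>\<forall>\<^sup>+n. zero_at a n)"
    proof (rule holds_Forall_posI[OF w])
      show "definable (fst w) [Nat] (\<lambda>ts. zero_at a (hd ts))" by (intro definable_intros; simp)
      fix v n assume v: "w \<sqsubseteq> v" and n: "posnat v n"
      note vv = ext_world[OF v] and nel = posnat_elems[OF n] and av = elems_mono[OF a v]
      \<comment> \<open>The flag at \<open>n + 1\<close> covers the term at \<open>n\<close>.\<close>
      have sn: "posnat v (succ n)" "succ n \<in> elems v Nat" using posnat_succ[OF vv nel] nel
          by simp_all
      have "v \<Vdash> zero_at l (succ n)"
        by (rule holds_Forall_posE[OF holds_mono[OF all v] _ sn(1) vv])
          (intro definable_intros; use elems_mono[OF l(1) v] in simp)
      from none_beforeE[OF zero[OF v sn(1) this] vv av sn(2) n nle_refl[OF vv sn(2)]]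
      show "v \<Vdash> zero_at a n" .
    qed
    then show ?thesis ..
  next
    assume ex: "w \<Vdash> (\<^bold>\<exists>\<^sup>+n. one_at l n)"
    have "definable (fst w) [Nat] (\<lambda>ts. one_at l (hd ts))" by (intro definable_intros; simp)
    from holds_Exists_posE[OF ex this w] obtain n where n: "posnat w n" "w \<Vdash> one_at l n" .
    have "w \<Vdash> some_before a n"
      by (cases rule: search_flagE[OF fl[OF ext_refl[OF w] n(1)] w]) (use zero_not_one[OF _ n(2)
          w] in blast)+
    then obtain k where k: "posnat w k" "w \<Vdash> one_at a k"
      by (rule some_beforeE[OF _ w a posnat_elems[OF n(1)]])
    have "w \<Vdash> (\<^bold>\<exists>\<^sup>+n. one_at a n)"
      by (rule holds_Exists_posI[where n = k, OF _ k(1) _ w],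
          rule k(2)) (intro definable_intros; simp)
    then show ?thesis ..
  qed
qed

text \<open>
  Let \<open>2\<^sup>-\<^sup>n = 1/M\<close> and test the sign of \<open>d\<close> at \<open>N = 4M\<close>; then \<open>4/N\<close> is \<open>2\<^sup>-\<^sup>n\<close>, as \<open>close_point\<close>
  requires.
\<close>

lemma near_or_pos:
  assumes w: "world w" and ms: "w \<Vdash> metric_space" and dist: "w \<Vdash> is_dist_Q x d"
      and d: "w \<Vdash> is_real d"
    and el: "x \<in> elems w Pt" "d \<in> elems w (Seq Rat)" and n: "n \<in> elems w Nat"
  obtains "w \<Vdash> 0\<^sub>R <\<^sub>R d" | a where "a \<in> elems w Pt" "w \<Vdash> a \<in>\<^sub>Q" "w \<Vdash> \<rho> a x <\<^sub>R 2\<^sup>-\<^sup>n"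
proof -
  obtain M where M: "posnat w M" "is_zero w (recip_of M - rat_of (half ^\<^sub>Q n))"
      by (rule half_pow_recip[OF w n])
  let ?N = "dbl (dbl M)"
  note M2 = posnat_dbl[OF w M(1)] and N = posnat_dbl[OF w posnat_dbl[OF w M(1)]]
  have "is_zero w (- (recip_of M - rat_of (half ^\<^sub>Q n)) + ((recip_of M - recip_of (dbl M) -
      recip_of (dbl M)) +
      ((recip_of (dbl M) - recip_of ?N - recip_of ?N) + (recip_of (dbl M) - recip_of ?N - recip_of
          ?N))))"
    by (intro is_zero_add is_zero_minus w M recip_of_dbl M2)
  then have r: "is_zero w (rat_of (half ^\<^sub>Q n) - (recip_of ?N + recip_of ?N + recip_of ?N +
      recip_of ?N))" by (simp add: algebra_simps)
  have rel: "half ^\<^sub>Q n \<in> elems w Rat" using n by simp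
  from sign_test[OF w N el(2)] show ?thesis
  proof
    assume "nonneg w (recip_of ?N - approx d (dbl ?N))"
    from close_point[OF w ms dist d N el rel r this] that(2) show ?thesis by blast
  qed (rule that(1))
qed

lemma not_pos_if_zero:
  assumes w: "world w" and d: "d \<in> elems w (Seq Rat)" and "w \<Vdash> d =\<^sub>R 0\<^sub>R" "w \<Vdash> 0\<^sub>R <\<^sub>R d"
  shows P
proof -
  note [simp] = d d[THEN elems_sort]
  obtain m where m: "posnat w m" "positive w (approx d (dbl m) - approx 0\<^sub>R (dbl m) - recip_of m)"
    by (rule rless_E[OF assms(4) w]) simp_all
  note m2 = posnat_dbl[OF w m(1)] and [simp] = posnat_elems[OF m(1)] posnat_elems[OF m(1),
      THEN elems_sort]
  have "nonneg w (recip_of (dbl m) + recip_of (dbl m) - (approx d (dbl m) - approx 0\<^sub>R (dbl m)))"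
    by (rule req_E(1)[OF assms(3) w d _ m2]) simp
  from pos_nonneg_add[OF w m(2) nonneg_add[OF w this is_zero_nonneg(1)[OF w recip_of_dbl[OF w
      m(1)]]]]
  have "positive w 0" by (simp add: algebra_simps)
  then show P using not_pos_0[OF w] by blast
qed

text \<open>
  If \<open>d = 0\<close> there are points of \<open>Q\<close> at every distance from \<open>x\<close>, whatever the sequence \<open>a\<close>.
\<close>

lemma zero_distance_LPO:
  assumes w: "world w" and ms: "w \<Vdash> metric_space" and sub: "w \<Vdash> subset_Q"
      and ce: "w \<Vdash> complete_enough x"
    and apart: "w \<Vdash> (\<^bold>\<forall>z:Pt. z \<noteq>\<^sub>X x \<^bold>\<or> \<^bold>\<not> z \<in>\<^sub>Q)" and x: "x \<in> elems w Pt" and d: "d \<in> elems w (Seq Rat)"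
    and real: "w \<Vdash> is_real d" and dist: "w \<Vdash> is_dist_Q x d" and zero: "w \<Vdash> d =\<^sub>R 0\<^sub>R"
  shows "w \<Vdash> LPO"
  unfolding LPO_def
proof (rule holds_Forall_ImpI[OF w])
  show "definable (fst w) [Seq Nat] (\<lambda>ts. binary (hd ts) \<^bold>\<longrightarrow>
      (\<^bold>\<forall>\<^sup>+n. zero_at (hd ts) n) \<^bold>\<or> (\<^bold>\<exists>\<^sup>+n. one_at (hd ts) n))"
    by (intro definable_intros; simp)
  fix v a assume v: "w \<sqsubseteq> v" and a: "a \<in> elems v (Seq Nat)" and bin: "v \<Vdash> binary a"
  note vv = ext_world[OF v]
  have "(v \<Vdash> (\<^bold>\<forall>\<^sup>+n. zero_at a n)) \<or> (v \<Vdash> (\<^bold>\<exists>\<^sup>+n. one_at a n))"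
  proof (rule search_decides[OF vv holds_mono[OF ms v] holds_mono[OF sub v] holds_mono[OF ce v]
        holds_mono[OF apart v] elems_mono[OF x v] a bin])
    fix u n assume vu: "v \<sqsubseteq> u" and n: "posnat u n"
    have u: "w \<sqsubseteq> u" by (rule ext_trans[OF v vu])
    note uu = ext_world[OF u]
    from near_or_pos[OF uu holds_mono[OF ms u] holds_mono[OF dist u] holds_mono[OF real u]
        elems_mono[OF x u] elems_mono[OF d u] posnat_elems[OF n]]
    obtain q where "q \<in> elems u Pt" "u \<Vdash> q \<in>\<^sub>Q" "u \<Vdash> \<rho> q x <\<^sub>R 2\<^sup>-\<^sup>n"
      using not_pos_if_zero[OF uu elems_mono[OF d u] holds_mono[OF zero u]] by blast
    then show "\<exists>q\<in>elems u Pt. (u \<Vdash> q \<in>\<^sub>Q) \<and> ((u \<Vdash> none_before a n) \<longrightarrow> (u \<Vdash> \<rho> q x <\<^sub>R 2\<^sup>-\<^sup>n))" by blast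
  qed
  moreover have "sentence v (\<^bold>\<forall>\<^sup>+n. zero_at a n)" "sentence v (\<^bold>\<exists>\<^sup>+n. one_at a n)"
    unfolding sentence_iff by (intro definable_intros; use a in simp)+
  ultimately show "v \<Vdash> (\<^bold>\<forall>\<^sup>+n. zero_at a n) \<^bold>\<or> (\<^bold>\<exists>\<^sup>+n. one_at a n)"
    using vv by (auto intro: holds_OrI1 holds_OrI2)
qed

lemma small_distance_zero:
  assumes w: "world w" and ms: "w \<Vdash> metric_space" and x: "x \<in> elems w Pt"
      and d: "d \<in> elems w (Seq Rat)"
    and real: "w \<Vdash> is_real d" and dist: "w \<Vdash> is_dist_Q x d"
    and small: "\<And>v n. w \<sqsubseteq> v \<Longrightarrow> posnat v n \<Longrightarrow> nonneg v (recip_of n - approx d (dbl n))"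
  shows "w \<Vdash> d =\<^sub>R 0\<^sub>R"
proof (rule req_I[OF w d])
  fix v n assume v: "w \<sqsubseteq> v" and n: "posnat v n"
  note vv = ext_world[OF v] and dv = elems_mono[OF d v]
  note n2 = posnat_dbl[OF vv n] and n4 = posnat_dbl[OF vv posnat_dbl[OF vv n]]
  note [simp] = dv dv[THEN elems_sort] posnat_elems[OF n] posnat_elems[OF n, THEN elems_sort]
  have "nonneg v ((recip_of (dbl n) - approx d (dbl (dbl n))) + ((recip_of n + recip_of (dbl (dbl
      n)) - (approx d n - approx d (dbl (dbl n)))) +
      ((recip_of n - recip_of (dbl n) - recip_of (dbl n)) + ((recip_of (dbl n) - recip_of (dbl
          (dbl n)) - recip_of (dbl (dbl n))) + recip_of (dbl (dbl n))))))"
    by (intro nonneg_add vv small[OF v n2] is_real_E[OF holds_mono[OF real v] vv dv n n4]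
        is_zero_nonneg(1)[OF vv recip_of_dbl[OF vv n]] is_zero_nonneg(1)[OF vv recip_of_dbl[OF vv
            n2]] pos_nonneg[OF vv recip_of_pos[OF vv n4]])
  then show "nonneg v (recip_of n + recip_of n - (approx d n - approx 0\<^sub>R n))"
      by (simp add: algebra_simps)
  show "nonneg v (recip_of n + recip_of n - (approx 0\<^sub>R n - approx d n))"
    using pos_nonneg[OF vv dist_lower_bound[OF vv holds_mono[OF ms v] holds_mono[OF dist v]
        holds_mono[OF real v] n elems_mono[OF x v] dv]]
    by simp
qed simp

text \<open>
  The sequence \<open>a\<close> records which alternative of the approximate tests was found.  The bound is
  \<open>2\<^sup>-\<^sup>n\<^sup>-\<^sup>1\<close> in the \<open>n\<close>-th test because \<open>search_decides\<close> only knows the tests before \<open>n\<close> when it asks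
  for a point within \<open>2\<^sup>-\<^sup>n\<close>.  For \<open>n = 1\<close> there is no earlier test, so that this case is settled in
  advance; it also provides a point of \<open>Q\<close> to fall back on.
\<close>

lemma distance_decides:
  assumes w: "world w" and ms: "w \<Vdash> metric_space" and sub: "w \<Vdash> subset_Q"
      and ce: "w \<Vdash> complete_enough x"
    and apart: "w \<Vdash> (\<^bold>\<forall>z:Pt. z \<noteq>\<^sub>X x \<^bold>\<or> \<^bold>\<not> z \<in>\<^sub>Q)" and x: "x \<in> elems w Pt" and d: "d \<in> elems w (Seq Rat)"
    and real: "w \<Vdash> is_real d" and dist: "w \<Vdash> is_dist_Q x d"
  shows "(w \<Vdash> 0\<^sub>R <\<^sub>R d) \<or> (w \<Vdash> d =\<^sub>R 0\<^sub>R)"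
proof (cases rule: near_or_pos[OF w ms dist real x d posnat_elems[OF posnat_one[OF w]]])
  case (2 b)
  define S where "S n = ((\<^bold>\<exists>z:Pt. z \<in>\<^sub>Q \<^bold>\<and> \<rho> z x <\<^sub>R 2\<^sup>-\<^sup>(succ n)) \<^bold>\<and> d \<cdot>\<^sub>Q dbl n \<le>\<^sub>Q recip n)" for n
  define F where "F n y = ((y =\<^sub>N 0\<^sub>N \<^bold>\<and> S n) \<^bold>\<or> (y =\<^sub>N 1\<^sub>N \<^bold>\<and> 0\<^sub>R <\<^sub>R d))" for n y
  note [simp] = x d
  \<comment> \<open>Each of the two tests either finds that \<open>d > 0\<close> or gives one conjunct of \<open>S n\<close>.\<close>
  have total: "\<exists>y\<in>elems v Nat. v \<Vdash> F n y" if v: "w \<sqsubseteq> v" and n: "posnat v n" for v n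
  proof -
    note vv = ext_world[OF v] and dv = elems_mono[OF d v] and xv = elems_mono[OF x v]
    note [simp] = dv dv[THEN elems_sort] xv posnat_elems[OF n] posnat_elems[OF n, THEN elems_sort]
    have sn: "succ n \<in> elems v Nat" by simp
    have dz: "definable (fst v) [Pt] (\<lambda>ts. hd ts \<in>\<^sub>Q \<^bold>\<and> \<rho> (hd ts) x <\<^sub>R 2\<^sup>-\<^sup>(succ n))"
        by (intro definable_intros; simp)
    have ok: "sentence v (0\<^sub>N =\<^sub>N 0\<^sub>N \<^bold>\<and> S n)" "sentence v (1\<^sub>N =\<^sub>N 1\<^sub>N \<^bold>\<and> 0\<^sub>R <\<^sub>R d)"
      "sentence v (1\<^sub>N =\<^sub>N 0\<^sub>N \<^bold>\<and> S n)" "sentence v (0\<^sub>N =\<^sub>N 1\<^sub>N \<^bold>\<and> 0\<^sub>R <\<^sub>R d)"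
      unfolding sentence_iff S_def by (intro definable_intros; simp)+
    have one: ?thesis if "v \<Vdash> 0\<^sub>R <\<^sub>R d"
    proof -
      have "v \<Vdash> F n 1\<^sub>N" unfolding F_def using that vv ok
        by (intro holds_OrI2) (simp_all add: holds_And holds_refl)
      then show ?thesis by (intro bexI[of _ "1\<^sub>N"]) simp_all
    qed
    from sign_test[OF vv n dv] show ?thesis
    proof
      assume small: "nonneg v (recip_of n - approx d (dbl n))"
      show ?thesis
      proof (cases rule: near_or_pos[OF vv holds_mono[OF ms v] holds_mono[OF dist v] holds_mono[OF
          real v] xv dv sn])
        case (2 z)
        have "v \<Vdash> (\<^bold>\<exists>z:Pt. z \<in>\<^sub>Q \<^bold>\<and> \<rho> z x <\<^sub>R 2\<^sup>-\<^sup>(succ n))"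
          by (rule holds_ExistsI[OF _ 2(1) dz vv]) (use 2 vv in \<open>simp add: holds_And\<close>)
        moreover have "v \<Vdash> d \<cdot>\<^sub>Q dbl n \<le>\<^sub>Q recip n" using small vv by (simp add: le_iff recip_of_def)
        ultimately have "v \<Vdash> S n" using vv by (simp add: S_def holds_And)
        then have "v \<Vdash> F n 0\<^sub>N" unfolding F_def using vv ok
          by (intro holds_OrI1) (simp_all add: holds_And holds_refl)
        then show ?thesis by (intro bexI[of _ "0\<^sub>N"]) simp_all
      qed (rule one)
    qed (rule one)
  qed
  have zero_el: "0\<^sub>N \<in> elems w Nat" by simp
  obtain a where a: "a \<in> elems w (Seq Nat)" "w \<Vdash> (\<^bold>\<forall>\<^sup>+n. F n (a \<cdot>\<^sub>N n))"
    by (rule holds_choice_pos[OF w zero_el, of F])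
      (unfold F_def S_def, (intro definable_intros; simp)+, fold S_def, fold F_def,
          blast intro: total)
  have Fa: "v \<Vdash> F n (a \<cdot>\<^sub>N n)" if v: "w \<sqsubseteq> v" and n: "posnat v n" for v n
    by (rule holds_Forall_posE[OF holds_mono[OF a(2) v] _ n ext_world[OF v]])
      (unfold F_def S_def, intro definable_intros; use elems_mono[OF x v] elems_mono[OF d v]
          elems_mono[OF a(1) v] in simp)
  have cases_a: "((v \<Vdash> zero_at a n) \<and> (v \<Vdash> S n)) \<or> ((v \<Vdash> one_at a n) \<and> (v \<Vdash> 0\<^sub>R <\<^sub>R d))"
    if v: "w \<sqsubseteq> v" and n: "posnat v n" for v n
    using holds_OrE[OF Fa[OF v n, unfolded F_def] ext_world[OF v]] holds_And[OF ext_world[OF v]]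
        by blast
  have S_if_zero: "v \<Vdash> S n" if v: "w \<sqsubseteq> v" and n: "posnat v n" and "v \<Vdash> zero_at a n" for v n
    using cases_a[OF v n] zero_not_one[OF that(3) _ ext_world[OF v]] by blast
  have bin: "w \<Vdash> binary a" unfolding binary_def
  proof (rule holds_Forall_posI[OF w])
    show dz: "definable (fst w) [Nat] (\<lambda>ts. zero_at a (hd ts) \<^bold>\<or> one_at a (hd ts))"
      by (intro definable_intros; use a in simp)
    fix v n assume v: "w \<sqsubseteq> v" and n: "posnat v n"
    have ok: "sentence v (zero_at a n)" "sentence v (one_at a n)"
      using sentence_definable[OF dz v posnat_elems[OF n]] by (auto simp: sentence_def)
    show "v \<Vdash> zero_at a n \<^bold>\<or> one_at a n"
      using cases_a[OF v n] holds_OrI1[OF _ ext_world[OF v] ok(2)] holds_OrI2[OF _ ext_world[OF v]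
          ok(1)] by blast
  qed
  have "(w \<Vdash> (\<^bold>\<forall>\<^sup>+n. zero_at a n)) \<or> (w \<Vdash> (\<^bold>\<exists>\<^sup>+n. one_at a n))"
  proof (rule search_decides[OF w ms sub ce apart x a(1) bin])
    fix v n assume v: "w \<sqsubseteq> v" and n: "posnat v n"
    note vv = ext_world[OF v] and xv = elems_mono[OF x v] and bv = elems_mono[OF 2(1) v]
        and nel = posnat_elems[OF n]
    obtain k where k: "k \<in> elems v Nat" "v \<Vdash> n =\<^sub>N succ k" by (rule posnatE[OF n vv])
    have close: "v \<Vdash> \<rho> z x <\<^sub>R 2\<^sup>-\<^sup>n" if "z \<in> elems v Pt" "v \<Vdash> \<rho> z x <\<^sub>R 2\<^sup>-\<^sup>(succ m)" "v \<Vdash> n =\<^sub>N succ m"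
        for z m
      by (rule holds_subst[where F = "\<lambda>m. \<rho> z x <\<^sub>R 2\<^sup>-\<^sup>m", OF holds_sym[OF that(3) vv] that(2) _ vv])
        (intro definable_intros; use that(1) xv in simp)
    have "\<exists>q\<in>elems v Pt. (v \<Vdash> q \<in>\<^sub>Q) \<and> (v \<Vdash> \<rho> q x <\<^sub>R 2\<^sup>-\<^sup>n)" if none: "v \<Vdash> none_before a n"
    proof (cases rule: nat_cases[OF vv k(1)])
      case 1
      then have "v \<Vdash> succ k =\<^sub>N 1\<^sub>N" by (rule holds_cong1[OF vv]) simp_all
      then show ?thesis
        using close[OF bv holds_mono[OF 2(3) v] holds_trans[OF k(2) _ vv]] bv holds_mono[OF 2(2)
            v] by blast
    next
      case k': (2 i)
      note kp = posnatI[OF vv k']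
      have "succ k \<in> elems v Nat" using k(1) by simp
      from nle_subst[OF vv nle_refl[OF vv this] holds_refl[OF vv this] holds_sym[OF k(2) vv]]
      have "v \<Vdash> zero_at a k" by (rule none_beforeE[OF none vv elems_mono[OF a(1) v] nel kp])
      then have ex: "v \<Vdash> (\<^bold>\<exists>z:Pt. z \<in>\<^sub>Q \<^bold>\<and> \<rho> z x <\<^sub>R 2\<^sup>-\<^sup>(succ k))"
        using S_if_zero[OF v kp] vv by (simp add: S_def holds_And)
      have "definable (fst v) [Pt] (\<lambda>ts. hd ts \<in>\<^sub>Q \<^bold>\<and> \<rho> (hd ts) x <\<^sub>R 2\<^sup>-\<^sup>(succ k))"
          by (intro definable_intros; use xv k(1) in simp)
      from holds_ExistsE[OF ex this vv] obtain z where "z \<in> elems v Pt" "v \<Vdash> z \<in>\<^sub>Q \<^bold>\<and> \<rho> z x <\<^sub>R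
          2\<^sup>-\<^sup>(succ k)" .
      then show ?thesis using close[OF _ _ k(2)] holds_And[OF vv] by blast
    qed
    then show "\<exists>q\<in>elems v Pt. (v \<Vdash> q \<in>\<^sub>Q) \<and> ((v \<Vdash> none_before a n) \<longrightarrow> (v \<Vdash> \<rho> q x <\<^sub>R 2\<^sup>-\<^sup>n))"
      using bv holds_mono[OF 2(2) v] by blast
  qed
  then show ?thesis
  proof
    assume all: "w \<Vdash> (\<^bold>\<forall>\<^sup>+n. zero_at a n)"
    have "w \<Vdash> d =\<^sub>R 0\<^sub>R"
    proof (rule small_distance_zero[OF w ms x d real dist])
      fix v n assume v: "w \<sqsubseteq> v" and n: "posnat v n"
      note vv = ext_world[OF v] and dv = elems_mono[OF d v]
      have "v \<Vdash> zero_at a n"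
        by (rule holds_Forall_posE[OF holds_mono[OF all v] _ n vv]) (intro definable_intros; use
            elems_mono[OF a(1) v] in simp)
      then have "v \<Vdash> d \<cdot>\<^sub>Q dbl n \<le>\<^sub>Q recip n"
        using S_if_zero[OF v n] vv by (simp add: S_def holds_And)
      then show "nonneg v (recip_of n - approx d (dbl n))"
        using vv dv posnat_elems[OF n] by (simp add: le_iff recip_of_def)
    qed
    then show ?thesis ..
  next
    assume ex: "w \<Vdash> (\<^bold>\<exists>\<^sup>+n. one_at a n)"
    have "definable (fst w) [Nat] (\<lambda>ts. one_at a (hd ts))"
        by (intro definable_intros; use a(1) in simp)
    from holds_Exists_posE[OF ex this w] obtain n where n: "posnat w n" "w \<Vdash> one_at a n" .
    from cases_a[OF ext_refl[OF w] n(1)] show ?thesis using zero_not_one[OF _ n(2) w] by blast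
  qed
qed blast

theorem proposition6p2:
  shows "{} \<turnstile> metric_space \<^bold>\<and> subset_Q \<^bold>\<and> located_Q \<^bold>\<longrightarrow>
    (\<^bold>\<forall>x:Pt. complete_enough x \<^bold>\<and> (\<^bold>\<forall>z:Pt. z \<noteq>\<^sub>X x \<^bold>\<or> \<^bold>\<not> z \<in>\<^sub>Q) \<^bold>\<longrightarrow>
      (\<^bold>\<forall>\<^sub>Rd. is_dist_Q x d \<^bold>\<longrightarrow>
        (0\<^sub>R <\<^sub>R d \<^bold>\<or> d =\<^sub>R 0\<^sub>R) \<^bold>\<and> (d =\<^sub>R 0\<^sub>R \<^bold>\<longrightarrow> LPO)))"
proof (rule completeness)
  let ?H = "metric_space \<^bold>\<and> subset_Q \<^bold>\<and> located_Q"
  let ?C = "\<^bold>\<forall>x:Pt. complete_enough x \<^bold>\<and> (\<^bold>\<forall>z:Pt. z \<noteq>\<^sub>X x \<^bold>\<or> \<^bold>\<not> z \<in>\<^sub>Q) \<^bold>\<longrightarrow>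
      (\<^bold>\<forall>\<^sub>Rd. is_dist_Q x d \<^bold>\<longrightarrow>
        (0\<^sub>R <\<^sub>R d \<^bold>\<or> d =\<^sub>R 0\<^sub>R) \<^bold>\<and> (d =\<^sub>R 0\<^sub>R \<^bold>\<longrightarrow> LPO))"
  have ok: "definable N [] (\<lambda>_. ?H \<^bold>\<longrightarrow> ?C)" for N by (intro definable_intros; simp)
  then show "wf [] (?H \<^bold>\<longrightarrow> ?C)" by (simp only: definable_closed_iff)
  fix w0 assume "world w0"
  then show "w0 \<Vdash> ?H \<^bold>\<longrightarrow> ?C"
  proof (rule holds_ImpI)
    show "sentence w0 (?H \<^bold>\<longrightarrow> ?C)" using ok by (simp only: sentence_iff)
    fix w1 assume "w0 \<sqsubseteq> w1" and hyp: "w1 \<Vdash> ?H"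
    then have w1: "world w1" by (simp add: ext_world)
    show "w1 \<Vdash> ?C"
    proof (rule holds_Forall_ImpI[OF w1])
      fix w2 x assume w12: "w1 \<sqsubseteq> w2" and x: "x \<in> elems w2 Pt"
        and hyp_x: "w2 \<Vdash> complete_enough x \<^bold>\<and> (\<^bold>\<forall>z:Pt. z \<noteq>\<^sub>X x \<^bold>\<or> \<^bold>\<not> z \<in>\<^sub>Q)"
      note w2 = ext_world[OF w12]
      show "w2 \<Vdash> (\<^bold>\<forall>\<^sub>Rd. is_dist_Q x d \<^bold>\<longrightarrow> (0\<^sub>R <\<^sub>R d \<^bold>\<or> d =\<^sub>R 0\<^sub>R) \<^bold>\<and> (d =\<^sub>R 0\<^sub>R \<^bold>\<longrightarrow> LPO))"
        unfolding Forall_real_def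
      proof (rule holds_Forall_ImpI[OF w2])
        show "definable (fst w2) [Seq Rat] (\<lambda>ts. is_real (hd ts) \<^bold>\<longrightarrow> is_dist_Q x (hd ts) \<^bold>\<longrightarrow>
            (0\<^sub>R <\<^sub>R hd ts \<^bold>\<or> hd ts =\<^sub>R 0\<^sub>R) \<^bold>\<and> (hd ts =\<^sub>R 0\<^sub>R \<^bold>\<longrightarrow> LPO))"
          by (intro definable_intros; use x in simp)
        fix w3 d assume w23: "w2 \<sqsubseteq> w3" and d: "d \<in> elems w3 (Seq Rat)" and real: "w3 \<Vdash> is_real d"
        note w3 = ext_world[OF w23] and x3 = elems_mono[OF x w23]
        show "w3 \<Vdash> is_dist_Q x d \<^bold>\<longrightarrow> (0\<^sub>R <\<^sub>R d \<^bold>\<or> d =\<^sub>R 0\<^sub>R) \<^bold>\<and> (d =\<^sub>R 0\<^sub>R \<^bold>\<longrightarrow> LPO)"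
        proof (rule holds_ImpI[OF w3])
          show "sentence w3 (is_dist_Q x d \<^bold>\<longrightarrow> (0\<^sub>R <\<^sub>R d \<^bold>\<or> d =\<^sub>R 0\<^sub>R) \<^bold>\<and> (d =\<^sub>R 0\<^sub>R \<^bold>\<longrightarrow> LPO))"
            unfolding sentence_iff by (intro definable_intros; use x3 d in simp)
          fix w assume w3w: "w3 \<sqsubseteq> w" and dist: "w \<Vdash> is_dist_Q x d"
          note w = ext_world[OF w3w] and w2w = ext_trans[OF w23 w3w]
          note w1w = ext_trans[OF w12 w2w]
          note el = elems_mono[OF x w2w] elems_mono[OF d w3w]
          have ok: "sentence w (0\<^sub>R <\<^sub>R d)" "sentence w (d =\<^sub>R 0\<^sub>R)" "sentence w (d =\<^sub>R 0\<^sub>R \<^bold>\<longrightarrow> LPO)"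
            unfolding sentence_iff by (intro definable_intros; use el in simp)+
          have hyps: "w \<Vdash> metric_space" "w \<Vdash> subset_Q" "w \<Vdash> complete_enough x" "w \<Vdash> (\<^bold>\<forall>z:Pt. z \<noteq>\<^sub>X x
              \<^bold>\<or> \<^bold>\<not> z \<in>\<^sub>Q)"
            using holds_mono[OF hyp w1w] holds_mono[OF hyp_x w2w] w by (auto simp: holds_And)
          have "w \<Vdash> 0\<^sub>R <\<^sub>R d \<^bold>\<or> d =\<^sub>R 0\<^sub>R"
            using distance_decides[OF w hyps el holds_mono[OF real w3w] dist] ok w
            by (auto intro: holds_OrI1 holds_OrI2)
          moreover have "w \<Vdash> d =\<^sub>R 0\<^sub>R \<^bold>\<longrightarrow> LPO"
          proof (rule holds_ImpI[OF w ok(3)])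
            fix v assume v: "w \<sqsubseteq> v" and "v \<Vdash> d =\<^sub>R 0\<^sub>R"
            then show "v \<Vdash> LPO"
              by (intro zero_distance_LPO[OF ext_world[OF v] hyps[THEN holds_mono,
                  OF v] el[THEN elems_mono, OF v]
                    holds_mono[OF real ext_trans[OF w3w v]] holds_mono[OF dist v]])
          qed
          ultimately show "w \<Vdash> (0\<^sub>R <\<^sub>R d \<^bold>\<or> d =\<^sub>R 0\<^sub>R) \<^bold>\<and> (d =\<^sub>R 0\<^sub>R \<^bold>\<longrightarrow> LPO)"
            using w by (simp add: holds_And)
        qed
      qed
    qed (intro definable_intros; simp)
  qed
qed

end
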